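(* Let $k\ge1$, let $(\Omega_j,\mathcal F_j,H_j,P_j)$, $j\in\{1,\dots,k+1\}$, be projection valued measure spaces, and $P=P_1\otimes\cdots\otimes P_{k+1}$. Fix $\varphi\in L^\infty(\Omega_1,P_1)\hat\otimes_i\cdots\hat\otimes_iL^\infty(\Omega_{k+1},P_{k+1})$, an $L^\infty_P$-integral projective decomposition $(\Sigma,\rho,\varphi_1,\dots,\varphi_{k+1})$ of $\varphi$, and $b=(b_1,\dots,b_k)\in B(H_2;H_1)\times\cdots\times B(H_{k+1};H_k)$. If $b_j\in\mathcal S_1(H_{j+1};H_j)$ for some $j\in\{1,\dots,k\}$, then $$\Sigma\ni\sigma\mapsto P_1(\varphi_1(\cdot,\sigma))\,b_1\cdots P_k(\varphi_k(\cdot,\sigma))\,b_k\,P_{k+1}(\varphi_{k+1}(\cdot,\sigma))\in\mathcal S_1(H_{k+1};H_1)$$ is Gel'fand--Pettis integrable as a map $\Sigma\to(\mathcal S_1(H_{k+1};H_1),\|\cdot\|_{\mathcal S_1})$, and its Gel'fand--Pettis integral (over $\Sigma$) is $I^{\boldsymbol P}(\Sigma,\rho,\varphi_1,\dots,\varphi_{k+1})[b]\in\mathcal S_1(H_{k+1};H_1)$.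
   Context: Hilbert spaces are complex (not assumed separable), inner products linear in the first argument. $\mathcal S_1(H;K)$ is the space of trace class operators $H\to K$ with trace norm $\|A\|_{\mathcal S_1}=\operatorname{Tr}((A^*A)^{1/2})$. A projection valued measure space $(\Xi,\mathcal G,K,Q)$: $(\Xi,\mathcal G)$ measurable space, $K$ Hilbert space, $Q:\mathcal G\to B(K)$ with $Q(\Xi)=\mathrm{id}_K$, $Q(G)^2=Q(G)=Q(G)^*$, countably additive in the weak operator topology. $L^\infty(\Xi,Q)$: $Q$-a.e. classes of bounded measurable functions, $\|f\|_{L^\infty(Q)}=\inf\{c\ge0:Q(|f|>c)=0\}$. For $f\in L^\infty(\Xi,Q)$, $Q(f)\in B(K)$ is given by $\langle Q(f)h,k\rangle=\int f\,dQ_{h,k}$, $Q_{h,k}(G)=\langle Q(G)h,k\rangle$. $P=P_1\otimes\cdots\otimes P_{k+1}$ is the unique projection valued measure on $\Omega=\prod_j\Omega_j$ with the product $\sigma$-algebra, acting on the Hilbert space tensor product of the $H_j$, with $P(G_1\times\cdots\times G_{k+1})=P_1(G_1)\otimes\cdots\otimes P_{k+1}(G_{k+1})$. Upper integral of arbitrary $h:\Sigma\to[0,\infty]$: $\overline{\int_\Sigma}h\,d\rho=\inf\{\int\tilde h\,d\rho:h\le\tilde h\ \rho\text{-a.e.},\ \tilde h\text{ measurable}\}$. An $L^\infty_P$-integral projective decomposition of $\varphi:\Omega\to\mathbb C$: a tuple $(\Sigma,\rho,\varphi_1,\dots,\varphi_{k+1})$ with $(\Sigma,\mathcal H,\rho)$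 $\sigma$-finite, $\varphi_j:\Omega_j\times\Sigma\to\mathbb C$ measurable, (i) $\varphi_j(\cdot,\sigma)\in L^\infty(\Omega_j,P_j)$ for all $j,\sigma$; (ii) $\overline{\int_\Sigma}\prod_{j}\|\varphi_j(\cdot,\sigma)\|_{L^\infty(P_j)}\,\rho(d\sigma)<\infty$; (iii) $\varphi(\omega_1,\dots,\omega_{k+1})=\int_\Sigma\prod_j\varphi_j(\omega_j,\sigma)\,\rho(d\sigma)$ for $P$-a.e. $(\omega_1,\dots,\omega_{k+1})$. $L^\infty(\Omega_1,P_1)\hat\otimes_i\cdots\hat\otimes_iL^\infty(\Omega_{k+1},P_{k+1})$ is the set of $P$-a.e. classes of functions admitting such a decomposition. $I^{\boldsymbol P}(\Sigma,\rho,\varphi_1,\dots,\varphi_{k+1})[b]:=\int_\Sigma P_1(\varphi_1(\cdot,\sigma))\,b_1\cdots P_k(\varphi_k(\cdot,\sigma))\,b_k\,P_{k+1}(\varphi_{k+1}(\cdot,\sigma))\,\rho(d\sigma)\in B(H_{k+1};H_1)$ is a pointwise Pettis integral, i.e. the unique bounded operator $T$ with $\langle Th,h'\rangle=\int_\Sigma\langle F(\sigma)h,h'\rangle\,\rho(d\sigma)$ for all $h\in H_{k+1},h'\in H_1$, $F$ being the integrand (whose matrix coefficients are measurable and integrable). A map $F:\Sigma\to V$ into a Banach space is Gel'fand--Pettis integrable if $\ell\circ F$ is measurable and $\int|\ell\circ F|\,d\rho<\infty$ for all $\ell\in V^*$ and for every $S\in\mathcal H$ there is $\int_SF\,d\rho\in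 V$ with $\ell(\int_SF\,d\rho)=\int_S\ell\circ F\,d\rho$ for all $\ell\in V^*$. *)

theory Defs
  imports "HOL-Analysis.Analysis"
begin

section \<open>Complex Hilbert spaces\<close>

class scaleC =
  fixes scaleC :: "complex \<Rightarrow> 'a \<Rightarrow> 'a" (infixr "*\<^sub>C" 75)

class complex_vector = scaleC + real_vector +
  assumes scaleC_add_right: "a *\<^sub>C (x + y) = a *\<^sub>C x + a *\<^sub>C y"
    and scaleC_add_left: "(a + b) *\<^sub>C x = a *\<^sub>C x + b *\<^sub>C x"
    and scaleC_scaleC: "a *\<^sub>C (b *\<^sub>C x) = (a * b) *\<^sub>C x"
    and scaleC_of_real: "complex_of_real r *\<^sub>C x = r *\<^sub>R x"

class complex_normed_vector = complex_vector + real_normed_vector +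
  assumes norm_scaleC: "norm (a *\<^sub>C x) = cmod a * norm x"

text \<open>
  The underlying real inner product is the real part of the complex one, so that the norm, the
  topology and positive definiteness are those of the library class of real inner product spaces.
  The complex inner product is linear in its first argument.
\<close>

class complex_hilbert = complex_normed_vector + real_inner + complete_space +
  fixes cinner :: "'a \<Rightarrow> 'a \<Rightarrow> complex"
  assumes cinner_commute: "cinner x y = cnj (cinner y x)"
    and cinner_add_left: "cinner (x + y) z = cinner x z + cinner y z"
    and cinner_scaleC_left: "cinner (a *\<^sub>C x) y = a * cinner x y"
    and Re_cinner: "Re (cinner x y) = inner x y"

instantiation complex :: complex_hilbert
begin

definition scaleC_complex :: "complex \<Rightarrow> complex \<Rightarrow> complex" where
  "scaleC_complex a x = a * x"

definition cinner_complex :: "complex \<Rightarrow> complex \<Rightarrow> complex" where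
  "cinner_complex x y = x * cnj y"

instance
  by standard
    (auto simp: scaleC_complex_def cinner_complex_def algebra_simps norm_mult
      inner_complex_def scaleR_conv_of_real)

end

lemma bounded_linear_scaleC:
  "bounded_linear (\<lambda>x :: 'a :: complex_normed_vector. a *\<^sub>C x)"
proof (rule bounded_linear_intro)
  fix x y :: 'a and r :: real
  show "a *\<^sub>C (x + y) = a *\<^sub>C x + a *\<^sub>C y" by (rule scaleC_add_right)
  show "a *\<^sub>C (r *\<^sub>R x) = r *\<^sub>R (a *\<^sub>C x)"
    by (simp add: scaleC_of_real [symmetric] scaleC_scaleC mult.commute)
  show "norm (a *\<^sub>C x) \<le> norm x * cmod a" by (simp add: norm_scaleC)
qed

instantiation blinfun :: (real_normed_vector, complex_normed_vector) complex_normed_vector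
begin

lift_definition scaleC_blinfun :: "complex \<Rightarrow> ('a \<Rightarrow>\<^sub>L 'b) \<Rightarrow> ('a \<Rightarrow>\<^sub>L 'b)"
  is "\<lambda>a f x. a *\<^sub>C f x"
  by (rule bounded_linear_compose [OF bounded_linear_scaleC])

instance
proof
  fix a b :: complex and r :: real and x y :: "'a \<Rightarrow>\<^sub>L 'b"
  show "a *\<^sub>C (x + y) = a *\<^sub>C x + a *\<^sub>C y"
    by transfer (simp add: scaleC_add_right)
  show "(a + b) *\<^sub>C x = a *\<^sub>C x + b *\<^sub>C x"
    by transfer (simp add: scaleC_add_left)
  show "a *\<^sub>C (b *\<^sub>C x) = (a * b) *\<^sub>C x"
    by transfer (simp add: scaleC_scaleC)
  show "complex_of_real r *\<^sub>C x = r *\<^sub>R x"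
    by transfer (simp add: scaleC_of_real)
  show "norm (a *\<^sub>C x) = cmod a * norm x"
  proof (cases "a = 0")
    case True
    have "(0 :: complex) *\<^sub>C x = 0"
      using scaleC_of_real [where ?'a = 'b and r = 0] by transfer simp
    with True show ?thesis by simp
  next
    case False
    have le: "norm (c *\<^sub>C z) \<le> cmod c * norm z" for c and z :: "'a \<Rightarrow>\<^sub>L 'b"
      by (rule norm_blinfun_bound)
        (simp_all add: scaleC_blinfun.rep_eq norm_scaleC mult.assoc mult_left_mono norm_blinfun)
    have "inverse a *\<^sub>C (a *\<^sub>C x) = x"
      using False scaleC_of_real [where ?'a = 'b and r = 1] by transfer (simp add: scaleC_scaleC)
    then have "norm x \<le> cmod (inverse a) * norm (a *\<^sub>C x)"
      using le [of "inverse a" "a *\<^sub>C x"] by simp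
    then have "cmod a * norm x \<le> norm (a *\<^sub>C x)"
      using False by (simp add: norm_divide field_simps)
    with le [of a x] show ?thesis by simp
  qed
qed

end

definition closed_csubspace :: "'a::complex_hilbert set \<Rightarrow> bool" where
  "closed_csubspace H \<longleftrightarrow> closed H \<and> 0 \<in> H \<and>
     (\<forall>x\<in>H. \<forall>y\<in>H. x + y \<in> H) \<and> (\<forall>a. \<forall>x\<in>H. a *\<^sub>C x \<in> H)"

definition is_onb :: "'a::complex_hilbert set \<Rightarrow> bool" where
  "is_onb E \<longleftrightarrow> (\<forall>x\<in>E. \<forall>y\<in>E. cinner x y = (if x = y then 1 else 0)) \<and>
     closed_csubspace hull E = UNIV"

section \<open>Bounded operators between the Hilbert spaces of a family\<close>

text \<open>
  A family of possibly different Hilbert spaces is given by closed subspaces of a common ambient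
  Hilbert space (any finite family sits in this way in its orthogonal direct sum).  A bounded
  operator from \<open>H\<close> to \<open>K\<close> is represented by its extension by \<open>0\<close> on the orthogonal complement
  of \<open>H\<close>.  This identification is isometric and respects composition, adjoints, square roots
  of positive operators and traces.
\<close>

definition bops :: "'a::complex_hilbert set \<Rightarrow> 'b::complex_hilbert set \<Rightarrow> ('a \<Rightarrow>\<^sub>L 'b) set" where
  "bops H K = {T :: 'a \<Rightarrow>\<^sub>L 'b. (\<forall>a x. T (a *\<^sub>C x) = a *\<^sub>C T x) \<and> range T \<subseteq> K \<and>
     (\<forall>x. (\<forall>y\<in>H. cinner x y = 0) \<longrightarrow> T x = 0)}"

definition cadj :: "('a::complex_hilbert \<Rightarrow>\<^sub>L 'b::complex_hilbert) \<Rightarrow> ('b \<Rightarrow>\<^sub>L 'a)" where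
  "cadj A = (THE B :: 'b \<Rightarrow>\<^sub>L 'a. \<forall>x y. cinner (A x) y = cinner x (B y))"

definition positive_op :: "('a::complex_hilbert \<Rightarrow>\<^sub>L 'a) \<Rightarrow> bool" where
  "positive_op T \<longleftrightarrow> T \<in> bops UNIV UNIV \<and> (\<forall>x. cinner (T x) x \<in> \<real> \<and> 0 \<le> Re (cinner (T x) x))"

definition sqrt_op :: "('a::complex_hilbert \<Rightarrow>\<^sub>L 'a) \<Rightarrow> ('a \<Rightarrow>\<^sub>L 'a)" where
  "sqrt_op T = (THE S. positive_op S \<and> S o\<^sub>L S = T)"

text \<open>The trace of a positive operator, in \<open>[0, \<infinity>]\<close>; it does not depend on the chosen basis.\<close>

definition trace_pos :: "('a::complex_hilbert \<Rightarrow>\<^sub>L 'a) \<Rightarrow> ennreal" where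
  "trace_pos T = (\<Sum>\<^sub>\<infinity>e\<in>(SOME E. is_onb E). ennreal (Re (cinner (T e) e)))"

definition trace_class ::
  "'a::complex_hilbert set \<Rightarrow> 'b::complex_hilbert set \<Rightarrow> ('a \<Rightarrow>\<^sub>L 'b) set" where
  "trace_class H K = {A \<in> bops H K. trace_pos (sqrt_op (cadj A o\<^sub>L A)) < \<infinity>}"

definition trace_norm :: "('a::complex_hilbert \<Rightarrow>\<^sub>L 'b::complex_hilbert) \<Rightarrow> real" where
  "trace_norm A = enn2real (trace_pos (sqrt_op (cadj A o\<^sub>L A)))"

section \<open>Projection valued measures\<close>

text \<open>Only the underlying set and the \<open>\<sigma>\<close>-algebra of \<open>M\<close> are used.\<close>

definition pvm ::
  "'w measure \<Rightarrow> 'a::complex_hilbert set \<Rightarrow> ('w set \<Rightarrow> 'a \<Rightarrow>\<^sub>L 'a) \<Rightarrow> bool" where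
  "pvm M K Q \<longleftrightarrow> closed_csubspace K \<and>
     (\<forall>G\<in>sets M. Q G \<in> bops K K \<and> Q G o\<^sub>L Q G = Q G \<and> cadj (Q G) = Q G) \<and>
     (\<forall>x\<in>K. Q (space M) x = x) \<and>
     (\<forall>G :: nat \<Rightarrow> 'w set. range G \<subseteq> sets M \<longrightarrow> disjoint_family G \<longrightarrow>
        (\<forall>h\<in>K. \<forall>k\<in>K. (\<lambda>n. cinner (Q (G n) h) k) sums cinner (Q (\<Union>n. G n) h) k))"

definition Linfty ::
  "'w measure \<Rightarrow> ('w set \<Rightarrow> 'a::complex_hilbert \<Rightarrow>\<^sub>L 'a) \<Rightarrow> ('w \<Rightarrow> complex) set" where
  "Linfty M Q = {f \<in> borel_measurable M. \<exists>c\<ge>0. Q {w \<in> space M. c < cmod (f w)} = 0}"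

definition Linfty_norm ::
  "'w measure \<Rightarrow> ('w set \<Rightarrow> 'a::complex_hilbert \<Rightarrow>\<^sub>L 'a) \<Rightarrow> ('w \<Rightarrow> complex) \<Rightarrow> real" where
  "Linfty_norm M Q f = Inf {c. 0 \<le> c \<and> Q {w \<in> space M. c < cmod (f w)} = 0}"

text \<open>
  The integral of \<open>f\<close> with respect to a complex measure \<open>\<nu>\<close>, by a decomposition
  \<open>\<nu> = (\<mu>\<^sub>0 - \<mu>\<^sub>2) + \<i> (\<mu>\<^sub>1 - \<mu>\<^sub>3)\<close> into finite positive measures; the value does not depend on
  the decomposition.
\<close>

definition has_cmeasure_integral ::
  "'w measure \<Rightarrow> ('w set \<Rightarrow> complex) \<Rightarrow> ('w \<Rightarrow> complex) \<Rightarrow> complex \<Rightarrow> bool" where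
  "has_cmeasure_integral M \<nu> f I \<longleftrightarrow>
     (\<exists>\<mu> :: nat \<Rightarrow> 'w measure.
        (\<forall>n<4. finite_measure (\<mu> n) \<and> sets (\<mu> n) = sets M \<and> integrable (\<mu> n) f) \<and>
        (\<forall>G\<in>sets M. \<nu> G = (\<Sum>n<4. \<i> ^ n * complex_of_real (measure (\<mu> n) G))) \<and>
        I = (\<Sum>n<4. \<i> ^ n * (\<integral>w. f w \<partial>\<mu> n)))"

definition pvm_integral ::
  "'w measure \<Rightarrow> 'a::complex_hilbert set \<Rightarrow> ('w set \<Rightarrow> 'a \<Rightarrow>\<^sub>L 'a) \<Rightarrow> ('w \<Rightarrow> complex) \<Rightarrow> 'a \<Rightarrow>\<^sub>L 'a"
  where
  "pvm_integral M K Q f = (THE T. T \<in> bops K K \<and>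
     (\<forall>h\<in>K. \<forall>k\<in>K. has_cmeasure_integral M (\<lambda>G. cinner (Q G h) k) f (cinner (T h) k)))"

section \<open>Tensor products\<close>

text \<open>
  \<open>K\<close> is a realization of the Hilbert space tensor product of the \<open>H i\<close>, with \<open>tens x\<close> the
  elementary tensor of the family \<open>x\<close>.
\<close>

definition hilbert_tensor_product ::
  "'i set \<Rightarrow> ('i \<Rightarrow> 'a::complex_hilbert set) \<Rightarrow> 't::complex_hilbert set \<Rightarrow>
    (('i \<Rightarrow> 'a) \<Rightarrow> 't) \<Rightarrow> bool" where
  "hilbert_tensor_product I H K tens \<longleftrightarrow>
     (\<forall>x\<in>Pi\<^sub>E I H. \<forall>i\<in>I. \<forall>u\<in>H i. \<forall>v\<in>H i.
        tens (x(i := u + v)) = tens (x(i := u)) + tens (x(i := v))) \<and>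
     (\<forall>x\<in>Pi\<^sub>E I H. \<forall>i\<in>I. \<forall>u\<in>H i. \<forall>a.
        tens (x(i := a *\<^sub>C u)) = a *\<^sub>C tens (x(i := u))) \<and>
     (\<forall>x\<in>Pi\<^sub>E I H. \<forall>y\<in>Pi\<^sub>E I H. cinner (tens x) (tens y) = (\<Prod>i\<in>I. cinner (x i) (y i))) \<and>
     K = closed_csubspace hull (tens ` Pi\<^sub>E I H)"

definition is_product_pvm ::
  "'i set \<Rightarrow> ('i \<Rightarrow> 'w measure) \<Rightarrow> ('i \<Rightarrow> 'a::complex_hilbert set) \<Rightarrow> ('i \<Rightarrow> 'w set \<Rightarrow> 'a \<Rightarrow>\<^sub>L 'a) \<Rightarrow>
    't::complex_hilbert set \<Rightarrow> (('i \<Rightarrow> 'a) \<Rightarrow> 't) \<Rightarrow> (('i \<Rightarrow> 'w) set \<Rightarrow> 't \<Rightarrow>\<^sub>L 't) \<Rightarrow> bool" where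
  "is_product_pvm I M H Q K tens P \<longleftrightarrow> pvm (Pi\<^sub>M I M) K P \<and>
     (\<forall>G\<in>(\<Pi> i\<in>I. sets (M i)). \<forall>x\<in>Pi\<^sub>E I H.
        P (Pi\<^sub>E I G) (tens x) = tens (\<lambda>i\<in>I. Q i (G i) (x i)))"

section \<open>Integral projective decompositions\<close>

definition upper_nn_integral :: "'s measure \<Rightarrow> ('s \<Rightarrow> ennreal) \<Rightarrow> ennreal" where
  "upper_nn_integral \<rho> h =
     Inf {\<integral>\<^sup>+\<sigma>. g \<sigma> \<partial>\<rho> | g. g \<in> borel_measurable \<rho> \<and> (AE \<sigma> in \<rho>. h \<sigma> \<le> g \<sigma>)}"

text \<open>
  The functions \<open>\<phi>\<close> with \<open>integral_projective_decomposition I M Q P \<phi> \<rho> \<phi>s\<close> for some \<open>\<rho>\<close> and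
  \<open>\<phi>s\<close> represent the elements of the integral projective tensor product of the
  \<open>Linfty (M j) (Q j)\<close>, where \<open>P\<close> is the tensor product of the \<open>Q j\<close>.
\<close>

definition integral_projective_decomposition ::
  "'i set \<Rightarrow> ('i \<Rightarrow> 'w measure) \<Rightarrow> ('i \<Rightarrow> 'w set \<Rightarrow> 'a::complex_hilbert \<Rightarrow>\<^sub>L 'a) \<Rightarrow>
    (('i \<Rightarrow> 'w) set \<Rightarrow> 't::complex_hilbert \<Rightarrow>\<^sub>L 't) \<Rightarrow> (('i \<Rightarrow> 'w) \<Rightarrow> complex) \<Rightarrow>
    's measure \<Rightarrow> ('i \<Rightarrow> 'w \<Rightarrow> 's \<Rightarrow> complex) \<Rightarrow> bool" where
  "integral_projective_decomposition I M Q P \<phi> \<rho> \<phi>s \<longleftrightarrow>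
     sigma_finite_measure \<rho> \<and>
     (\<forall>j\<in>I. (\<lambda>(w, \<sigma>). \<phi>s j w \<sigma>) \<in> borel_measurable (M j \<Otimes>\<^sub>M \<rho>)) \<and>
     (\<forall>j\<in>I. \<forall>\<sigma>\<in>space \<rho>. (\<lambda>w. \<phi>s j w \<sigma>) \<in> Linfty (M j) (Q j)) \<and>
     upper_nn_integral \<rho> (\<lambda>\<sigma>. \<Prod>j\<in>I. ennreal (Linfty_norm (M j) (Q j) (\<lambda>w. \<phi>s j w \<sigma>))) < \<infinity> \<and>
     (\<exists>N\<in>sets (Pi\<^sub>M I M). P N = 0 \<and>
        (\<forall>w\<in>space (Pi\<^sub>M I M) - N.
           integrable \<rho> (\<lambda>\<sigma>. \<Prod>j\<in>I. \<phi>s j (w j) \<sigma>) \<and>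
           \<phi> w = (\<integral>\<sigma>. (\<Prod>j\<in>I. \<phi>s j (w j) \<sigma>) \<partial>\<rho>)))"

section \<open>The multiple operator integral and Gel'fand--Pettis integrals\<close>

text \<open>\<open>operator_product k A b = A 1 b 1 A 2 b 2 \<dots> A k b k A (k + 1)\<close>\<close>

definition operator_product ::
  "nat \<Rightarrow> (nat \<Rightarrow> 'a::complex_hilbert \<Rightarrow>\<^sub>L 'a) \<Rightarrow> (nat \<Rightarrow> 'a \<Rightarrow>\<^sub>L 'a) \<Rightarrow> 'a \<Rightarrow>\<^sub>L 'a" where
  "operator_product k A b = foldr (\<lambda>j T. A j o\<^sub>L b j o\<^sub>L T) [1..<k + 1] (A (k + 1))"

definition moi_integrand ::
  "nat \<Rightarrow> (nat \<Rightarrow> 'w measure) \<Rightarrow> (nat \<Rightarrow> 'a::complex_hilbert set) \<Rightarrow>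
    (nat \<Rightarrow> 'w set \<Rightarrow> 'a \<Rightarrow>\<^sub>L 'a) \<Rightarrow> (nat \<Rightarrow> 'w \<Rightarrow> 's \<Rightarrow> complex) \<Rightarrow>
    (nat \<Rightarrow> 'a \<Rightarrow>\<^sub>L 'a) \<Rightarrow> 's \<Rightarrow> 'a \<Rightarrow>\<^sub>L 'a" where
  "moi_integrand k M H Q \<phi>s b \<sigma> =
     operator_product k (\<lambda>j. pvm_integral (M j) (H j) (Q j) (\<lambda>w. \<phi>s j w \<sigma>)) b"

definition pointwise_pettis_integral ::
  "'a::complex_hilbert set \<Rightarrow> 'b::complex_hilbert set \<Rightarrow> 's measure \<Rightarrow> ('s \<Rightarrow> 'a \<Rightarrow>\<^sub>L 'b) \<Rightarrow> 'a \<Rightarrow>\<^sub>L 'b"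
  where
  "pointwise_pettis_integral H K \<rho> F = (THE T. T \<in> bops H K \<and>
     (\<forall>h\<in>H. \<forall>h'\<in>K. integrable \<rho> (\<lambda>\<sigma>. cinner (F \<sigma> h) h') \<and>
        cinner (T h) h' = (\<integral>\<sigma>. cinner (F \<sigma> h) h' \<partial>\<rho>)))"

definition moi ::
  "nat \<Rightarrow> (nat \<Rightarrow> 'w measure) \<Rightarrow> (nat \<Rightarrow> 'a::complex_hilbert set) \<Rightarrow>
    (nat \<Rightarrow> 'w set \<Rightarrow> 'a \<Rightarrow>\<^sub>L 'a) \<Rightarrow> 's measure \<Rightarrow> (nat \<Rightarrow> 'w \<Rightarrow> 's \<Rightarrow> complex) \<Rightarrow>
    (nat \<Rightarrow> 'a \<Rightarrow>\<^sub>L 'a) \<Rightarrow> 'a \<Rightarrow>\<^sub>L 'a" where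
  "moi k M H Q \<rho> \<phi>s b =
     pointwise_pettis_integral (H (k + 1)) (H 1) \<rho> (moi_integrand k M H Q \<phi>s b)"

text \<open>
  The remaining notions concern the normed space with underlying linear subspace \<open>V\<close> and norm \<open>N\<close>,
  which need not be the norm of the ambient type.  Values of a functional outside of \<open>V\<close> are
  irrelevant.
\<close>

definition dual_on :: "'v::complex_vector set \<Rightarrow> ('v \<Rightarrow> real) \<Rightarrow> ('v \<Rightarrow> complex) set" where
  "dual_on V N = {l. (\<forall>x\<in>V. \<forall>y\<in>V. l (x + y) = l x + l y) \<and>
     (\<forall>a. \<forall>x\<in>V. l (a *\<^sub>C x) = a * l x) \<and> (\<exists>C. \<forall>x\<in>V. cmod (l x) \<le> C * N x)}"

definition is_gp_integral ::
  "'v::complex_vector set \<Rightarrow> ('v \<Rightarrow> real) \<Rightarrow> 's measure \<Rightarrow> ('s \<Rightarrow> 'v) \<Rightarrow> 's set \<Rightarrow> 'v \<Rightarrow> bool" where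
  "is_gp_integral V N \<rho> F S v \<longleftrightarrow> v \<in> V \<and> (\<forall>l\<in>dual_on V N. l v = (LINT \<sigma>:S|\<rho>. l (F \<sigma>)))"

definition gp_integrable ::
  "'v::complex_vector set \<Rightarrow> ('v \<Rightarrow> real) \<Rightarrow> 's measure \<Rightarrow> ('s \<Rightarrow> 'v) \<Rightarrow> bool" where
  "gp_integrable V N \<rho> F \<longleftrightarrow> (\<forall>\<sigma>\<in>space \<rho>. F \<sigma> \<in> V) \<and>
     (\<forall>l\<in>dual_on V N. integrable \<rho> (\<lambda>\<sigma>. l (F \<sigma>))) \<and>
     (\<forall>S\<in>sets \<rho>. \<exists>v. is_gp_integral V N \<rho> F S v)"

definition gp_integral ::
  "'v::complex_vector set \<Rightarrow> ('v \<Rightarrow> real) \<Rightarrow> 's measure \<Rightarrow> ('s \<Rightarrow> 'v) \<Rightarrow> 's set \<Rightarrow> 'v" where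
  "gp_integral V N \<rho> F S = (THE v. is_gp_integral V N \<rho> F S v)"

end

theory Submission
  imports Defs
begin

text \<open>
  A trace class operator is an absolutely convergent series of rank one operators: if
  \<open>A = W |A|\<close> and \<open>|A| = R\<^sup>2\<close>, then \<open>A h = (\<Sum>e. \<langle>h, R e\<rangle> W R e)\<close> with \<open>(\<Sum>e. \<parallel>R e\<parallel>\<^sup>2) = \<parallel>A\<parallel>\<^sub>1\<close>, and the
  converse estimate is Bessel's inequality.  Inserting the series of the trace class factor \<open>b i\<close>
  turns the integrand into \<open>\<Sum>n. \<langle>\<cdot>, v n \<sigma>\<rangle> u n \<sigma>\<close>, where \<open>u n \<sigma>\<close> is the product of the factors to
  the left of \<open>b i\<close> applied to a fixed vector, and \<open>v n \<sigma>\<close> is the adjoint of the product of the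
  factors to the right of \<open>b i\<close> applied to a fixed vector.

  By a monotone class argument on the product \<open>\<sigma>\<close>-algebra, \<open>\<sigma> \<mapsto> P\<^sub>j(\<phi>\<^sub>j(\<cdot>, \<sigma>)) h\<close> is a pointwise limit
  of simple functions, also if the Hilbert space is not separable.  Hence \<open>u n\<close> and \<open>v n\<close> expand as
  \<open>u n \<sigma> = (\<Sum>l. a l \<sigma> z l)\<close> with fixed vectors \<open>z l\<close>, measurable scalars \<open>a l\<close> and
  \<open>(\<Sum>l. |a l \<sigma>| \<parallel>z l\<parallel>) \<le> 2 \<parallel>u n \<sigma>\<parallel>\<close>.  The integrand thus becomes \<open>\<Sum>l. t l \<sigma> \<langle>\<cdot>, Y l\<rangle> X l\<close> with
  \<open>(\<Sum>l. \<integral>|t l| d\<rho> \<parallel>X l\<parallel> \<parallel>Y l\<parallel>) < \<infinity>\<close>, so that it can be integrated term by term against every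
  functional in the dual of the trace class, without any description of that dual.
\<close>

text \<open>Two obstacles shape the argument. First, \<open>trace_norm\<close> is not the norm of
  the ambient type, so convergence of operators says nothing about it. Partial sums, tails and
  integrals are therefore exhibited as explicit series of rank one operators, and the sum of the
  products of the norms bounds the trace norm by \<open>nuclear_trace_class\<close>. Second, the
  product of the essential suprema is controlled only by an upper integral and may be nonmeasurable.
  Every expansion must therefore be estimated at each point by the norms of the expanded vectors
  themselves; a measurable majorant enters only when the finished series is integrated.

  The operator W is the contraction of a Douglas factorisation, which applies in both directions
  because |A| and A have equal norms on every vector. The vectors z l of an expansion may lie
  anywhere in the ambient space; the projections onto \<open>H 1\<close> and
  \<open>H (k + 1)\<close> move them into these subspaces, fix the sum and increase no norm.\<close>

instance complex_hilbert \<subseteq> banach ..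

section \<open>Complex inner products and adjoints\<close>

lemma cinner_add_right: "cinner x (y + z) = cinner x y + cinner x z"
  by (metis cinner_add_left cinner_commute complex_cnj_add)

lemma cinner_scaleC_right: "cinner x (a *\<^sub>C y) = cnj a * cinner x y"
  by (metis cinner_scaleC_left cinner_commute complex_cnj_mult)

lemma cinner_scaleR_left: "cinner (r *\<^sub>R x) y = r *\<^sub>R cinner x y"
  by (metis cinner_scaleC_left scaleC_of_real scaleR_conv_of_real)

lemma cinner_scaleR_right: "cinner x (r *\<^sub>R y) = r *\<^sub>R cinner x y"
  by (metis cinner_scaleC_right complex_cnj_complex_of_real scaleC_of_real scaleR_conv_of_real)

lemma Im_cinner: "Im (cinner x y) = inner (- \<i> *\<^sub>C x) y"
  by (simp flip: Re_cinner add: cinner_scaleC_left)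

lemma cinner_self: "cinner x x = complex_of_real ((norm x)\<^sup>2)"
proof (rule complex_eqI)
  show "Re (cinner x x) = Re (complex_of_real ((norm x)\<^sup>2))"
    by (simp add: Re_cinner dot_square_norm)
  have "Im (cinner x x) = - Im (cinner x x)"
    by (metis cinner_commute cnj.simps(2))
  then show "Im (cinner x x) = Im (complex_of_real ((norm x)\<^sup>2))" by simp
qed

lemma cmod_cinner_le: "cmod (cinner x y) \<le> norm x * norm y"
proof (cases "cinner x y = 0")
  case False
  \<comment> \<open>The phase \<open>a\<close> turns \<open>cinner x y\<close> into its modulus,
    after which the real Cauchy-Schwarz inequality applies.\<close>
  define a where "a = cnj (cinner x y) / cmod (cinner x y)"
  have a: "cmod a = 1" using False by (simp add: a_def norm_divide)
  have "complex_of_real (cmod (cinner x y)) = a * cinner x y"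
    using False complex_norm_square[of "cinner x y"]
    by (simp add: a_def field_simps power2_eq_square)
  then have "cmod (cinner x y) = Re (cinner (a *\<^sub>C x) y)"
    by (metis Re_complex_of_real cinner_scaleC_left)
  also have "\<dots> \<le> norm (a *\<^sub>C x) * norm y"
    by (simp add: Re_cinner norm_cauchy_schwarz)
  finally show ?thesis by (simp add: norm_scaleC a)
qed auto

interpretation cinner: bounded_bilinear cinner
proof
  show "\<exists>K. \<forall>a b. norm (cinner a b) \<le> norm a * norm b * K"
    by (rule exI[of _ 1]) (simp add: cmod_cinner_le)
qed (simp_all add: cinner_add_left cinner_add_right cinner_scaleR_left cinner_scaleR_right)

interpretation scaleC: bounded_bilinear "scaleC :: complex \<Rightarrow> 'a::complex_normed_vector \<Rightarrow> 'a"
proof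
  fix a :: complex and r :: real and x :: 'a
  show "(r *\<^sub>R a) *\<^sub>C x = r *\<^sub>R a *\<^sub>C x"
    by (simp add: scaleR_conv_of_real scaleC_of_real flip: scaleC_scaleC)
  show "a *\<^sub>C (r *\<^sub>R x) = r *\<^sub>R a *\<^sub>C x"
    by (simp add: scaleC_scaleC mult.commute flip: scaleC_of_real)
  show "\<exists>K. \<forall>a (b::'a). norm (a *\<^sub>C b) \<le> norm a * norm b * K"
    by (rule exI[of _ 1]) (simp add: norm_scaleC)
qed (simp_all add: scaleC_add_left scaleC_add_right)

lemma scaleC_one [simp]: "1 *\<^sub>C x = (x :: 'a::complex_vector)"
  using scaleC_of_real[of 1 x] by simp

lemma cinner_eqI:
  assumes "\<And>z. cinner x z = cinner y z"
  shows "x = y"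
  using assms[of "x - y"] cinner_self[of "x - y"] by (simp add: cinner.diff_left)

lemma cinner_eqI_right:
  assumes "\<And>z. cinner z x = cinner z y"
  shows "x = y"
  using assms[of "x - y"] cinner_self[of "x - y"] by (simp add: cinner.diff_right)

text \<open>The scalar - i recovers the imaginary part from the real inner product. In this way real
  Riesz theory yields identities for the complex inner product.\<close>

lemma inner_eq_cinnerI:
  assumes "\<And>a. inner (a *\<^sub>C x) y = inner (a *\<^sub>C x') y'"
  shows "cinner x y = cinner x' y'"
  using assms[of 1] assms[of "- \<i>"] by (intro complex_eqI) (simp_all add: Re_cinner Im_cinner)

text \<open>Elements of the operator type are only real linear, so complex linearity has to be
  carried as a predicate.\<close>

definition clin :: "('a::complex_hilbert \<Rightarrow>\<^sub>L 'b::complex_hilbert) \<Rightarrow> bool" where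
  "clin T \<longleftrightarrow> (\<forall>a x. T (a *\<^sub>C x) = a *\<^sub>C T x)"

lemma clinD: "clin T \<Longrightarrow> T (a *\<^sub>C x) = a *\<^sub>C T x"
  by (simp add: clin_def)

lemma clin_compose: "clin S \<Longrightarrow> clin T \<Longrightarrow> clin (S o\<^sub>L T)"
  by (simp add: clin_def)

lemma clin_bops: "T \<in> bops H K \<Longrightarrow> clin T"
  by (simp add: clin_def bops_def)

lemma polarization:
  assumes "clin T"
  shows "4 * cinner (T h) k =
    (\<Sum>n<4. \<i> ^ n * cinner (T (h + \<i> ^ n *\<^sub>C k)) (h + \<i> ^ n *\<^sub>C k))"
  using assms
  by (simp add: numeral_eq_Suc clinD cinner_add_left cinner_add_right cinner_scaleC_left
      cinner_scaleC_right blinfun.add_right algebra_simps flip: scaleC_scaleC)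

lemma clin_eqI:
  assumes "clin S" "clin T" "\<And>x. cinner (S x) x = cinner (T x) x"
  shows "S = T"
proof (rule blinfun_eqI, rule cinner_eqI)
  show "cinner (S x) y = cinner (T x) y" for x y
  proof -
    have "4 * cinner (S x) y = 4 * cinner (T x) y"
      by (simp only: polarization[OF assms(1), of x y] polarization[OF assms(2), of x y] assms(3))
    then show ?thesis by simp
  qed
qed

text \<open>The energy \<open>q c\<close> = |c|^2 - 2 f c is minimised over C. A minimising sequence
  is Cauchy by the parallelogram law, because midpoints stay in C, and the vanishing first variation
  at its limit is the representation. Since C need not be closed, the limit is found in the closure
  only.\<close>

lemma riesz_subspace:
  fixes C :: "'a::{real_inner,complete_space} set"
  assumes C: "subspace C"
    and add: "\<And>x y. x \<in> C \<Longrightarrow> y \<in> C \<Longrightarrow> f (x + y) = f x + f y"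
    and scale: "\<And>c x. x \<in> C \<Longrightarrow> f (c *\<^sub>R x) = c * f x"
    and bound: "\<And>x. x \<in> C \<Longrightarrow> \<bar>f x\<bar> \<le> B * norm x"
  shows "\<exists>v\<in>closure C. \<forall>x\<in>C. f x = inner x v"
proof -
  define q where "q c = (norm c)\<^sup>2 - 2 * f c" for c
  have q_ge: "q c \<ge> - B\<^sup>2" if "c \<in> C" for c
  proof -
    have "2 * f c \<le> 2 * B * norm c" using bound[OF that] by linarith
    moreover have "0 \<le> (norm c)\<^sup>2 + B\<^sup>2 - 2 * B * norm c"
      using zero_le_power2[of "norm c - B"] by (simp add: power2_diff mult_ac)
    ultimately show ?thesis unfolding q_def by linarith
  qed
  define m where "m = Inf (q ` C)"
  have bdd: "bdd_below (q ` C)" using q_ge by (auto intro!: bdd_belowI)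
  have ne: "C \<noteq> {}" using C subspace_0 by blast
  have m_le: "m \<le> q c" if "c \<in> C" for c
    unfolding m_def using bdd that by (auto intro: cInf_lower)
  have "\<exists>c\<in>C. q c < m + 1 / real (Suc n)" for n
    using cInf_lessD[of "q ` C" "m + 1 / real (Suc n)"] ne unfolding m_def by auto
  then obtain c where c: "\<And>n. c n \<in> C" "\<And>n. q (c n) < m + 1 / real (Suc n)"
    by metis
  have f_diff: "f (x - y) = f x - f y" if "x \<in> C" "y \<in> C" for x y
    using add[of x "(-1) *\<^sub>R y"] scale[of y "-1"] C that by (simp add: subspace_neg)
  have para: "(norm (x - y))\<^sup>2 \<le> 2 * q x + 2 * q y - 4 * m" if "x \<in> C" "y \<in> C" for x y
  proof -
    have mid: "(1/2) *\<^sub>R (x + y) \<in> C" using C that by (intro subspace_scale subspace_add)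
    have "f ((1/2) *\<^sub>R (x + y)) = (f x + f y) / 2"
      using C that by (simp add: scale add subspace_add)
    then have "4 * q ((1/2) *\<^sub>R (x + y)) = (norm (x + y))\<^sup>2 - 4 * (f x + f y)"
      by (simp add: q_def power_mult_distrib power2_eq_square)
    moreover have "(norm (x + y))\<^sup>2 + (norm (x - y))\<^sup>2 = 2 * (norm x)\<^sup>2 + 2 * (norm y)\<^sup>2"
      by (simp add: power2_norm_eq_inner algebra_simps inner_commute)
    ultimately show ?thesis using m_le[OF mid] by (simp add: q_def)
  qed
  have inv0: "(\<lambda>n. 1 / real (Suc n)) \<longlonglongrightarrow> 0"
    using LIMSEQ_inverse_real_of_nat by (simp add: inverse_eq_divide)
  have "Cauchy c"
  proof (rule metric_CauchyI)
    fix e :: real assume "e > 0"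
    then have "e\<^sup>2 / 4 > 0" by simp
    then obtain N where N: "1 / real (Suc N) < e\<^sup>2 / 4"
      using reals_Archimedean[of "e\<^sup>2 / 4"] by (auto simp: inverse_eq_divide)
    have "dist (c i) (c j) < e" if "i \<ge> N" "j \<ge> N" for i j
    proof -
      have "1 / real (Suc i) \<le> 1 / real (Suc N)" "1 / real (Suc j) \<le> 1 / real (Suc N)"
        using that by (simp_all add: divide_simps)
      then have "(norm (c i - c j))\<^sup>2 < e\<^sup>2"
        using para[OF c(1) c(1), of i j] c(2)[of i] c(2)[of j] N by linarith
      then show ?thesis using \<open>e > 0\<close> by (simp add: dist_norm power_less_imp_less_base)
    qed
    then show "\<exists>N. \<forall>i\<ge>N. \<forall>j\<ge>N. dist (c i) (c j) < e" by blast
  qed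
  then obtain v where v: "c \<longlonglongrightarrow> v" using Cauchy_convergent convergent_def by blast
  have "v \<in> closure C" using c(1) v closure_sequential by blast
  moreover have "f x = inner x v" if x: "x \<in> C" for x
  proof -
    define d where "d = inner v x - f x"
    have ge: "0 \<le> 2 * t * d + t\<^sup>2 * (norm x)\<^sup>2" for t
    proof -
      have "- (1 / real (Suc n)) \<le> 2 * t * (inner (c n) x - f x) + t\<^sup>2 * (norm x)\<^sup>2" for n
      proof -
        have "q (c n + t *\<^sub>R x) = q (c n) + (2 * t * (inner (c n) x - f x) + t\<^sup>2 * (norm x)\<^sup>2)"
          using c(1)[of n] x C
          by (simp add: q_def add scale subspace_scale)
            (simp add: power2_norm_eq_inner inner_add_left inner_add_right algebra_simps
              inner_commute power2_eq_square[of t])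
        moreover have "m \<le> q (c n + t *\<^sub>R x)"
          using c(1) x C by (intro m_le subspace_add subspace_scale)
        ultimately show ?thesis using c(2)[of n] by linarith
      qed
      moreover have "(\<lambda>n. - (1 / real (Suc n))) \<longlonglongrightarrow> 0" using tendsto_minus[OF inv0] by simp
      moreover have "(\<lambda>n. 2 * t * (inner (c n) x - f x) + t\<^sup>2 * (norm x)\<^sup>2)
          \<longlonglongrightarrow> 2 * t * d + t\<^sup>2 * (norm x)\<^sup>2"
        unfolding d_def by (intro tendsto_intros v)
      ultimately show ?thesis
        by (meson LIMSEQ_le)
    qed
    \<comment> \<open>At t = - d / N the quadratic in \<open>ge\<close> equals - d^2 (N + 1) / N^2,
      which is negative unless d = 0. The summand 1 keeps N positive when x = 0.\<close>
    define N where "N = (norm x)\<^sup>2 + 1"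
    have N: "N > 0" by (simp add: N_def add_nonneg_pos)
    have "0 \<le> N\<^sup>2 * (2 * (- d / N) * d + (- d / N)\<^sup>2 * (norm x)\<^sup>2)"
      using ge[of "- d / N"] by simp
    also have "\<dots> = d\<^sup>2 * (norm x)\<^sup>2 - 2 * d\<^sup>2 * N"
      using N by (simp add: power2_eq_square field_simps)
    also have "\<dots> = - (d\<^sup>2 * (N + 1))"
      by (simp add: N_def algebra_simps)
    finally have "d\<^sup>2 * (N + 1) \<le> 0" by simp
    then have "d = 0" using N by (auto simp: mult_le_0_iff)
    then show ?thesis by (simp add: d_def inner_commute)
  qed
  ultimately show ?thesis by blast
qed

section \<open>Douglas factorisation and existence of adjoints\<close>

lemma subspace_closure:
  fixes S :: "'a::real_normed_vector set"
  assumes "subspace S"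
  shows "subspace (closure S)"
  unfolding subspace_def
proof (intro conjI ballI allI)
  show "0 \<in> closure S" using assms closure_subset subspace_0 by blast
  show "x + y \<in> closure S" if xy: "x \<in> closure S" "y \<in> closure S" for x y
  proof -
    obtain a where a: "\<forall>n. a n \<in> S" "a \<longlonglongrightarrow> x" using xy(1) unfolding closure_sequential by blast
    obtain b where b: "\<forall>n. b n \<in> S" "b \<longlonglongrightarrow> y" using xy(2) unfolding closure_sequential by blast
    have "\<forall>n. a n + b n \<in> S" using a(1) b(1) assms by (simp add: subspace_add)
    then show ?thesis using tendsto_add[OF a(2) b(2)] unfolding closure_sequential
      by (intro exI[of _ "\<lambda>n. a n + b n"]) simp
  qed
  show "c *\<^sub>R x \<in> closure S" if x: "x \<in> closure S" for c x
  proof -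
    obtain a where a: "\<forall>n. a n \<in> S" "a \<longlonglongrightarrow> x" using x unfolding closure_sequential by blast
    have "\<forall>n. c *\<^sub>R a n \<in> S" using a(1) assms by (simp add: subspace_scale)
    then show ?thesis using tendsto_scaleR[OF tendsto_const a(2)] unfolding closure_sequential
      by (intro exI[of _ "\<lambda>n. c *\<^sub>R a n"]) simp
  qed
qed

text \<open>
  The Douglas factorisation \<open>S = V A\<close> is obtained through the adjoint of \<open>V\<close>, whose value at \<open>w\<close>
  is the Riesz vector, in the closure of the range of \<open>A\<close>, of \<open>A x \<mapsto> inner (S x) w\<close>.
\<close>

lemma douglas_adjoint:
  fixes A :: "'a::real_normed_vector \<Rightarrow>\<^sub>L 'b::{real_inner,complete_space}"
    and S :: "'a \<Rightarrow>\<^sub>L 'c::real_inner"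
  assumes "0 \<le> c" and le: "\<And>x. norm (S x) \<le> c * norm (A x)"
  shows "\<exists>W :: 'c \<Rightarrow>\<^sub>L 'b. (\<forall>x w. inner (A x) (W w) = inner (S x) w) \<and>
    (\<forall>w. norm (W w) \<le> c * norm w) \<and> (\<forall>w. W w \<in> closure (range A)) \<and>
    (\<forall>v w. v \<in> closure (range A) \<longrightarrow> (\<forall>x. inner (A x) v = inner (S x) w) \<longrightarrow> v = W w)"
proof -
  let ?R = "range (blinfun_apply A)"
  have sub: "subspace ?R"
    by (simp add: blinfun.bounded_linear_right bounded_linear.linear linear_subspace_image subspace_UNIV)
  have wd: "S x = S y" if "A x = A y" for x y
    using le[of "x - y"] that by (simp add: blinfun.diff_right)
  have "\<exists>v\<in>closure ?R. \<forall>x. inner (S x) w = inner (A x) v" for w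
  proof -
    define f where "f y = inner (S (SOME x. A x = y)) w" for y
    have f: "f (A x) = inner (S x) w" for x
    proof -
      have "A (SOME x'. A x' = A x) = A x" by (rule someI) simp
      then show ?thesis unfolding f_def using wd by metis
    qed
    have "\<exists>v\<in>closure ?R. \<forall>y\<in>?R. f y = inner y v"
    proof (rule riesz_subspace[OF sub])
      show "f (x + y) = f x + f y" if xy: "x \<in> ?R" "y \<in> ?R" for x y
      proof -
        obtain x' y' where "x = A x'" "y = A y'" using xy by blast
        then show ?thesis using f[of "x' + y'"] by (simp add: f blinfun.add_right inner_add_left)
      qed
      show "f (r *\<^sub>R x) = r * f x" if x: "x \<in> ?R" for r x
      proof -
        obtain x' where "x = A x'" using x by blast
        then show ?thesis using f[of "r *\<^sub>R x'"] by (simp add: f blinfun.scaleR_right)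
      qed
      show "\<bar>f x\<bar> \<le> (c * norm w) * norm x" if x: "x \<in> ?R" for x
      proof -
        from x obtain z where z: "x = A z" by blast
        have "\<bar>inner (S z) w\<bar> \<le> norm (S z) * norm w" by (rule Cauchy_Schwarz_ineq2)
        also have "\<dots> \<le> (c * norm (A z)) * norm w" by (intro mult_right_mono le) simp
        finally show ?thesis by (simp add: z f mult_ac)
      qed
    qed
    then show ?thesis using f by (metis rangeI)
  qed
  then obtain W where W: "\<And>w. W w \<in> closure ?R" "\<And>w x. inner (S x) w = inner (A x) (W w)"
    by metis
  have closed: "closed {u. inner u d = 0}" for d :: 'b
    by (intro closed_Collect_eq continuous_intros)
  \<comment> \<open>Uniqueness of the Riesz vector makes W additive and homogeneous below; it is
    also exported in the conclusion, where \<open>douglas\<close> uses it for complex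
    scalars.\<close>
  have uniq: "u = v" if "u \<in> closure ?R" "v \<in> closure ?R" "\<And>x. inner (A x) u = inner (A x) v" for u v
  proof -
    have "?R \<subseteq> {z. inner z (u - v) = 0}" using that(3) by (auto simp: inner_diff_right)
    then have "closure ?R \<subseteq> {z. inner z (u - v) = 0}" using closed closure_minimal by blast
    moreover have "u - v \<in> closure ?R"
      using that sub by (simp add: subspace_diff subspace_closure)
    ultimately show ?thesis by auto
  qed
  have csub: "subspace (closure ?R)" by (rule subspace_closure[OF sub])
  have bd: "norm (W w) \<le> c * norm w" for w
  proof (cases "W w = 0")
    case False
    obtain y where y: "\<forall>n. y n \<in> ?R" "y \<longlonglongrightarrow> W w"
      using W(1)[of w] unfolding closure_sequential by blast
    have "inner (y n) (W w) \<le> c * norm w * norm (y n)" for n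
    proof -
      obtain z where z: "y n = A z" using y(1) by blast
      have "inner (y n) (W w) = inner (S z) w" using W(2) by (simp add: z)
      also have "\<dots> \<le> norm (S z) * norm w" by (rule norm_cauchy_schwarz)
      also have "\<dots> \<le> (c * norm (A z)) * norm w" by (intro mult_right_mono le) simp
      finally show ?thesis by (simp add: z mult_ac)
    qed
    moreover have "(\<lambda>n. inner (y n) (W w)) \<longlonglongrightarrow> inner (W w) (W w)"
      "(\<lambda>n. c * norm w * norm (y n)) \<longlonglongrightarrow> c * norm w * norm (W w)"
      by (intro tendsto_intros y)+
    ultimately have "inner (W w) (W w) \<le> c * norm w * norm (W w)" by (meson LIMSEQ_le)
    then show ?thesis using False by (simp add: power2_norm_eq_inner[symmetric] power2_eq_square)
  qed (simp add: \<open>0 \<le> c\<close>)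
  have "bounded_linear W"
  proof (rule bounded_linear_intro[of _ c])
    show "W (x + y) = W x + W y" for x y
      by (rule uniq) (simp_all add: W(1) csub subspace_add inner_add_right flip: W(2))
    show "W (r *\<^sub>R x) = r *\<^sub>R W x" for r x
      by (rule uniq) (simp_all add: W(1) csub subspace_scale flip: W(2))
    show "norm (W x) \<le> norm x * c" for x using bd[of x] by (simp add: mult.commute)
  qed
  then have W': "blinfun_apply (Blinfun W) = W" by (rule bounded_linear_Blinfun_apply)
  have un: "v = W w" if "v \<in> closure ?R" "\<forall>x. inner (A x) v = inner (S x) w" for v w
    by (rule uniq[OF that(1) W(1)]) (simp only: that(2) W(2)[symmetric])
  show ?thesis
  proof (intro exI[of _ "Blinfun W"] conjI allI impI, unfold W')
    show "v = W w" if "v \<in> closure ?R" "\<forall>x. inner (A x) v = inner (S x) w" for v w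
      using that by (rule un)
  qed (rule W(2)[symmetric] bd W(1))+
qed

lemma cadj_eqI:
  fixes A :: "'a::complex_hilbert \<Rightarrow>\<^sub>L 'b::complex_hilbert" and B :: "'b \<Rightarrow>\<^sub>L 'a"
  assumes "\<And>x y. cinner (A x) y = cinner x (B y)"
  shows "cadj A = B"
  unfolding cadj_def
proof (rule the_equality, intro allI, rule assms, rule blinfun_eqI)
  fix B' :: "'b \<Rightarrow>\<^sub>L 'a" and y
  assume B': "\<forall>x y. cinner (A x) y = cinner x (B' y)"
  have 1: "cinner x (B' y) = cinner (A x) y" for x by (rule B'[rule_format, symmetric])
  have 2: "cinner x (B' y) = cinner x (B y)" for x unfolding 1 by (rule assms)
  show "B' y = B y"  by (rule cinner_eqI_right) (rule 2)
qed

text \<open>Existence of the adjoint is the case of \<open>douglas_adjoint\<close> in which the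
  dominating operator is the identity and c = \<open>norm A\<close>; \<open>cadj_eqI\<close> then
  evaluates the definite description.\<close>

lemma cinner_cadj:
  assumes "clin A"
  shows "cinner (A x) y = cinner x (cadj A y)"
proof -
  have "\<exists>B :: 'b \<Rightarrow>\<^sub>L 'a. (\<forall>x w. inner (id_blinfun x) (B w) = inner (A x) w) \<and>
      (\<forall>w. norm (B w) \<le> norm A * norm w) \<and> (\<forall>w. B w \<in> closure (range id_blinfun)) \<and>
      (\<forall>v w. v \<in> closure (range id_blinfun) \<longrightarrow>
        (\<forall>x. inner (id_blinfun x) v = inner (A x) w) \<longrightarrow> v = B w)"
    by (rule douglas_adjoint) (simp_all add: norm_blinfun)
  then obtain B :: "'b \<Rightarrow>\<^sub>L 'a" where B: "\<And>x w. inner x (B w) = inner (A x) w"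
    unfolding blinfun_apply_id_blinfun by blast
  have *: "cinner (A x) y = cinner x (B y)" for x y
    by (rule inner_eq_cinnerI) (unfold clinD[OF assms, symmetric] B, rule refl)
  then have "cadj A = B" by (rule cadj_eqI)
  then show ?thesis by (simp only: *)
qed

lemma cinner_cadj_left: "clin A \<Longrightarrow> cinner (cadj A x) y = cinner x (A y)"
  by (metis cinner_cadj cinner_commute)

lemma clin_cadj: "clin A \<Longrightarrow> clin (cadj A)"
  unfolding clin_def[of "cadj A"]
  by (intro allI, rule cinner_eqI) (simp add: cinner_cadj_left cinner_scaleC_left)

lemma cadj_compose: "clin A \<Longrightarrow> clin B \<Longrightarrow> cadj (A o\<^sub>L B) = cadj B o\<^sub>L cadj A"
  by (rule cadj_eqI) (simp only: cinner_cadj blinfun_apply_blinfun_compose)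

lemma norm_cadj_le: "clin A \<Longrightarrow> norm (cadj A) \<le> norm A"
proof (rule norm_blinfun_bound)
  fix y assume "clin A"
  show "norm (cadj A y) \<le> norm A * norm y"
  proof (cases "cadj A y = 0")
    case False
    have "(norm (cadj A y))\<^sup>2 = cmod (cinner (cadj A y) (cadj A y))" by (simp add: cinner_self norm_power)
    also have "\<dots> \<le> norm (A (cadj A y)) * norm y"
      using \<open>clin A\<close> by (simp add: cmod_cinner_le flip: cinner_cadj)
    also have "\<dots> \<le> (norm A * norm (cadj A y)) * norm y" by (intro mult_right_mono norm_blinfun) simp
    finally show ?thesis using False by (simp add: power2_eq_square mult_ac)
  qed simp
qed simp

text \<open>The operator W of \<open>douglas_adjoint\<close> is a priori only real linear. Both
  \<open>a *\<^sub>C W w\<close> and \<open>W (a *\<^sub>C w)\<close> lie in the closure of the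
  range of A and represent the same functional, so they coincide; V is the adjoint of W. Applied to
  A and |A| in either order, this takes the place of the polar decomposition.\<close>

lemma douglas:
  fixes A :: "'a::complex_hilbert \<Rightarrow>\<^sub>L 'b::complex_hilbert" and S :: "'a \<Rightarrow>\<^sub>L 'c::complex_hilbert"
  assumes "clin A" "clin S" and le: "\<And>x. norm (S x) \<le> norm (A x)"
  shows "\<exists>V. clin V \<and> S = V o\<^sub>L A \<and> (\<forall>w. norm (V w) \<le> norm w)"
proof -
  have "\<exists>W :: 'c \<Rightarrow>\<^sub>L 'b. (\<forall>x w. inner (A x) (W w) = inner (S x) w) \<and>
    (\<forall>w. norm (W w) \<le> 1 * norm w) \<and> (\<forall>w. W w \<in> closure (range A)) \<and>
    (\<forall>v w. v \<in> closure (range A) \<longrightarrow> (\<forall>x. inner (A x) v = inner (S x) w) \<longrightarrow> v = W w)"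
    by (rule douglas_adjoint) (simp_all add: le)
  then obtain W :: "'c \<Rightarrow>\<^sub>L 'b" where W: "\<forall>x w. inner (A x) (W w) = inner (S x) w"
    "\<forall>w. norm (W w) \<le> 1 * norm w" "\<forall>w. W w \<in> closure (range A)"
    "\<forall>v w. v \<in> closure (range A) \<longrightarrow> (\<forall>x. inner (A x) v = inner (S x) w) \<longrightarrow> v = W w"
    by (elim exE conjE)
  have *: "cinner (A x) (W w) = cinner (S x) w" for x w
    by (rule inner_eq_cinnerI) (simp only: clinD[OF assms(1), symmetric] clinD[OF assms(2), symmetric] W(1))
  have "a *\<^sub>C W w = W (a *\<^sub>C w)" for a w
  proof (rule W(4)[rule_format])
    have "(\<lambda>x. a *\<^sub>C x) ` range A \<subseteq> range A"
      by (auto simp flip: clinD[OF assms(1)])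
    then have "(\<lambda>x. a *\<^sub>C x) ` closure (range A) \<subseteq> closure (range A)"
      by (rule subset_trans[OF closure_bounded_linear_image_subset[OF bounded_linear_scaleC] closure_mono])
    then show "a *\<^sub>C W w \<in> closure (range A)" by (rule subsetD) (intro imageI W(3)[rule_format])
    show "inner (A x) (a *\<^sub>C W w) = inner (S x) (a *\<^sub>C w)" for x
      by (simp only: Re_cinner[symmetric] cinner_scaleC_right *)
  qed
  then have "clin W" by (simp add: clin_def)
  have "norm (cadj W w) \<le> norm w" for w
  proof -
    have "norm (cadj W w) \<le> norm (cadj W) * norm w" by (rule norm_blinfun)
    also have "\<dots> \<le> 1 * norm w"
      by (intro mult_right_mono order_trans[OF norm_cadj_le[OF \<open>clin W\<close>]] norm_blinfun_bound)
        (simp_all add: W(2)[rule_format, simplified])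
    finally show ?thesis by simp
  qed
  moreover have "S = cadj W o\<^sub>L A"
    by (rule blinfun_eqI, rule cinner_eqI) (simp add: cinner_cadj_left[OF \<open>clin W\<close>] *)
  ultimately show ?thesis using clin_cadj[OF \<open>clin W\<close>] by (intro exI[of _ "cadj W"]) simp
qed

section \<open>Positive square roots\<close>

lemma clin_bops_UNIV: "T \<in> bops UNIV UNIV \<longleftrightarrow> clin T"
proof
  have x: "x = 0" if "\<forall>y. cinner x y = 0" for x :: 'a
    using that cinner_self[of x] by simp
  show "T \<in> bops UNIV UNIV" if "clin T"
    unfolding bops_def
  proof (intro CollectI conjI allI impI)
    show "T z = 0" if "\<forall>y\<in>UNIV. cinner z y = 0" for z using x[of z] that by simp
  qed (simp_all add: clinD[OF that])
qed (rule clin_bops)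

text \<open>A real quadratic form is shared by T and its adjoint, so polarization
  (\<open>clin_eqI\<close>) gives self-adjointness.\<close>

lemma positive_opD:
  assumes "positive_op T"
  shows "clin T" "0 \<le> inner (T x) x" "inner (T x) y = inner x (T y)" "cadj T = T"
proof -
  show c: "clin T" and "0 \<le> inner (T x) x"
    using assms by (auto simp: positive_op_def clin_bops_UNIV simp flip: Re_cinner)
  have "cadj T = T"
  proof (rule clin_eqI[OF clin_cadj[OF c] c])
    fix x
    have "cinner (cadj T x) x = cnj (cinner (T x) x)"
      by (metis c cinner_cadj_left cinner_commute)
    also have "\<dots> = cinner (T x) x" using assms by (auto simp: positive_op_def Reals_cnj_iff)
    finally show "cinner (cadj T x) x = cinner (T x) x" .
  qed
  then show "cadj T = T" "inner (T x) y = inner x (T y)"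
    using cinner_cadj[OF c] by (metis Re_cinner)+
qed

lemma positive_opI:
  assumes "clin T" "\<And>x y. inner (T x) y = inner x (T y)" "\<And>x. 0 \<le> inner (T x) x"
  shows "positive_op T"
proof -
  have "cinner (T x) y = cinner x (T y)" for x y
    by (intro inner_eq_cinnerI) (simp add: assms(2) flip: clinD[OF assms(1)])
  then have "cinner (T x) x = cnj (cinner (T x) x)" for x by (metis cinner_commute)
  then show ?thesis using assms
    by (auto simp: positive_op_def clin_bops_UNIV Re_cinner Reals_cnj_iff)
qed

lemma positive_cauchy_schwarz:
  fixes T :: "'a::real_inner \<Rightarrow>\<^sub>L 'a"
  assumes sym: "\<And>x y. inner (T x) y = inner x (T y)" and pos: "\<And>x. 0 \<le> inner (T x) x"
  shows "(inner (T x) y)\<^sup>2 \<le> inner (T x) x * inner (T y) y"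
proof -
  have ge: "0 \<le> inner (T x) x + 2 * t * inner (T x) y + t\<^sup>2 * inner (T y) y" for t
    using pos[of "x + t *\<^sub>R y"] sym[of y x]
    by (simp add: blinfun.add_right blinfun.scaleR_right inner_add_left inner_add_right
        inner_commute power2_eq_square algebra_simps)
  show ?thesis
  proof (cases "inner (T y) y = 0")
    case True
    \<comment> \<open>Without its quadratic term \<open>ge\<close> is affine in t; the value of t
      chosen here would make it equal to - 1.\<close>
    have "inner (T x) y = 0"
    proof (rule ccontr)
      assume "inner (T x) y \<noteq> 0"
      then show False
        using ge[of "- (inner (T x) x + 1) / (2 * inner (T x) y)"] True pos[of x]
        by (simp add: field_simps)
    qed
    then show ?thesis by (simp add: True)
  next
    case False
    then have p: "inner (T y) y > 0" using pos[of y] by simp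
    show ?thesis using ge[of "- inner (T x) y / inner (T y) y"] p
      by (simp add: power2_eq_square field_simps)
  qed
qed

lemma positive_eq_0:
  fixes T :: "'a::real_inner \<Rightarrow>\<^sub>L 'a"
  assumes sym: "\<And>x y. inner (T x) y = inner x (T y)" and pos: "\<And>x. 0 \<le> inner (T x) x"
    and "inner (T x) x = 0"
  shows "T x = 0"
  using positive_cauchy_schwarz[OF sym pos, where x=x and y="T x"] assms(3) by simp

text \<open>Cauchy-Schwarz for the form of T, applied to x and T x, gives |T x|^4 \<le> |x|^2 |T
  x|^2.\<close>

lemma norm_le_one_positive:
  fixes T :: "'a::real_inner \<Rightarrow>\<^sub>L 'a"
  assumes sym: "\<And>x y. inner (T x) y = inner x (T y)" and pos: "\<And>x. 0 \<le> inner (T x) x"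
    and le: "\<And>x. inner (T x) x \<le> (norm x)\<^sup>2"
  shows "norm T \<le> 1"
proof (rule norm_blinfun_bound)
  fix x
  have "((norm (T x))\<^sup>2)\<^sup>2 \<le> inner (T x) x * inner (T (T x)) (T x)"
    using positive_cauchy_schwarz[OF sym pos, where x=x and y="T x"] by (simp add: dot_square_norm)
  also have "\<dots> \<le> (norm x)\<^sup>2 * (norm (T x))\<^sup>2" by (intro mult_mono le pos) auto
  finally have "(norm (T x))\<^sup>2 \<le> (norm x)\<^sup>2"
    by (cases "T x = 0") (auto simp: power2_eq_square)
  then show "norm (T x) \<le> 1 * norm x" by (simp add: power2_le_iff_abs_le)
qed simp

text \<open>
  If \<open>R = 1 - T\<close> with \<open>\<parallel>R\<parallel> \<le> 1\<close>, the iterates of \<open>Y \<mapsto> (R + Y\<^sup>2) / 2\<close> converge in norm, because they are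
  dominated by the scalar iterates of \<open>y \<mapsto> (1 + y\<^sup>2) / 2\<close>; the limit satisfies \<open>(1 - Y)\<^sup>2 = T\<close>.
\<close>

primrec sqrt_iter :: "('a::real_normed_vector \<Rightarrow>\<^sub>L 'a) \<Rightarrow> nat \<Rightarrow> 'a \<Rightarrow>\<^sub>L 'a" where
  "sqrt_iter R 0 = 0"
| "sqrt_iter R (Suc n) = (1/2) *\<^sub>R (R + (sqrt_iter R n o\<^sub>L sqrt_iter R n))"

primrec scalar_iter :: "nat \<Rightarrow> real" where
  "scalar_iter 0 = 0"
| "scalar_iter (Suc n) = (1/2) * (1 + (scalar_iter n)\<^sup>2)"

lemma scalar_iter_bounds: "0 \<le> scalar_iter n \<and> scalar_iter n \<le> 1 \<and> scalar_iter n \<le> scalar_iter (Suc n)"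
proof (induction n)
  case (Suc n)
  have "(scalar_iter (Suc n))\<^sup>2 \<le> 1" using Suc by (simp add: power_le_one)
  then have "scalar_iter (Suc n) \<le> 1" using Suc power_le_one[of "scalar_iter n" 2] by simp
  moreover have "(scalar_iter n)\<^sup>2 \<le> (scalar_iter (Suc n))\<^sup>2" using Suc by (intro power_mono) auto
  ultimately show ?case using Suc by (simp del: scalar_iter.simps add: scalar_iter.simps(2)[of "Suc n"] scalar_iter.simps(2)[of n])
qed simp

text \<open>Needed twice: the iterates commute with one another, and the limit inherits every
  commutation relation of R.\<close>

lemma sqrt_iter_commute:
  assumes "U o\<^sub>L R = R o\<^sub>L U"
  shows "U o\<^sub>L sqrt_iter R n = sqrt_iter R n o\<^sub>L U"
proof (induction n)
  case (Suc n)
  have a: "U (R x) = R (U x)" and b: "U (sqrt_iter R n x) = sqrt_iter R n (U x)" for x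
    using assms Suc by (metis blinfun_apply_blinfun_compose)+
  show ?case by (rule blinfun_eqI) (simp add: blinfun.add_right blinfun.scaleR_right blinfun.add_left blinfun.scaleR_left a b)
qed simp

lemma norm_sqrt_iter:
  assumes "norm R \<le> 1"
  shows "norm (sqrt_iter R n) \<le> scalar_iter n"
proof (induction n)
  case (Suc n)
  have "norm (sqrt_iter R n o\<^sub>L sqrt_iter R n) \<le> norm (sqrt_iter R n) * norm (sqrt_iter R n)"
    by (rule norm_blinfun_compose)
  also have "\<dots> \<le> (scalar_iter n)\<^sup>2"
    unfolding power2_eq_square using Suc by (intro mult_mono) (auto simp: scalar_iter_bounds)
  finally show ?case
    using assms norm_triangle_ineq[of R "sqrt_iter R n o\<^sub>L sqrt_iter R n"] by simp
qed simp

text \<open>Consecutive iterates Y, Z commute, so Y^2 - Z^2 = (Y - Z)(Y + Z) as for scalars. Hence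
  the increments of the operator iteration are bounded by those of the scalar one, which
  telescope.\<close>

lemma norm_sqrt_iter_diff:
  assumes "norm R \<le> 1"
  shows "norm (sqrt_iter R (Suc n) - sqrt_iter R n) \<le> scalar_iter (Suc n) - scalar_iter n"
proof (induction n)
  case (Suc n)
  let ?Y = "sqrt_iter R (Suc n)" and ?Z = "sqrt_iter R n"
  let ?y = "scalar_iter (Suc n)" and ?z = "scalar_iter n"
  have "R o\<^sub>L ?Z = ?Z o\<^sub>L R" by (rule sqrt_iter_commute) simp
  then have "?Z o\<^sub>L ?Y = ?Y o\<^sub>L ?Z" by (intro sqrt_iter_commute) simp
  then have comm: "?Z (?Y x) = ?Y (?Z x)" for x by (metis blinfun_apply_blinfun_compose)
  have "sqrt_iter R (Suc (Suc n)) - ?Y = (1/2) *\<^sub>R (R + (?Y o\<^sub>L ?Y)) - (1/2) *\<^sub>R (R + (?Z o\<^sub>L ?Z))"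
    by (simp only: sqrt_iter.simps)
  also have "\<dots> = (1/2) *\<^sub>R ((?Y - ?Z) o\<^sub>L (?Y + ?Z))"
    by (rule blinfun_eqI)
      (simp add: blinfun.add_left blinfun.add_right blinfun.diff_left comm blinfun.scaleR_left
        scaleR_add_right scaleR_diff_right del: sqrt_iter.simps)
  also have "norm \<dots> \<le> (1/2) * (norm (?Y - ?Z) * norm (?Y + ?Z))"
    using norm_blinfun_compose[of "?Y - ?Z" "?Y + ?Z"] by (simp del: sqrt_iter.simps)
  also have "\<dots> \<le> (1/2) * ((?y - ?z) * (?y + ?z))"
    using Suc norm_sqrt_iter[OF assms, of n] norm_sqrt_iter[OF assms, of "Suc n"]
      norm_triangle_ineq[of ?Y ?Z] scalar_iter_bounds[of n]
    by (intro mult_left_mono mult_mono) (auto simp del: sqrt_iter.simps scalar_iter.simps)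
  also have "\<dots> = scalar_iter (Suc (Suc n)) - ?y"
    by (simp only: scalar_iter.simps(2)[of "Suc n"] scalar_iter.simps(2)[of n])
      (simp add: algebra_simps power2_eq_square)
  finally show ?case .
qed (use assms in simp)

lemma sqrt_iter_convergent:
  fixes R :: "'a::banach \<Rightarrow>\<^sub>L 'a"
  assumes "norm R \<le> 1"
  shows "convergent (sqrt_iter R)"
proof -
  have "incseq scalar_iter" using scalar_iter_bounds by (intro incseq_SucI) blast
  then have "convergent scalar_iter"
    using scalar_iter_bounds by (intro Bseq_mono_convergent BseqI'[of _ 1]) (auto simp: incseq_def)
  then have "summable (\<lambda>n. scalar_iter (Suc n) - scalar_iter n)"
    unfolding convergent_def using telescope_sums sums_summable by blast
  then have "summable (\<lambda>n. sqrt_iter R (Suc n) - sqrt_iter R n)"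
    by (rule summable_comparison_test'[where N=0]) (use norm_sqrt_iter_diff[OF assms] in blast)
  then have "convergent (\<lambda>n. \<Sum>i<n. sqrt_iter R (Suc i) - sqrt_iter R i)"
    by (simp add: summable_iff_convergent)
  then show ?thesis by (simp only: sum_lessThan_telescope) simp
qed

text \<open>The clause on U serves two ends: it makes every other square root commute with S, as
  \<open>sqrt_unique\<close> demands, and, with U a complex scalar multiplication, it makes S
  complex linear. Positivity of S = 1 - Y comes from \<open>norm Y \<le> 1\<close>.\<close>

lemma sqrt_exists_contraction:
  fixes T :: "'a::{real_inner,banach} \<Rightarrow>\<^sub>L 'a"
  assumes sym: "\<And>x y. inner (T x) y = inner x (T y)" and pos: "\<And>x. 0 \<le> inner (T x) x"
    and le: "norm T \<le> 1"
  shows "\<exists>S. S o\<^sub>L S = T \<and> (\<forall>x y. inner (S x) y = inner x (S y)) \<and> (\<forall>x. 0 \<le> inner (S x) x) \<and>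
    (\<forall>U. U o\<^sub>L T = T o\<^sub>L U \<longrightarrow> U o\<^sub>L S = S o\<^sub>L U)"
proof -
  define R where "R = id_blinfun - T"
  have R: "R x = x - T x" for x by (simp add: R_def blinfun.diff_left)
  have Tx: "inner (T x) x \<le> (norm x)\<^sup>2" for x
  proof -
    have "inner (T x) x \<le> norm (T x) * norm x" by (rule norm_cauchy_schwarz)
    also have "\<dots> \<le> (1 * norm x) * norm x"
      by (intro mult_right_mono order_trans[OF norm_blinfun] le) auto
    finally show ?thesis by (simp add: power2_eq_square)
  qed
  have Rsym: "inner (R x) y = inner x (R y)" for x y by (simp add: R inner_diff_left inner_diff_right sym)
  have "norm R \<le> 1"
    using Tx pos by (intro norm_le_one_positive Rsym) (auto simp: R inner_diff_left dot_square_norm)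
  obtain Y where Y: "sqrt_iter R \<longlonglongrightarrow> Y"
    using sqrt_iter_convergent[OF \<open>norm R \<le> 1\<close>] by (auto simp: convergent_def)
  have app: "(\<lambda>n. sqrt_iter R n x) \<longlonglongrightarrow> Y x" for x
    by (intro blinfun.tendsto Y tendsto_const)
  have nY: "norm Y \<le> 1"
  proof (rule LIMSEQ_le_const2[OF tendsto_norm[OF Y]])
    show "\<exists>N. \<forall>n\<ge>N. norm (sqrt_iter R n) \<le> 1"
      using norm_sqrt_iter[OF \<open>norm R \<le> 1\<close>] scalar_iter_bounds by (meson order_trans)
  qed
  have iter_sym: "inner (sqrt_iter R n x) y = inner x (sqrt_iter R n y)" for n x y
    by (induction n arbitrary: x y)
      (simp_all add: blinfun.scaleR_left blinfun.add_left inner_add_left inner_add_right Rsym)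
  have Ysym: "inner (Y x) y = inner x (Y y)" for x y
  proof (rule LIMSEQ_unique)
    show "(\<lambda>n. inner (sqrt_iter R n x) y) \<longlonglongrightarrow> inner (Y x) y" by (intro tendsto_intros app)
    show "(\<lambda>n. inner (sqrt_iter R n x) y) \<longlonglongrightarrow> inner x (Y y)"
      unfolding iter_sym by (intro tendsto_intros app)
  qed
  have "(\<lambda>n. (1/2) *\<^sub>R (R + (sqrt_iter R n o\<^sub>L sqrt_iter R n))) \<longlonglongrightarrow> (1/2) *\<^sub>R (R + (Y o\<^sub>L Y))"
    by (intro tendsto_intros Y bounded_bilinear.tendsto[OF bounded_bilinear_blinfun_compose])
  then have "(\<lambda>n. sqrt_iter R (Suc n)) \<longlonglongrightarrow> (1/2) *\<^sub>R (R + (Y o\<^sub>L Y))" by simp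
  then have Yeq: "Y = (1/2) *\<^sub>R (R + (Y o\<^sub>L Y))" by (rule LIMSEQ_unique[OF LIMSEQ_Suc[OF Y]])
  define S where "S = id_blinfun - Y"
  have S: "S x = x - Y x" for x by (simp add: S_def blinfun.diff_left)
  have YY: "Y (Y x) = 2 *\<^sub>R Y x - R x" for x
  proof -
    have "2 *\<^sub>R Y = R + (Y o\<^sub>L Y)" by (subst Yeq) simp
    then have "(2 *\<^sub>R Y) x = (R + (Y o\<^sub>L Y)) x" by simp
    then show ?thesis by (simp add: blinfun.scaleR_left blinfun.add_left algebra_simps)
  qed
  have "S o\<^sub>L S = T"
    by (rule blinfun_eqI) (simp add: S blinfun.diff_right YY R scaleR_2)
  moreover have "0 \<le> inner (S x) x" for x
  proof -
    have "inner (Y x) x \<le> norm (Y x) * norm x" by (rule norm_cauchy_schwarz)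
    also have "\<dots> \<le> (1 * norm x) * norm x"
      by (intro mult_right_mono order_trans[OF norm_blinfun] nY) auto
    finally show ?thesis by (simp add: S inner_diff_left dot_square_norm power2_eq_square)
  qed
  moreover have "U o\<^sub>L S = S o\<^sub>L U" if "U o\<^sub>L T = T o\<^sub>L U" for U
  proof -
    have "U (T x) = T (U x)" for x using that by (metis blinfun_apply_blinfun_compose)
    then have "U o\<^sub>L R = R o\<^sub>L U" by (intro blinfun_eqI) (simp add: R blinfun.diff_right)
    then have c: "U (sqrt_iter R n x) = sqrt_iter R n (U x)" for n x
      using sqrt_iter_commute by (metis blinfun_apply_blinfun_compose)
    have "U (Y x) = Y (U x)" for x
    proof (rule LIMSEQ_unique)
      show "(\<lambda>n. U (sqrt_iter R n x)) \<longlonglongrightarrow> U (Y x)" by (intro blinfun.tendsto tendsto_const app)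
      show "(\<lambda>n. U (sqrt_iter R n x)) \<longlonglongrightarrow> Y (U x)" unfolding c by (rule app)
    qed
    then show ?thesis by (intro blinfun_eqI) (simp add: S blinfun.diff_right)
  qed
  moreover have "inner (S x) y = inner x (S y)" for x y
    by (simp add: S inner_diff_left inner_diff_right Ysym)
  ultimately show ?thesis by blast
qed

lemma sqrt_exists:
  assumes "positive_op T"
  shows "\<exists>S. positive_op S \<and> S o\<^sub>L S = T \<and> (\<forall>U. U o\<^sub>L T = T o\<^sub>L U \<longrightarrow> U o\<^sub>L S = S o\<^sub>L U)"
proof -
  note T = positive_opD[OF assms]
  \<comment> \<open>Rescaling reduces to contractions; the summand 1 covers T = 0.\<close>
  define c where "c = norm T + 1"
  have c: "c > 0" by (simp add: c_def add_nonneg_pos)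
  let ?T = "(1/c) *\<^sub>R T"
  have "norm ?T \<le> 1" using c by (simp add: c_def)
  moreover have "inner (?T x) y = inner x (?T y)" "0 \<le> inner (?T x) x" for x y
    using T(2,3) c by (simp_all add: blinfun.scaleR_left)
  ultimately obtain S where S: "S o\<^sub>L S = ?T" "\<And>x y. inner (S x) y = inner x (S y)"
    "\<And>x. 0 \<le> inner (S x) x" "\<And>U. U o\<^sub>L ?T = ?T o\<^sub>L U \<Longrightarrow> U o\<^sub>L S = S o\<^sub>L U"
    using sqrt_exists_contraction[of ?T] by blast
  let ?S = "sqrt c *\<^sub>R S"
  have SS: "S (S x) = (1/c) *\<^sub>R T x" for x
    using arg_cong[OF S(1), of "\<lambda>X. X x"] by (simp add: blinfun.scaleR_left)
  have comm: "U o\<^sub>L ?S = ?S o\<^sub>L U" if "U o\<^sub>L T = T o\<^sub>L U" for U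
  proof -
    have "U (T x) = T (U x)" for x using that by (metis blinfun_apply_blinfun_compose)
    then have "U o\<^sub>L S = S o\<^sub>L U"
      by (intro S(4) blinfun_eqI) (simp add: blinfun.scaleR_left blinfun.scaleR_right)
    then have "U (S x) = S (U x)" for x by (metis blinfun_apply_blinfun_compose)
    then show ?thesis
      by (intro blinfun_eqI) (simp add: blinfun.scaleR_left blinfun.scaleR_right)
  qed
  have "clin ?S"
  proof -
    have "(a *\<^sub>C id_blinfun) o\<^sub>L ?S = ?S o\<^sub>L (a *\<^sub>C id_blinfun)" for a
      by (intro comm blinfun_eqI) (simp add: scaleC_blinfun.rep_eq clinD[OF T(1)])
    then have "((a *\<^sub>C id_blinfun) o\<^sub>L ?S) x = (?S o\<^sub>L (a *\<^sub>C id_blinfun)) x" for a x by simp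
    then show ?thesis by (simp add: clin_def scaleC_blinfun.rep_eq)
  qed
  then have "positive_op ?S"
    using S(2,3) c by (intro positive_opI) (auto simp: blinfun.scaleR_left)
  moreover have "?S o\<^sub>L ?S = T"
    using c by (intro blinfun_eqI) (simp add: blinfun.scaleR_left blinfun.scaleR_right SS)
  ultimately show ?thesis using comm by blast
qed

text \<open>For y = S x - S' x, commutativity gives (S + S') y = (S^2 - S'^2) x = 0. Both forms are
  nonnegative, so each vanishes at y; then S y = S' y = 0, and self-adjointness gives |y|^2 =
  0.\<close>

lemma sqrt_unique:
  assumes "positive_op S" "positive_op S'" "S o\<^sub>L S = S' o\<^sub>L S'"
    and comm: "S' o\<^sub>L S = S o\<^sub>L S'"
  shows "S = S'"
proof (rule blinfun_eqI)
  fix x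
  note S = positive_opD[OF assms(1)] and S' = positive_opD[OF assms(2)]
  define y where "y = S x - S' x"
  have sq: "S (S x) = S' (S' x)" and cm: "S' (S x) = S (S' x)"
    using arg_cong[OF assms(3), of "\<lambda>X. X x"] arg_cong[OF comm, of "\<lambda>X. X x"] by simp_all
  have "S y + S' y = 0" by (simp add: y_def blinfun.diff_right sq cm)
  then have "inner (S y) y + inner (S' y) y = 0" by (simp flip: inner_add_left)
  then have "inner (S y) y = 0" "inner (S' y) y = 0" using S(2)[of y] S'(2)[of y] by linarith+
  then have "S y = 0" "S' y = 0"
    by (auto intro: positive_eq_0[OF S(3) S(2)] positive_eq_0[OF S'(3) S'(2)])
  have "inner y y = inner x (S y) - inner x (S' y)"
    by (subst (1) y_def) (simp only: inner_diff_left S(3) S'(3))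
  then have "y = 0" by (simp add: \<open>S y = 0\<close> \<open>S' y = 0\<close>)
  then show "S x = S' x" by (simp add: y_def)
qed

lemma sqrt_op:
  assumes "positive_op T"
  shows "positive_op (sqrt_op T)" "sqrt_op T o\<^sub>L sqrt_op T = T"
proof -
  obtain S where S: "positive_op S" "S o\<^sub>L S = T" "\<And>U. U o\<^sub>L T = T o\<^sub>L U \<Longrightarrow> U o\<^sub>L S = S o\<^sub>L U"
    using sqrt_exists[OF assms] by blast
  have "S' = S" if S': "positive_op S'" "S' o\<^sub>L S' = T" for S' :: "'a \<Rightarrow>\<^sub>L 'a"
  proof -
    have "S' o\<^sub>L T = T o\<^sub>L S'"
      unfolding S'(2)[symmetric] by (rule blinfun_eqI) simp
    then have "S' o\<^sub>L S = S o\<^sub>L S'" by (rule S(3))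
    moreover have "S o\<^sub>L S = S' o\<^sub>L S'" unfolding S(2) S'(2) by (rule refl)
    ultimately show ?thesis using sqrt_unique[OF S(1) S'(1)] by blast
  qed
  then have "sqrt_op T = S"
    unfolding sqrt_op_def by (intro the_equality conjI S(1,2)) (elim conjE)
  then show "positive_op (sqrt_op T)" "sqrt_op T o\<^sub>L sqrt_op T = T" by (simp_all only: S(1,2))
qed

text \<open>The equality of norms is the hypothesis of \<open>douglas\<close> for the pair A, |A| in
  both orders.\<close>

lemma abs_op:
  assumes "clin A"
  defines "S \<equiv> sqrt_op (cadj A o\<^sub>L A)"
  shows "positive_op S" "norm (S x) = norm (A x)"
proof -
  have eq: "inner ((cadj A o\<^sub>L A) x) y = inner (A x) (A y)" for x y
    by (simp add: cinner_cadj_left assms flip: Re_cinner)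
  have "positive_op (cadj A o\<^sub>L A)"
  proof (rule positive_opI)
    show "clin (cadj A o\<^sub>L A)" by (intro clin_compose clin_cadj assms)
    show "inner ((cadj A o\<^sub>L A) x) y = inner x ((cadj A o\<^sub>L A) y)" for x y
      unfolding eq inner_commute[of x] by (rule inner_commute)
    show "0 \<le> inner ((cadj A o\<^sub>L A) x) x" for x
      unfolding eq by (rule inner_ge_zero)
  qed
  note S = sqrt_op[OF this, folded S_def]
  show "positive_op S" by (rule S)
  have "(norm (S x))\<^sup>2 = inner ((S o\<^sub>L S) x) x"
    by (simp add: positive_opD(3)[OF S(1)] power2_norm_eq_inner)
  also have "\<dots> = (norm (A x))\<^sup>2" unfolding S(2) eq power2_norm_eq_inner ..
  finally show "norm (S x) = norm (A x)" by simp
qed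

section \<open>Orthonormal bases\<close>

lemma closed_csubspace_hull: "closed_csubspace (closed_csubspace hull S)"
  by (rule hull_in) (auto simp: closed_csubspace_def closed_Inter)

lemma closed_csubspace_scaleR: "closed_csubspace C \<Longrightarrow> x \<in> C \<Longrightarrow> r *\<^sub>R x \<in> C"
  by (simp add: closed_csubspace_def flip: scaleC_of_real)

lemma closed_csubspace_sum:
  "closed_csubspace C \<Longrightarrow> (\<And>i. i \<in> I \<Longrightarrow> f i \<in> C) \<Longrightarrow> sum f I \<in> C"
  by (induction I rule: infinite_finite_induct) (auto simp: closed_csubspace_def)

text \<open>The Riesz vector of c \<mapsto> \<open>inner c z\<close> on C is the orthogonal
  projection of z. Stability of C under complex scalars upgrades real orthogonality to complex
  orthogonality.\<close>

lemma closed_csubspace_projection: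
  assumes C: "closed_csubspace C"
  shows "\<exists>v\<in>C. \<forall>c\<in>C. cinner (z - v) c = 0"
proof -
  have "subspace C"
    using C closed_csubspace_scaleR[OF C] by (auto simp: subspace_def closed_csubspace_def)
  moreover have "\<bar>inner c z\<bar> \<le> norm z * norm c" for c
    using Cauchy_Schwarz_ineq2[of c z] by (simp add: mult.commute)
  ultimately have "\<exists>v\<in>closure C. \<forall>x\<in>C. inner x z = inner x v"
    by (intro riesz_subspace[where B = "norm z"]) (auto simp: inner_add_left)
  moreover have "closure C = C" using C by (simp add: closed_csubspace_def closure_closed)
  ultimately obtain v where v: "v \<in> C" "\<forall>x\<in>C. inner x z = inner x v" by blast
  have "cinner c (z - v) = cinner c 0" if "c \<in> C" for c
  proof (rule inner_eq_cinnerI)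
    fix a
    have "a *\<^sub>C c \<in> C" using C that by (simp add: closed_csubspace_def)
    then show "inner (a *\<^sub>C c) (z - v) = inner (a *\<^sub>C c) 0" using v(2) by (simp add: inner_diff_right)
  qed
  then have "\<forall>c\<in>C. cinner (z - v) c = 0"
    using cinner_commute[of "z - v"] by (simp add: cinner.zero_right)
  then show ?thesis using v(1) by blast
qed

lemma closed_csubspace_orthogonal:
  assumes "closed_csubspace C" and "z \<notin> C"
  shows "\<exists>w. w \<noteq> 0 \<and> (\<forall>c\<in>C. cinner w c = 0)"
proof -
  obtain v where "v \<in> C" "\<forall>c\<in>C. cinner (z - v) c = 0"
    using closed_csubspace_projection[OF assms(1), of z] by blast
  moreover have "z - v \<noteq> 0" using calculation(1) assms(2) by auto
  ultimately show ?thesis by blast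
qed

definition orthonormal :: "'a::complex_hilbert set \<Rightarrow> bool" where
  "orthonormal E \<longleftrightarrow> (\<forall>x\<in>E. \<forall>y\<in>E. cinner x y = (if x = y then 1 else 0))"

lemma orthonormal_subset: "orthonormal E \<Longrightarrow> F \<subseteq> E \<Longrightarrow> orthonormal F"
  unfolding orthonormal_def by blast

lemma is_onb_orthonormal: "is_onb E \<Longrightarrow> orthonormal E"
  by (simp add: is_onb_def orthonormal_def)

lemma onb_exists: "\<exists>E :: 'a::complex_hilbert set. is_onb E"
proof -
  have "\<exists>M\<in>{E :: 'a set. orthonormal E}. \<forall>X\<in>{E. orthonormal E}. M \<subseteq> X \<longrightarrow> X = M"
  proof (rule subset_Zorn')
    fix \<C> :: "'a set set" assume ch: "subset.chain {E. orthonormal E} \<C>"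
    have "cinner x y = (if x = y then 1 else 0)" if "X \<in> \<C>" "Y \<in> \<C>" "x \<in> X" "y \<in> Y" for x y X Y
    proof -
      have "X \<subseteq> Y \<or> Y \<subseteq> X" using ch that(1,2) unfolding subset.chain_def by blast
      moreover have "orthonormal X" "orthonormal Y" using ch that(1,2) unfolding subset.chain_def by blast+
      ultimately show ?thesis using that unfolding orthonormal_def by blast
    qed
    then show "\<Union>\<C> \<in> {E. orthonormal E}" by (simp add: orthonormal_def)
  qed
  then obtain M :: "'a set" where M: "orthonormal M" "\<And>X. orthonormal X \<Longrightarrow> M \<subseteq> X \<Longrightarrow> X = M"
    by auto
  have "closed_csubspace hull M = UNIV"
  proof (rule ccontr)
    assume "closed_csubspace hull M \<noteq> UNIV"
    then obtain z where "z \<notin> closed_csubspace hull M" by blast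
    then obtain w where w: "w \<noteq> 0" "\<forall>c\<in>closed_csubspace hull M. cinner w c = 0"
      using closed_csubspace_orthogonal[OF closed_csubspace_hull] by blast
    define e where "e = (1 / norm w) *\<^sub>R w"
    have orth: "cinner e c = 0" if "c \<in> M" for c
      using w(2) that by (simp add: e_def cinner.scaleR_left hull_inc)
    moreover have "cinner c e = 0" if "c \<in> M" for c
      using orth[OF that] cinner_commute[of c e] by simp
    moreover have "cinner e e = 1"
      using w(1) by (simp add: e_def cinner.scaleR_left cinner.scaleR_right cinner_self scaleR_conv_of_real
          power2_eq_square field_simps)
    ultimately have "orthonormal (insert e M)" using M(1) by (auto simp: orthonormal_def)
    then have "e \<in> M" using M(2)[of "insert e M"] by blast
    then have "cinner e e = 0" by (rule orth)
    with \<open>cinner e e = 1\<close> show False by simp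
  qed
  then show ?thesis using M(1) unfolding is_onb_def orthonormal_def by blast
qed

definition fourier :: "'a::complex_hilbert set \<Rightarrow> 'a \<Rightarrow> 'a" where
  "fourier F x = (\<Sum>e\<in>F. cinner x e *\<^sub>C e)"

lemma fourier_pythagoras:
  assumes "orthonormal F" "finite F"
  shows "(norm (x - fourier F x))\<^sup>2 = (norm x)\<^sup>2 - (\<Sum>e\<in>F. (cmod (cinner x e))\<^sup>2)"
proof -
  let ?s = "complex_of_real (\<Sum>e\<in>F. (cmod (cinner x e))\<^sup>2)"
  have xF: "cinner x (fourier F x) = ?s"
    unfolding fourier_def cinner.sum_right cinner_scaleC_right of_real_sum
    by (intro sum.cong refl) (simp add: complex_norm_square[symmetric] mult.commute del: of_real_power)
  have eF: "cinner e (fourier F x) = cnj (cinner x e)" if "e \<in> F" for e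
  proof -
    have "cinner e (fourier F x) = (\<Sum>e'\<in>F. cnj (cinner x e') * cinner e e')"
      by (simp add: fourier_def cinner.sum_right cinner_scaleC_right)
    also have "\<dots> = (\<Sum>e'\<in>F. if e = e' then cnj (cinner x e) else 0)"
      using assms(1) that by (intro sum.cong) (auto simp: orthonormal_def)
    finally show ?thesis using assms(2) that by simp
  qed
  have FF: "cinner (fourier F x) (fourier F x) = ?s"
    unfolding fourier_def[of F x, THEN arg_cong, of "\<lambda>y. cinner y (fourier F x)"]
      cinner.sum_left cinner_scaleC_left of_real_sum
    by (intro sum.cong refl) (simp add: eF complex_norm_square[symmetric] del: of_real_power)
  have Fx: "cinner (fourier F x) x = ?s"
    by (subst cinner_commute) (simp only: xF complex_cnj_complex_of_real)
  have "cinner (x - fourier F x) (x - fourier F x) =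
      cinner x x - cinner x (fourier F x) - (cinner (fourier F x) x - cinner (fourier F x) (fourier F x))"
    by (simp add: cinner.diff_left cinner.diff_right)
  also have "\<dots> = complex_of_real ((norm x)\<^sup>2 - (\<Sum>e\<in>F. (cmod (cinner x e))\<^sup>2))"
    by (simp only: Fx xF FF) (simp add: cinner_self del: of_real_power)
  finally show ?thesis
    by (simp only: cinner_self of_real_eq_iff)
qed

lemma bessel:
  assumes "orthonormal F" "finite F"
  shows "(\<Sum>e\<in>F. (cmod (cinner x e))\<^sup>2) \<le> (norm x)\<^sup>2"
  using fourier_pythagoras[OF assms, of x] zero_le_power2[of "norm (x - fourier F x)"] by linarith

lemma norm_fourier_rest_le:
  assumes "orthonormal F" "finite F"
  shows "norm (x - fourier F x) \<le> norm x"
  by (rule power2_le_imp_le) (simp_all add: fourier_pythagoras[OF assms] sum_nonneg)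

lemma norm_fourier_rest_antimono:
  assumes "orthonormal F" "finite F" "G \<subseteq> F"
  shows "norm (x - fourier F x) \<le> norm (x - fourier G x)"
proof -
  have G: "orthonormal G" "finite G"
    by (rule orthonormal_subset[OF assms(1,3)], rule finite_subset[OF assms(3,2)])
  have "(\<Sum>e\<in>G. (cmod (cinner x e))\<^sup>2) \<le> (\<Sum>e\<in>F. (cmod (cinner x e))\<^sup>2)"
    using assms by (intro sum_mono2) auto
  then show ?thesis
    by (intro power2_le_imp_le[of "norm (x - fourier F x)"])
      (simp_all add: fourier_pythagoras[OF assms(1,2)] fourier_pythagoras[OF G])
qed

lemma fourier_linear:
  "fourier F (x + y) = fourier F x + fourier F y" "fourier F (x - y) = fourier F x - fourier F y"
  "fourier F (a *\<^sub>C x) = a *\<^sub>C fourier F x"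
  by (simp_all add: fourier_def cinner_add_left cinner.diff_left cinner_scaleC_left scaleC_add_left
      scaleC.diff_left sum.distrib sum_subtractf scaleC.sum_right scaleC_scaleC)

text \<open>The vectors approximable by finite Fourier sums form a closed complex subspace
  containing E, hence all of the hull. For sums one takes the union of the two index sets, which is
  harmless because remainders shrink as the set grows; for limits one uses that taking remainders is
  a contraction.\<close>

lemma fourier_approx:
  assumes "is_onb E" "\<epsilon> > 0"
  shows "\<exists>F. finite F \<and> F \<subseteq> E \<and> norm (x - fourier F x) < \<epsilon>"
proof -
  have oE: "orthonormal E" and hE: "closed_csubspace hull E = UNIV"
    using assms(1) by (auto simp: is_onb_def orthonormal_def[of E])
  note oF = orthonormal_subset[OF oE]
  define C where "C = {x. \<forall>\<epsilon>>0. \<exists>F. finite F \<and> F \<subseteq> E \<and> norm (x - fourier F x) < \<epsilon>}"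
  have add: "x + y \<in> C" if "x \<in> C" "y \<in> C" for x y
    unfolding C_def
  proof (intro CollectI allI impI)
    fix \<epsilon> :: real assume "\<epsilon> > 0"
    then have "\<epsilon> / 2 > 0" by simp
    obtain F where F: "finite F" "F \<subseteq> E" "norm (x - fourier F x) < \<epsilon> / 2"
      using \<open>x \<in> C\<close> \<open>\<epsilon> / 2 > 0\<close> unfolding C_def by blast
    obtain G where G: "finite G" "G \<subseteq> E" "norm (y - fourier G y) < \<epsilon> / 2"
      using \<open>y \<in> C\<close> \<open>\<epsilon> / 2 > 0\<close> unfolding C_def by blast
    have eq: "(x + y) - fourier (F \<union> G) (x + y) = (x - fourier (F \<union> G) x) + (y - fourier (F \<union> G) y)"
      by (simp add: fourier_linear)
    have "norm (x - fourier (F \<union> G) x) \<le> norm (x - fourier F x)"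
      "norm (y - fourier (F \<union> G) y) \<le> norm (y - fourier G y)"
      using F G oF by (intro norm_fourier_rest_antimono; simp)+
    then have "norm ((x + y) - fourier (F \<union> G) (x + y)) < \<epsilon>"
      using F(3) G(3) norm_triangle_ineq[of "x - fourier (F \<union> G) x" "y - fourier (F \<union> G) y"]
      unfolding eq by linarith
    then show "\<exists>F. finite F \<and> F \<subseteq> E \<and> norm (x + y - fourier F (x + y)) < \<epsilon>"
      using F G by (intro exI[of _ "F \<union> G"]) simp
  qed
  have scale: "a *\<^sub>C x \<in> C" if "x \<in> C" for a x
    unfolding C_def
  proof (intro CollectI allI impI)
    fix \<epsilon> :: real assume "\<epsilon> > 0"
    have p: "cmod a + 1 > 0" by (simp add: add_nonneg_pos)
    then have "\<epsilon> / (cmod a + 1) > 0" using \<open>\<epsilon> > 0\<close> by simp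
    then obtain F where F: "finite F" "F \<subseteq> E" "norm (x - fourier F x) < \<epsilon> / (cmod a + 1)"
      using \<open>x \<in> C\<close> unfolding C_def by blast
    have "norm (a *\<^sub>C x - fourier F (a *\<^sub>C x)) = cmod a * norm (x - fourier F x)"
      by (simp add: fourier_linear norm_scaleC flip: scaleC.diff_right)
    also have "\<dots> \<le> (cmod a + 1) * norm (x - fourier F x)" by (intro mult_right_mono) auto
    also have "\<dots> < \<epsilon>" using F(3) p by (simp add: field_simps)
    finally show "\<exists>F. finite F \<and> F \<subseteq> E \<and> norm (a *\<^sub>C x - fourier F (a *\<^sub>C x)) < \<epsilon>"
      using F by blast
  qed
  have "closed C"
    unfolding closed_sequential_limits
  proof (intro allI impI)
    fix X l assume X: "(\<forall>n. X n \<in> C) \<and> X \<longlonglongrightarrow> l"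
    show "l \<in> C"
      unfolding C_def
    proof (intro CollectI allI impI)
      fix \<epsilon> :: real assume "\<epsilon> > 0"
      then have "\<epsilon> / 2 > 0" by simp
      then obtain n where n: "norm (X n - l) < \<epsilon> / 2"
        using X LIMSEQ_D[of X l "\<epsilon> / 2"] by blast
      obtain F where F: "finite F" "F \<subseteq> E" "norm (X n - fourier F (X n)) < \<epsilon> / 2"
        using X \<open>\<epsilon> / 2 > 0\<close> unfolding C_def by blast
      have "l - fourier F l = (X n - fourier F (X n)) - ((X n - l) - fourier F (X n - l))"
        by (simp add: fourier_linear)
      then have "norm (l - fourier F l) \<le> norm (X n - fourier F (X n)) + norm ((X n - l) - fourier F (X n - l))"
        using norm_triangle_ineq4 by (simp only:)
      also have "\<dots> < \<epsilon>"
        using norm_fourier_rest_le[OF oF[OF F(2)] F(1), of "X n - l"] F(3) n by simp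
      finally show "\<exists>F. finite F \<and> F \<subseteq> E \<and> norm (l - fourier F l) < \<epsilon>" using F by blast
    qed
  qed
  moreover have "E \<subseteq> C"
  proof
    fix e assume "e \<in> E"
    then have "fourier {e} e = e" using oE by (simp add: fourier_def orthonormal_def)
    then show "e \<in> C" unfolding C_def using \<open>e \<in> E\<close> by (intro CollectI allI impI exI[of _ "{e}"]) simp
  qed
  moreover have "0 \<in> C"
    unfolding C_def by (intro CollectI allI impI exI[of _ "{}"]) (simp add: fourier_def)
  ultimately have "closed_csubspace C" unfolding closed_csubspace_def using add scale by blast
  then have "closed_csubspace hull E \<subseteq> C" using \<open>E \<subseteq> C\<close> by (intro hull_minimal)
  then show ?thesis using hE assms(2) unfolding C_def by blast
qed

lemma onb_expansion:
  assumes "is_onb E"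
  shows "((\<lambda>e. cinner x e *\<^sub>C e) has_sum x) E"
  unfolding has_sum_def tendsto_iff
proof (intro allI impI)
  fix \<epsilon> :: real assume "\<epsilon> > 0"
  obtain F where F: "finite F" "F \<subseteq> E" "norm (x - fourier F x) < \<epsilon>"
    using fourier_approx[OF assms \<open>\<epsilon> > 0\<close>] by blast
  have "dist (fourier G x) x < \<epsilon>" if G: "finite G" "F \<subseteq> G" "G \<subseteq> E" for G
  proof -
    have "orthonormal G" using is_onb_orthonormal[OF assms] G(3) by (rule orthonormal_subset)
    then have "norm (x - fourier G x) < \<epsilon>"
      using norm_fourier_rest_antimono[of G F x] G F(3) by simp
    then show ?thesis by (simp add: dist_norm norm_minus_commute)
  qed
  then show "\<forall>\<^sub>F G in finite_subsets_at_top E. dist (sum (\<lambda>e. cinner x e *\<^sub>C e) G) x < \<epsilon>"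
    unfolding eventually_finite_subsets_at_top fourier_def using F by blast
qed

section \<open>Operators between closed subspaces\<close>

lemma bopsI:
  fixes T :: "'a::complex_hilbert \<Rightarrow>\<^sub>L 'b::complex_hilbert"
  assumes "\<And>a x. T (a *\<^sub>C x) = a *\<^sub>C T x" "\<And>x. T x \<in> K"
    and "\<And>x. \<forall>y\<in>H. cinner x y = 0 \<Longrightarrow> T x = 0"
  shows "T \<in> bops H K"
proof -
  have "range T \<subseteq> K" by (rule image_subsetI) (rule assms(2))
  then show ?thesis
    unfolding bops_def using assms(1,3) by (intro CollectI conjI allI impI)
qed

lemma bopsD:
  assumes "T \<in> bops H K"
  shows "T (a *\<^sub>C x) = a *\<^sub>C T x" "T x \<in> K" "\<forall>y\<in>H. cinner x y = 0 \<Longrightarrow> T x = 0"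
proof -
  have "(\<forall>a x. T (a *\<^sub>C x) = a *\<^sub>C T x) \<and> range T \<subseteq> K \<and>
     (\<forall>x. (\<forall>y\<in>H. cinner x y = 0) \<longrightarrow> T x = 0)"
    using assms unfolding bops_def by (rule CollectD)
  then show "T (a *\<^sub>C x) = a *\<^sub>C T x" "T x \<in> K" "\<forall>y\<in>H. cinner x y = 0 \<Longrightarrow> T x = 0" by blast+
qed

text \<open>Both operators kill the orthogonal complement of H, so x may be replaced by its
  projection p; the difference of the values at p lies in K and can be tested against
  itself.\<close>

lemma bops_eqI:
  fixes S T :: "'a::complex_hilbert \<Rightarrow>\<^sub>L 'b::complex_hilbert"
  assumes H: "closed_csubspace H" and K: "closed_csubspace K" and S: "S \<in> bops H K" and T: "T \<in> bops H K"
    and eq: "\<And>h k. h \<in> H \<Longrightarrow> k \<in> K \<Longrightarrow> cinner (S h) k = cinner (T h) k"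
  shows "S = T"
proof (rule blinfun_eqI)
  fix x
  obtain p where p: "p \<in> H" "\<forall>y\<in>H. cinner (x - p) y = 0"
    using closed_csubspace_projection[OF H, of x] by blast
  have Sx: "S x = S p" using bopsD(3)[OF S p(2)] by (simp add: blinfun.diff_right)
  have Tx: "T x = T p" using bopsD(3)[OF T p(2)] by (simp add: blinfun.diff_right)
  define d where "d = S p - T p"
  have "S p + (-1) *\<^sub>R T p \<in> K"
    using K bopsD(2)[OF S, of p] closed_csubspace_scaleR[OF K bopsD(2)[OF T, of p], of "-1"]
    unfolding closed_csubspace_def by blast
  then have "d \<in> K" by (simp add: d_def)
  then have "cinner d d = 0"
    using eq[OF p(1), of d] by (subst (1) d_def) (simp only: cinner.diff_left diff_self)
  then have "d = 0" by (simp add: cinner_self)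
  then show "S x = T x" unfolding Sx Tx d_def by simp
qed

section \<open>Trace class operators as absolutely convergent series of rank one operators\<close>

lemma sums_in_closed_csubspace:
  assumes "closed_csubspace C" "\<And>n. f n \<in> C" "f sums s"
  shows "s \<in> C"
proof (rule closed_sequentially)
  show "closed C" using assms(1) by (simp add: closed_csubspace_def)
  show "(\<Sum>i<n. f i) \<in> C" for n using assms by (intro closed_csubspace_sum)
  show "(\<lambda>n. \<Sum>i<n. f i) \<longlonglongrightarrow> s" using assms(3) by (simp add: sums_def)
qed

text \<open>The vectors are not tied to subspaces here. Those representing \<open>b i\<close> may
  lie anywhere; the neighbouring factors of the product bring them into \<open>H 1\<close> and
  \<open>H (k + 1)\<close>.\<close>

definition nuclear_rep :: "('a::complex_hilbert \<Rightarrow>\<^sub>L 'b::complex_hilbert) \<Rightarrow> (nat \<Rightarrow> 'b) \<Rightarrow> (nat \<Rightarrow> 'a) \<Rightarrow> bool"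
  where "nuclear_rep A x y \<longleftrightarrow> summable (\<lambda>n. norm (x n) * norm (y n)) \<and>
    (\<forall>h. (\<lambda>n. cinner h (y n) *\<^sub>C x n) sums A h)"

lemma nuclear_bops:
  assumes "nuclear_rep A x y" "closed_csubspace K" "\<And>n. x n \<in> K" "\<And>n. y n \<in> H"
  shows "A \<in> bops H K"
  unfolding bops_def
proof (intro CollectI conjI allI impI subsetI)
  have A: "(\<lambda>n. cinner h (y n) *\<^sub>C x n) sums A h" for h
    using assms(1) by (simp add: nuclear_rep_def)
  show "A (a *\<^sub>C h) = a *\<^sub>C A h" for a h
    using A[of "a *\<^sub>C h"] bounded_linear.sums[OF bounded_linear_scaleC[of a] A[of h]]
    by (intro sums_unique2) (simp_all add: cinner_scaleC_left scaleC_scaleC)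
  show "z \<in> K" if z: "z \<in> range A" for z
  proof -
    obtain h where "z = A h" using z by blast
    moreover have "cinner h (y n) *\<^sub>C x n \<in> K" for n
      using assms(2,3) by (simp add: closed_csubspace_def)
    ultimately show ?thesis using sums_in_closed_csubspace[OF assms(2) _ A] by blast
  qed
  show "A h = 0" if "\<forall>z\<in>H. cinner h z = 0" for h
    using that assms(4) by (intro sums_unique2[OF A[of h]]) (simp add: scaleC.zero_left)
qed

text \<open>The basis in \<open>trace_pos\<close> is an arbitrary choice, so the bound is demanded
  for all finite orthonormal sets, which include the finite subsets of that basis.\<close>

lemma trace_pos_le:
  fixes T :: "'a::complex_hilbert \<Rightarrow>\<^sub>L 'a"
  assumes "\<And>F. finite F \<Longrightarrow> orthonormal F \<Longrightarrow> (\<Sum>e\<in>F. Re (cinner (T e) e)) \<le> c"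
    and "\<And>e. 0 \<le> Re (cinner (T e) e)"
  shows "trace_pos T \<le> ennreal c"
proof -
  let ?E = "SOME E :: 'a set. is_onb E"
  have "is_onb ?E" using onb_exists by (rule someI_ex)
  then have o: "orthonormal F" if "F \<subseteq> ?E" for F
    by (rule orthonormal_subset[OF is_onb_orthonormal that])
  have "(\<Sum>e\<in>F. ennreal (Re (cinner (T e) e))) \<le> ennreal c" if "finite F" "F \<subseteq> ?E" for F
    using assms(1)[OF that(1) o[OF that(2)]] assms(2) by (simp add: ennreal_leI)
  then show ?thesis
    unfolding trace_pos_def by (subst nonneg_infsum_complete) (auto intro!: SUP_least)
qed

text \<open>Writing |A| = V A with a contraction V, the diagonal entry of |A| at e is the sum over n
  of \<open>cinner e (y n)\<close> times \<open>cinner (V (x n)) e\<close>. Over a finite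
  orthonormal set F, Cauchy-Schwarz in the index e and Bessel for V (x n) and y n bound the n-th
  term by the product of the norms.\<close>

lemma nuclear_trace:
  assumes "nuclear_rep A x y" and "clin A"
  shows "trace_pos (sqrt_op (cadj A o\<^sub>L A)) \<le> ennreal (\<Sum>n. norm (x n) * norm (y n))"
proof (rule trace_pos_le)
  let ?S = "sqrt_op (cadj A o\<^sub>L A)"
  have A: "summable (\<lambda>n. norm (x n) * norm (y n))" "(\<lambda>n. cinner h (y n) *\<^sub>C x n) sums A h" for h
    using assms(1) by (simp_all add: nuclear_rep_def)
  note S = abs_op[OF assms(2)]
  note S' = positive_opD[OF S(1)]
  show "0 \<le> Re (cinner (?S e) e)" for e using S'(2) by (simp add: Re_cinner)
  have "\<exists>V. clin V \<and> ?S = V o\<^sub>L A \<and> (\<forall>w. norm (V w) \<le> norm w)"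
    by (rule douglas[OF assms(2) S'(1)]) (simp add: S(2))
  then obtain V where V: "clin V" "?S = V o\<^sub>L A" "\<And>w. norm (V w) \<le> norm w"
    by (elim exE conjE) simp
  fix F :: "'a set" assume F: "finite F" "orthonormal F"
  have entry: "(\<lambda>n. cinner (cinner e (y n) *\<^sub>C V (x n)) e) sums cinner (?S e) e" for e
  proof -
    have "(\<lambda>n. V (cinner e (y n) *\<^sub>C x n)) sums V (A e)"
      by (rule bounded_linear.sums[OF blinfun.bounded_linear_right A(2)])
    then have "(\<lambda>n. cinner e (y n) *\<^sub>C V (x n)) sums ?S e" by (simp add: clinD[OF V(1)] V(2))
    then show ?thesis by (rule bounded_linear.sums[OF cinner.bounded_linear_left])
  qed
  have "(\<lambda>n. Re (\<Sum>e\<in>F. cinner (cinner e (y n) *\<^sub>C V (x n)) e)) sums Re (\<Sum>e\<in>F. cinner (?S e) e)"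
    by (intro sums_Re sums_sum entry)
  moreover have "Re (\<Sum>e\<in>F. cinner (cinner e (y n) *\<^sub>C V (x n)) e) \<le> norm (x n) * norm (y n)" for n
  proof -
    have "Re (\<Sum>e\<in>F. cinner (cinner e (y n) *\<^sub>C V (x n)) e)
        \<le> cmod (\<Sum>e\<in>F. cinner (cinner e (y n) *\<^sub>C V (x n)) e)" by (rule complex_Re_le_cmod)
    also have "\<dots> \<le> (\<Sum>e\<in>F. cmod (cinner (V (x n)) e) * cmod (cinner (y n) e))"
      by (rule sum_norm_le)
        (simp add: cinner_scaleC_left norm_mult cinner_commute[of _ "y n"] mult.commute)
    also have "\<dots> \<le> L2_set (\<lambda>e. cmod (cinner (V (x n)) e)) F * L2_set (\<lambda>e. cmod (cinner (y n) e)) F"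
      using L2_set_mult_ineq[of "\<lambda>e. cmod (cinner (V (x n)) e)" "\<lambda>e. cmod (cinner (y n) e)" F] by simp
    also have "\<dots> \<le> norm (x n) * norm (y n)"
    proof (intro mult_mono)
      have L: "L2_set (\<lambda>e. cmod (cinner z e)) F \<le> norm z" for z
        unfolding L2_set_def using bessel[OF F(2,1), of z] by (simp add: real_le_lsqrt)
      show "L2_set (\<lambda>e. cmod (cinner (V (x n)) e)) F \<le> norm (x n)" using L V(3) order_trans by blast
      show "L2_set (\<lambda>e. cmod (cinner (y n) e)) F \<le> norm (y n)" by (rule L)
    qed auto
    finally show ?thesis .
  qed
  ultimately have "Re (\<Sum>e\<in>F. cinner (?S e) e) \<le> (\<Sum>n. norm (x n) * norm (y n))"
    by (metis (no_types, lifting) A(1) sums_le summable_sums)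
  then show "(\<Sum>e\<in>F. Re (cinner (?S e) e)) \<le> (\<Sum>n. norm (x n) * norm (y n))" by simp
qed

lemma nuclear_trace_class:
  assumes "nuclear_rep A x y" "closed_csubspace K" "\<And>n. x n \<in> K" "\<And>n. y n \<in> H"
  shows "A \<in> trace_class H K" "trace_norm A \<le> (\<Sum>n. norm (x n) * norm (y n))"
proof -
  have A: "A \<in> bops H K" by (rule nuclear_bops[OF assms])
  note le = nuclear_trace[OF assms(1) clin_bops[OF A]]
  show "A \<in> trace_class H K" using A le by (auto simp: trace_class_def intro: le_less_trans)
  have "0 \<le> (\<Sum>n. norm (x n) * norm (y n))"
    using assms(1) by (intro suminf_nonneg) (auto simp: nuclear_rep_def)
  then show "trace_norm A \<le> (\<Sum>n. norm (x n) * norm (y n))"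
    unfolding trace_norm_def using le enn2real_leI by blast
qed

text \<open>The index set N pads a finite D with zeros. The two clauses differ only in the type of
  the summands: an obtained enumeration is not polymorphic, yet the same one must serve a vector
  valued family and its real majorant.\<close>

lemma countable_enumeration:
  assumes "countable D"
  obtains N and e :: "nat \<Rightarrow> 'a" where
    "\<forall>(f :: 'a \<Rightarrow> 'b::real_normed_vector) s. (f has_sum s) D \<longrightarrow> (\<lambda>n. if n \<in> N then f (e n) else 0) sums s"
    "\<forall>(f :: 'a \<Rightarrow> real) s. (f has_sum s) D \<longrightarrow> (\<lambda>n. if n \<in> N then f (e n) else 0) sums s"
proof -
  define e where "e = from_nat_into D"
  define N where "N = to_nat_on D ` D"
  have bij: "bij_betw e N D"
    unfolding e_def N_def
    by (rule bij_betw_byWitness[of _ "to_nat_on D"]) (auto simp: assms)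
  have *: "(\<lambda>n. if n \<in> N then f (e n) else 0) sums s" if "(f has_sum s) D"
    for f :: "'a \<Rightarrow> 'c::real_normed_vector" and s
  proof (rule has_sum_imp_sums)
    have "((\<lambda>n. f (e n)) has_sum s) N" using has_sum_reindex_bij_betw[OF bij, of f s] that by blast
    then show "((\<lambda>n. if n \<in> N then f (e n) else 0) has_sum s) UNIV"
      by (rule iffD1[OF has_sum_cong_neutral, rotated -1]) auto
  qed
  show ?thesis
    by (rule that[of N e]) (intro allI impI *, assumption)+
qed

text \<open>
  With \<open>S = |A| = R\<^sup>2\<close> and \<open>A = W S\<close>, expanding \<open>R h\<close> in the basis \<open>E\<close> of \<open>trace_pos\<close> gives
  \<open>A h = (\<Sum>e\<in>E. cinner h (R e) *\<^sub>C W (R e))\<close>, and \<open>\<parallel>R e\<parallel>\<^sup>2 = \<langle>S e, e\<rangle>\<close>.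
\<close>

lemma trace_class_nuclear:
  assumes "A \<in> trace_class H K"
  obtains x y where "nuclear_rep A x y" "(\<Sum>n. norm (x n) * norm (y n)) \<le> trace_norm A"
proof -
  have A: "clin A" and fin: "trace_pos (sqrt_op (cadj A o\<^sub>L A)) < \<infinity>"
    using assms by (auto simp: trace_class_def clin_bops)
  define S where "S = sqrt_op (cadj A o\<^sub>L A)"
  note S = abs_op[OF A, folded S_def]
  define R where "R = sqrt_op S"
  note R = sqrt_op[OF S(1), folded R_def]
  note R' = positive_opD[OF R(1)]
  have "\<exists>W. clin W \<and> A = W o\<^sub>L S \<and> (\<forall>w. norm (W w) \<le> norm w)"
    by (rule douglas[OF positive_opD(1)[OF S(1)] A]) (simp add: S(2))
  then obtain W where W: "clin W" "A = W o\<^sub>L S" "\<And>w. norm (W w) \<le> norm w"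
    by (elim exE conjE) simp
  define E where "E = (SOME E :: 'a set. is_onb E)"
  have E: "is_onb E" unfolding E_def using onb_exists by (rule someI_ex)
  have Re: "Re (cinner (S e) e) = (norm (R e))\<^sup>2" for e
    by (simp add: Re_cinner R'(3) power2_norm_eq_inner flip: R(2))
  \<comment> \<open>Finiteness of the trace makes \<open>enn2real\<close> reversible, so the
    extended sum becomes a real one.\<close>
  define t where "t = trace_norm A"
  have "(\<Sum>\<^sub>\<infinity>e\<in>E. ennreal ((norm (R e))\<^sup>2)) = ennreal t"
    using fin unfolding t_def trace_norm_def trace_pos_def S_def[symmetric] E_def[symmetric] Re
    by simp
  then have hs: "((\<lambda>e. ennreal ((norm (R e))\<^sup>2)) has_sum ennreal t) E"
    by (metis has_sum_infsum nonneg_summable_on_complete zero_le)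
  have "t \<ge> 0" by (simp add: t_def trace_norm_def)
  have sumR: "((\<lambda>e. (norm (R e))\<^sup>2) has_sum t) E"
  proof -
    have "sum (\<lambda>e. ennreal ((norm (R e))\<^sup>2)) = (\<lambda>F. ennreal (\<Sum>e\<in>F. (norm (R e))\<^sup>2))"
      by (rule ext) (simp add: sum_nonneg)
    then show ?thesis
      using hs unfolding has_sum_def
      by (intro tendsto_ennrealD[OF _ _ \<open>t \<ge> 0\<close>]) (simp_all add: sum_nonneg)
  qed
  \<comment> \<open>The basis may be uncountable, but a summable real family has countable
    support.\<close>
  define D where "D = {e\<in>E. R e \<noteq> 0}"
  have "countable {e\<in>E. (norm (R e))\<^sup>2 \<noteq> 0}"
    using sumR summable_countable_real summable_on_def by blast
  then have D: "countable D" by (simp add: D_def)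
  have expand: "((\<lambda>e. cinner h (R e) *\<^sub>C W (R e)) has_sum A h) D" for h
  proof -
    have "((\<lambda>e. cinner (R h) e *\<^sub>C e) has_sum R h) E" by (rule onb_expansion[OF E])
    then have "((\<lambda>e. (W o\<^sub>L R) (cinner (R h) e *\<^sub>C e)) has_sum (W o\<^sub>L R) (R h)) E"
      by (rule has_sum_bounded_linear[OF blinfun.bounded_linear_right])
    moreover have "(W o\<^sub>L R) (cinner (R h) e *\<^sub>C e) = cinner h (R e) *\<^sub>C W (R e)" for e
      using cinner_cadj[OF R'(1), of h e] by (simp add: clinD[OF W(1)] clinD[OF R'(1)] R'(4))
    moreover have "(W o\<^sub>L R) (R h) = A h" by (simp add: W(2) flip: R(2))
    ultimately have "((\<lambda>e. cinner h (R e) *\<^sub>C W (R e)) has_sum A h) E" by simp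
    then show ?thesis
      by (rule iffD1[OF has_sum_cong_neutral, rotated -1])
        (auto simp: D_def blinfun.zero_right scaleC.zero_right)
  qed
  have sumD: "((\<lambda>e. (norm (R e))\<^sup>2) has_sum t) D"
    using sumR by (rule iffD1[OF has_sum_cong_neutral, rotated -1]) (auto simp: D_def)
  obtain N and e :: "nat \<Rightarrow> 'a" where eN:
    "\<forall>(f :: 'a \<Rightarrow> 'b) s. (f has_sum s) D \<longrightarrow> (\<lambda>n. if n \<in> N then f (e n) else 0) sums s"
    "\<forall>(f :: 'a \<Rightarrow> real) s. (f has_sum s) D \<longrightarrow> (\<lambda>n. if n \<in> N then f (e n) else 0) sums s"
    by (rule countable_enumeration[OF D, where 'b = 'b])
  define x where "x n = (if n \<in> N then W (R (e n)) else 0)" for n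
  define y where "y n = (if n \<in> N then R (e n) else 0)" for n
  have le: "norm (x n) * norm (y n) \<le> (if n \<in> N then (norm (R (e n)))\<^sup>2 else 0)" for n
    using W(3) by (simp add: x_def y_def power2_eq_square mult_right_mono)
  have sm: "(\<lambda>n. if n \<in> N then (norm (R (e n)))\<^sup>2 else 0) sums t" by (rule eN(2)[rule_format, OF sumD])
  have "summable (\<lambda>n. norm (x n) * norm (y n))"
    by (rule summable_comparison_test'[OF sums_summable[OF sm], of 0]) (use le in simp)
  moreover have "(\<lambda>n. cinner h (y n) *\<^sub>C x n) sums A h" for h
  proof -
    have "(\<lambda>n. cinner h (y n) *\<^sub>C x n) = (\<lambda>n. if n \<in> N then cinner h (R (e n)) *\<^sub>C W (R (e n)) else 0)"
      by (auto simp: x_def y_def scaleC.zero_right)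
    then show ?thesis using eN(1)[rule_format, OF expand] by simp
  qed
  ultimately have "nuclear_rep A x y" by (simp add: nuclear_rep_def)
  moreover have "(\<Sum>n. norm (x n) * norm (y n)) \<le> t"
    using suminf_le[OF le \<open>summable _\<close> sums_summable[OF sm]] sums_unique[OF sm] by simp
  ultimately show ?thesis using that unfolding t_def by blast
qed

lemma norm_nuclear_le:
  assumes "nuclear_rep A x y"
  shows "norm (A h) \<le> (\<Sum>n. norm (x n) * norm (y n)) * norm h"
proof -
  have A: "summable (\<lambda>n. norm (x n) * norm (y n))" "(\<lambda>n. cinner h (y n) *\<^sub>C x n) sums A h"
    using assms by (simp_all add: nuclear_rep_def)
  have "norm (A h) \<le> (\<Sum>n. norm (x n) * norm (y n) * norm h)"
  proof (rule norm_sums_le[OF A(2) summable_sums[OF summable_mult2[OF A(1)]]])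
    fix n
    have "norm (cinner h (y n) *\<^sub>C x n) \<le> (norm h * norm (y n)) * norm (x n)"
      unfolding norm_scaleC by (intro mult_right_mono cmod_cinner_le) auto
    then show "norm (cinner h (y n) *\<^sub>C x n) \<le> norm (x n) * norm (y n) * norm h"
      by (simp add: mult_ac)
  qed
  then show ?thesis by (simp add: suminf_mult2[OF A(1)])
qed

text \<open>This is the bridge between the two integrals: testing a Gel'fand--Pettis integral on
  these functionals gives the defining equation of the pointwise Pettis integral.\<close>

lemma matrix_coefficient_dual:
  "(\<lambda>A :: 'a::complex_hilbert \<Rightarrow>\<^sub>L 'b::complex_hilbert. cinner (A h) h') \<in> dual_on (trace_class H K) trace_norm"
  unfolding dual_on_def
proof (intro CollectI conjI ballI allI exI[of _ "norm h * norm h'"])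
  fix A :: "'a \<Rightarrow>\<^sub>L 'b" assume "A \<in> trace_class H K"
  then obtain x y where xy: "nuclear_rep A x y" "(\<Sum>n. norm (x n) * norm (y n)) \<le> trace_norm A"
    by (rule trace_class_nuclear)
  have "cmod (cinner (A h) h') \<le> norm (A h) * norm h'" by (rule cmod_cinner_le)
  also have "\<dots> \<le> (trace_norm A * norm h) * norm h'"
    using norm_nuclear_le[OF xy(1), of h] mult_right_mono[OF xy(2) norm_ge_zero[of h]]
    by (intro mult_right_mono) auto
  finally show "cmod (cinner (A h) h') \<le> norm h * norm h' * trace_norm A" by (simp add: mult_ac)
qed (simp_all add: blinfun.add_left cinner_add_left scaleC_blinfun.rep_eq cinner_scaleC_left)

section \<open>Projection valued measures and their functional calculus\<close>

lemma (in finite_measure) bounded_convergence: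
  fixes f :: "'a \<Rightarrow> 'b::{banach,second_countable_topology}"
  assumes "f \<in> borel_measurable M" "\<And>n. s n \<in> borel_measurable M"
    and "\<And>n x. x \<in> space M \<Longrightarrow> norm (s n x) \<le> C"
    and "\<And>x. x \<in> space M \<Longrightarrow> (\<lambda>n. s n x) \<longlonglongrightarrow> f x"
  shows "(\<lambda>n. \<integral>x. s n x \<partial>M) \<longlonglongrightarrow> (\<integral>x. f x \<partial>M)"
  by (rule integral_dominated_convergence[where w = "\<lambda>_. C"]) (use assms in auto)

lemma bops_lim:
  fixes T :: "'a::complex_hilbert \<Rightarrow>\<^sub>L 'b::complex_hilbert"
  assumes "\<And>n. S n \<in> bops H K" "closed K" "\<And>v. (\<lambda>n. S n v) \<longlonglongrightarrow> T v"
  shows "T \<in> bops H K"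
proof (rule bopsI)
  note S = bopsD[OF assms(1)]
  show "T (a *\<^sub>C x) = a *\<^sub>C T x" for a x
  proof (rule LIMSEQ_unique[OF assms(3)])
    show "(\<lambda>n. S n (a *\<^sub>C x)) \<longlonglongrightarrow> a *\<^sub>C T x" unfolding S(1) by (intro scaleC.tendsto tendsto_const assms(3))
  qed
  show "T x \<in> K" for x by (rule closed_sequentially[OF assms(2) S(2) assms(3)])
  show "T x = 0" if "\<forall>y\<in>H. cinner x y = 0" for x
    using assms(3)[of x] unfolding S(3)[OF that] LIMSEQ_const_iff by (rule sym)
qed

lemma bops_add:
  assumes S: "S \<in> bops H K" and T: "T \<in> bops H K" and K: "closed_csubspace K"
  shows "S + T \<in> bops H K"
proof (rule bopsI)
  show "(S + T) x \<in> K" for x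
    using K bopsD(2)[OF S, of x] bopsD(2)[OF T, of x] by (simp add: closed_csubspace_def blinfun.add_left)
  show "(S + T) x = 0" if "\<forall>y\<in>H. cinner x y = 0" for x
    by (simp add: blinfun.add_left bopsD(3)[OF S that] bopsD(3)[OF T that])
qed (simp add: blinfun.add_left bopsD(1)[OF S] bopsD(1)[OF T] scaleC_add_right)

lemma bops_scaleC:
  assumes T: "T \<in> bops H K" and K: "closed_csubspace K"
  shows "a *\<^sub>C T \<in> bops H K"
proof (rule bopsI)
  show "(a *\<^sub>C T) x \<in> K" for x
    using K bopsD(2)[OF T, of x] by (simp add: closed_csubspace_def scaleC_blinfun.rep_eq)
  show "(a *\<^sub>C T) x = 0" if "\<forall>y\<in>H. cinner x y = 0" for x
    by (simp add: scaleC_blinfun.rep_eq bopsD(3)[OF T that] scaleC.zero_right)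
qed (simp add: scaleC_blinfun.rep_eq bopsD(1)[OF T] scaleC_scaleC mult.commute)

lemma blinfun_pointwise_limit:
  fixes S :: "nat \<Rightarrow> 'a::real_normed_vector \<Rightarrow>\<^sub>L 'b::banach"
  assumes "\<And>v. Cauchy (\<lambda>n. S n v)" "\<And>n v. norm (S n v) \<le> c * norm v"
  shows "\<exists>T :: 'a \<Rightarrow>\<^sub>L 'b. \<forall>v. (\<lambda>n. S n v) \<longlonglongrightarrow> T v"
proof -
  have "\<exists>l. (\<lambda>n. S n v) \<longlonglongrightarrow> l" for v
    using Cauchy_convergent[OF assms(1)] unfolding convergent_def .
  then have "\<exists>t. \<forall>v. (\<lambda>n. S n v) \<longlonglongrightarrow> t v" by (intro choice allI)
  then obtain t where t: "\<And>v. (\<lambda>n. S n v) \<longlonglongrightarrow> t v" by blast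
  have "bounded_linear t"
  proof (rule bounded_linear_intro)
    show "t (x + y) = t x + t y" for x y
      by (rule LIMSEQ_unique[OF t], unfold blinfun.add_right, intro tendsto_add t)
    show "t (r *\<^sub>R x) = r *\<^sub>R t x" for r x
      by (rule LIMSEQ_unique[OF t], unfold blinfun.scaleR_right, intro tendsto_scaleR tendsto_const t)
    show "norm (t x) \<le> norm x * c" for x
      unfolding mult.commute[of "norm x"]
      by (rule LIMSEQ_le_const2[OF tendsto_norm[OF t]]) (intro exI allI impI assms(2))
  qed
  then have "blinfun_apply (Blinfun t) = t" by (rule bounded_linear_Blinfun_apply)
  then show ?thesis using t by (intro exI[of _ "Blinfun t"]) (simp only:, blast)
qed

lemma borel_measurable_cnj [measurable (raw)]:
  "f \<in> borel_measurable M \<Longrightarrow> (\<lambda>x. cnj (f x)) \<in> borel_measurable M"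
  by (rule borel_measurable_continuous_on[of cnj]) (intro continuous_intros)

locale pvm_space =
  fixes M :: "'w measure" and K :: "'a::complex_hilbert set" and Q :: "'w set \<Rightarrow> 'a \<Rightarrow>\<^sub>L 'a"
  assumes pvm: "pvm M K Q"
begin

lemma K: "closed_csubspace K"
  using pvm by (simp add: pvm_def)

lemma Q_bops: "G \<in> sets M \<Longrightarrow> Q G \<in> bops K K"
  using pvm by (simp add: pvm_def)

lemma clin_Q: "G \<in> sets M \<Longrightarrow> clin (Q G)"
  using Q_bops clin_bops by blast

lemma Q_in: "G \<in> sets M \<Longrightarrow> Q G x \<in> K"
  using Q_bops by (rule bopsD(2))

lemma Q_idem: "G \<in> sets M \<Longrightarrow> Q G (Q G x) = Q G x"
  using pvm unfolding pvm_def by (metis blinfun_apply_blinfun_compose)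

lemma Q_adj: "G \<in> sets M \<Longrightarrow> cinner (Q G x) y = cinner x (Q G y)"
  using pvm cinner_cadj[OF clin_Q, of G x y] by (simp add: pvm_def)

lemma Q_space: "x \<in> K \<Longrightarrow> Q (space M) x = x"
  using pvm by (simp add: pvm_def)

lemma Q_Q_space: "G \<in> sets M \<Longrightarrow> Q G (Q (space M) x) = Q G x"
  by (rule cinner_eqI) (simp add: Q_adj Q_space Q_in)

lemma cinner_Q: "G \<in> sets M \<Longrightarrow> cinner (Q G v) v = complex_of_real ((norm (Q G v))\<^sup>2)"
  using Q_adj[of G "Q G v" v] Q_idem[of G v] by (simp add: cinner_self)

lemma norm_Q_le: "G \<in> sets M \<Longrightarrow> norm (Q G v) \<le> norm v"
proof (cases "Q G v = 0")
  case False
  assume G: "G \<in> sets M"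
  have "(norm (Q G v))\<^sup>2 = cmod (cinner (Q G v) v)" by (simp add: cinner_Q[OF G] norm_power)
  also have "\<dots> \<le> norm (Q G v) * norm v" by (rule cmod_cinner_le)
  finally show ?thesis using False by (simp add: power2_eq_square)
qed simp

lemma Q_sums:
  assumes "range G \<subseteq> sets M" "disjoint_family G"
  shows "(\<lambda>n. (norm (Q (G n) v))\<^sup>2) sums (norm (Q (\<Union>n. G n) v))\<^sup>2"
proof -
  \<comment> \<open>Countable additivity is available only for vectors of K; passing from v to its
    projection does not change the values of the measure.\<close>
  let ?w = "Q (space M) v"
  have U: "(\<Union>n. G n) \<in> sets M" using assms(1) by blast
  have G: "G n \<in> sets M" for n using assms(1) by blast
  have "?w \<in> K" by (simp add: Q_in)
  then have "(\<lambda>n. cinner (Q (G n) ?w) ?w) sums cinner (Q (\<Union>n. G n) ?w) ?w"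
    using pvm assms unfolding pvm_def by blast
  moreover have "cinner (Q A ?w) ?w = complex_of_real ((norm (Q A v))\<^sup>2)" if "A \<in> sets M" for A
    using cinner_Q[OF that, of ?w] by (simp only: Q_Q_space[OF that])
  ultimately have "(\<lambda>n. complex_of_real ((norm (Q (G n) v))\<^sup>2)) sums complex_of_real ((norm (Q (\<Union>n. G n) v))\<^sup>2)"
    using U G by simp
  then show ?thesis by (simp only: sums_of_real_iff)
qed

lemma Q_empty [simp]: "Q {} = 0"
proof (rule blinfun_eqI)
  fix v
  have "(\<lambda>n::nat. (norm (Q {} v))\<^sup>2) sums (norm (Q {} v))\<^sup>2"
    using Q_sums[of "\<lambda>_. {}" v] by (simp add: disjoint_family_on_def)
  then have "(\<lambda>n::nat. (norm (Q {} v))\<^sup>2) \<longlonglongrightarrow> 0"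
    by (intro summable_LIMSEQ_zero sums_summable)
  then show "Q {} v = blinfun_apply 0 v" by (simp add: LIMSEQ_const_iff)
qed

text \<open>The scalar spectral measure of v, written with a square so that it is visibly
  nonnegative; it agrees with \<open>cinner (Q G v) v\<close> by \<open>cinner_Q\<close>.\<close>

definition mu :: "'a \<Rightarrow> 'w measure" where
  "mu v = measure_of (space M) (sets M) (\<lambda>G. ennreal ((norm (Q G v))\<^sup>2))"

lemma sets_mu [simp, measurable_cong]: "sets (mu v) = sets M"
  by (simp add: mu_def sets.sigma_sets_eq)

lemma space_mu [simp]: "space (mu v) = space M"
  by (simp add: mu_def)

lemma emeasure_mu: "G \<in> sets M \<Longrightarrow> emeasure (mu v) G = ennreal ((norm (Q G v))\<^sup>2)"
  unfolding mu_def
proof (rule emeasure_measure_of_sigma)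
  show "countably_additive (sets M) (\<lambda>G. ennreal ((norm (Q G v))\<^sup>2))"
  proof (rule countably_additiveI)
    fix A :: "nat \<Rightarrow> 'w set" assume "range A \<subseteq> sets M" "disjoint_family A"
    from Q_sums[OF this, of v] show "(\<Sum>i. ennreal ((norm (Q (A i) v))\<^sup>2)) = ennreal ((norm (Q (\<Union>i. A i) v))\<^sup>2)"
      by (intro suminf_ennreal_eq) auto
  qed
qed (simp_all add: sets.sigma_algebra_axioms positive_def)

lemma finite_mu: "finite_measure (mu v)"
  by (rule finite_measureI) (simp add: emeasure_mu)

lemma measure_mu: "G \<in> sets M \<Longrightarrow> measure (mu v) G = (norm (Q G v))\<^sup>2"
  by (simp add: measure_def emeasure_mu)

lemma Q_Un:
  assumes "A \<in> sets M" "B \<in> sets M" "A \<inter> B = {}"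
  shows "Q (A \<union> B) = Q A + Q B"
proof (rule clin_eqI)
  interpret finite_measure "mu x" for x by (rule finite_mu)
  show "clin (Q (A \<union> B))" using assms by (intro clin_Q) simp
  show "clin (Q A + Q B)"
    using clin_Q[OF assms(1)] clin_Q[OF assms(2)] by (simp add: clin_def blinfun.add_left scaleC_add_right)
  fix x
  have "measure (mu x) (A \<union> B) = measure (mu x) A + measure (mu x) B"
    using assms by (intro finite_measure_Union) auto
  then have "(norm (Q (A \<union> B) x))\<^sup>2 = (norm (Q A x))\<^sup>2 + (norm (Q B x))\<^sup>2"
    using assms by (simp add: measure_mu)
  then show "cinner (Q (A \<union> B) x) x = cinner ((Q A + Q B) x) x"
    by (simp only: cinner_Q[OF assms(1)] cinner_Q[OF assms(2)] cinner_Q[OF sets.Un[OF assms(1,2)]]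
        blinfun.add_left cinner_add_left of_real_add)
qed

text \<open>Additivity of the spectral measure of Q B v gives |Q (A \<union> B) Q B v|^2 = |Q A Q B
  v|^2 + |Q B v|^2, whereas a projection cannot increase the norm of Q B v.\<close>

lemma Q_disjoint:
  assumes "A \<in> sets M" "B \<in> sets M" "A \<inter> B = {}"
  shows "Q A (Q B v) = 0"
proof -
  interpret finite_measure "mu (Q B v)" by (rule finite_mu)
  have "measure (mu (Q B v)) (A \<union> B) = measure (mu (Q B v)) A + measure (mu (Q B v)) B"
    using assms by (intro finite_measure_Union) auto
  moreover have "(norm (Q (A \<union> B) (Q B v)))\<^sup>2 \<le> (norm (Q B v))\<^sup>2"
    using assms by (intro power_mono norm_Q_le) auto
  ultimately show ?thesis using assms by (simp add: measure_mu Q_idem)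
qed

lemma Q_Int:
  assumes "A \<in> sets M" "B \<in> sets M"
  shows "Q A (Q B v) = Q (A \<inter> B) v"
proof -
  have A: "Q A = Q (A \<inter> B) + Q (A - B)" and B: "Q B = Q (A \<inter> B) + Q (B - A)"
    using assms by (subst Q_Un[symmetric]; auto intro: arg_cong[where f = Q])+
  have "Q A (Q B v) = Q (A \<inter> B) (Q (A \<inter> B) v) + Q (A \<inter> B) (Q (B - A) v)
      + (Q (A - B) (Q (A \<inter> B) v) + Q (A - B) (Q (B - A) v))"
    by (subst A, subst B) (simp add: blinfun.add_left blinfun.add_right)
  moreover have "Q (A \<inter> B) (Q (B - A) v) = 0" "Q (A - B) (Q (A \<inter> B) v) = 0" "Q (A - B) (Q (B - A) v) = 0"
    using assms by (intro Q_disjoint; auto)+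
  moreover have "Q (A \<inter> B) (Q (A \<inter> B) v) = Q (A \<inter> B) v" using assms by (intro Q_idem) auto
  ultimately show ?thesis by simp
qed

text \<open>
  The functional calculus on bounded measurable functions is introduced as a relation, so that its
  properties can be proved by induction; existence and uniqueness of the value come afterwards.
\<close>

inductive calc :: "('w \<Rightarrow> complex) \<Rightarrow> ('a \<Rightarrow>\<^sub>L 'a) \<Rightarrow> bool" where
  calc_indicator: "G \<in> sets M \<Longrightarrow> calc (\<lambda>w. a * indicator G w) (a *\<^sub>C Q G)"
| calc_add: "calc f S \<Longrightarrow> calc g T \<Longrightarrow> calc (\<lambda>w. f w + g w) (S + T)"
| calc_lim: "(\<And>n. calc (s n) (S n)) \<Longrightarrow> (\<And>n w. w \<in> space M \<Longrightarrow> cmod (s n w) \<le> C) \<Longrightarrow>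
    (\<And>w. w \<in> space M \<Longrightarrow> (\<lambda>n. s n w) \<longlonglongrightarrow> f w) \<Longrightarrow> (\<And>v. (\<lambda>n. S n v) \<longlonglongrightarrow> (T :: 'a \<Rightarrow>\<^sub>L 'a) v) \<Longrightarrow> calc f T"

lemma calc_bounded: "calc f T \<Longrightarrow> \<exists>C. \<forall>w\<in>space M. cmod (f w) \<le> C"
proof (induction rule: calc.induct)
  case (calc_indicator G a)
  then show ?case by (intro exI[of _ "cmod a"]) (auto simp: indicator_def)
next
  case (calc_add f S g T)
  then obtain C D where "\<forall>w\<in>space M. cmod (f w) \<le> C" "\<forall>w\<in>space M. cmod (g w) \<le> D" by blast
  then show ?case by (intro exI[of _ "C + D"]) (auto intro: norm_triangle_le add_mono)
next
  case (calc_lim s S C f T)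
  have "cmod (f w) \<le> C" if "w \<in> space M" for w
    by (rule LIMSEQ_le_const2[OF tendsto_norm[OF calc_lim(3)[OF that]]]) (use calc_lim(2)[OF that] in blast)
  then show ?case by blast
qed

lemma calc_measurable: "calc f T \<Longrightarrow> f \<in> borel_measurable M"
proof (induction rule: calc.induct)
  case (calc_lim s S C f T)
  then show ?case by (intro borel_measurable_LIMSEQ_metric[of s M f]) auto
qed auto

lemma calc_bops: "calc f T \<Longrightarrow> T \<in> bops K K"
proof (induction rule: calc.induct)
  case (calc_lim s S C f T)
  then show ?case using K by (intro bops_lim[of S K K T]) (auto simp: closed_csubspace_def)
qed (auto intro: bops_add bops_scaleC Q_bops K)

lemma calc_scale: "calc f T \<Longrightarrow> calc (\<lambda>w. c * f w) (c *\<^sub>C T)"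
proof (induction rule: calc.induct)
  case (calc_indicator G a)
  then show ?case using calc.calc_indicator[of G "c * a"] by (simp add: scaleC_scaleC mult.assoc)
next
  case (calc_add f S g T)
  then show ?case using calc.calc_add[OF calc_add.IH] by (simp add: algebra_simps scaleC_add_right)
next
  case (calc_lim s S C f T)
  show ?case
  proof (rule calc.calc_lim[OF calc_lim.IH(1), where C = "cmod c * C"])
    show "cmod (c * s n w) \<le> cmod c * C" if "w \<in> space M" for n w
      using calc_lim(2)[OF that] by (simp add: norm_mult mult_left_mono)
    show "(\<lambda>n. c * s n w) \<longlonglongrightarrow> c * f w" if "w \<in> space M" for w
      by (intro tendsto_intros calc_lim(3) that)
    show "(\<lambda>n. (c *\<^sub>C S n) v) \<longlonglongrightarrow> (c *\<^sub>C T) v" for v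
      unfolding scaleC_blinfun.rep_eq by (intro scaleC.tendsto tendsto_const calc_lim(4))
  qed
qed

lemma calc_diff:
  assumes "calc f S" "calc g T"
  shows "calc (\<lambda>w. f w - g w) (S - T)"
proof -
  have "(-1) *\<^sub>C T = - T" by (metis scaleC.minus_left scaleC_one)
  then show ?thesis using calc_add[OF assms(1) calc_scale[OF assms(2), of "-1"]] by simp
qed

lemma calc_cong:
  assumes "calc f T" "\<And>w. w \<in> space M \<Longrightarrow> f w = g w"
  shows "calc g T"
proof -
  obtain C where "\<forall>w\<in>space M. cmod (f w) \<le> C" using calc_bounded[OF assms(1)] by blast
  then show ?thesis
    using assms by (intro calc_lim[of "\<lambda>_. f" "\<lambda>_. T" C g T]) auto
qed

lemma calc_sum: "finite Y \<Longrightarrow> (\<And>y. y \<in> Y \<Longrightarrow> calc (f y) (T y)) \<Longrightarrow> calc (\<lambda>w. \<Sum>y\<in>Y. f y w) (\<Sum>y\<in>Y. T y)"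
proof (induction rule: finite_induct)
  case empty
  show ?case using calc_indicator[of "{}" 0] by (simp add: scaleC.zero_left)
qed (simp add: calc_add)

section \<open>The isometry between the calculus and square integrable functions\<close>

lemma calc_integrable:
  assumes "calc f T"
  shows "integrable (mu v) f"
proof -
  interpret finite_measure "mu v" by (rule finite_mu)
  obtain C where "\<forall>w\<in>space M. cmod (f w) \<le> C" using calc_bounded[OF assms] by blast
  then show ?thesis using calc_measurable[OF assms]
    by (intro integrable_const_bound[of _ C]) (auto intro: AE_I2)
qed

lemma calc_integrable_mult:
  assumes "calc f S" "calc g T"
  shows "integrable (mu v) (\<lambda>w. f w * cnj (g w))"
proof -
  interpret finite_measure "mu v" by (rule finite_mu)
  obtain C where C: "\<forall>w\<in>space M. cmod (f w) \<le> C" using calc_bounded[OF assms(1)] by blast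
  obtain D where D: "\<forall>w\<in>space M. cmod (g w) \<le> D" using calc_bounded[OF assms(2)] by blast
  have "cmod (f w * cnj (g w)) \<le> C * D" if "w \<in> space M" for w
    unfolding norm_mult complex_mod_cnj using C D that order_trans[OF norm_ge_zero, of "f w" C]
    by (intro mult_mono) auto
  then show ?thesis using calc_measurable[OF assms(1)] calc_measurable[OF assms(2)]
    by (intro integrable_const_bound[of _ "C * D"]) (auto intro: AE_I2)
qed

text \<open>The identity of \<open>calc_inner\<close> takes one induction for each of its two
  functions; this is the induction on the second one, with an indicator in the first place.\<close>

lemma calc_inner_indicator:
  assumes "calc g T" "G \<in> sets M"
  shows "cinner (Q G v) (T v) = (\<integral>w. indicator G w * cnj (g w) \<partial>mu v)"
  using assms(1)
proof (induction rule: calc.induct)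
  case (calc_indicator F a)
  have "cinner (Q G v) ((a *\<^sub>C Q F) v) = cnj a * cinner v (Q G (Q F v))"
    using assms(2) by (simp add: scaleC_blinfun.rep_eq cinner_scaleC_right Q_adj)
  also have "cinner v (Q G (Q F v)) = cinner (Q (G \<inter> F) v) v"
    using assms(2) calc_indicator by (simp add: Q_Int Q_adj)
  also have "\<dots> = complex_of_real (measure (mu v) (G \<inter> F))"
    using assms(2) calc_indicator by (simp add: cinner_Q measure_mu)
  also have "cnj a * \<dots> = (\<integral>w. cnj a * indicator (G \<inter> F) w \<partial>mu v)"
  proof -
    have "(\<integral>w. (indicator (G \<inter> F) w :: complex) \<partial>mu v) = (\<integral>w. complex_of_real (indicator (G \<inter> F) w) \<partial>mu v)"
      by (intro Bochner_Integration.integral_cong) (auto simp: indicator_def)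
    also have "\<dots> = complex_of_real (measure (mu v) (G \<inter> F))"
      using assms(2) calc_indicator sets.sets_into_space[of "G \<inter> F" M] by (simp add: Int_absorb2)
    finally show ?thesis by simp
  qed
  also have "\<dots> = (\<integral>w. indicator G w * cnj (a * indicator F w) \<partial>mu v)"
    by (intro Bochner_Integration.integral_cong) (auto simp: indicator_def)
  finally show ?case .
next
  case (calc_add f S g T)
  have G: "calc (indicator G) (Q G)" using calc_indicator[of G 1] assms(2) by simp
  show ?case
    using calc_add.IH calc_integrable_mult[OF G calc_add.hyps(1)] calc_integrable_mult[OF G calc_add.hyps(2)]
    by (simp add: blinfun.add_left cinner_add_right distrib_left)
next
  case (calc_lim s S C f T)
  interpret finite_measure "mu v" by (rule finite_mu)
  have [measurable]: "s n \<in> borel_measurable M" for n using calc_measurable[OF calc_lim(1)] .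
  have [measurable]: "f \<in> borel_measurable M"
    using calc_measurable calc.calc_lim calc_lim.hyps by metis
  have [measurable]: "G \<in> sets M" by fact
  have "(\<lambda>n. \<integral>w. indicator G w * cnj (s n w) \<partial>mu v) \<longlonglongrightarrow> (\<integral>w. indicator G w * cnj (f w) \<partial>mu v)"
  proof (rule bounded_convergence[where C = C])
    show "norm (indicator G w * cnj (s n w)) \<le> C" if "w \<in> space (mu v)" for n w
    proof -
      have "cmod (s n w) \<le> C" using calc_lim(2) that by simp
      moreover have "0 \<le> C" using norm_ge_zero calculation by (rule order_trans)
      ultimately show ?thesis by (auto simp: indicator_def)
    qed
    show "(\<lambda>n. indicator G w * cnj (s n w)) \<longlonglongrightarrow> indicator G w * cnj (f w)" if "w \<in> space (mu v)" for w
      using that by (intro tendsto_intros calc_lim(3)) simp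
  qed measurable
  moreover have "(\<lambda>n. cinner (Q G v) (S n v)) \<longlonglongrightarrow> cinner (Q G v) (T v)"
    by (intro cinner.tendsto tendsto_const calc_lim(4))
  ultimately show ?case using calc_lim.IH by (simp add: LIMSEQ_unique)
qed

text \<open>For fixed v the assignment of T v to f preserves the inner product of L^2 with respect
  to \<open>mu v\<close>. Norm bounds, uniqueness and continuity of the calculus are all read off
  from this.\<close>

lemma calc_inner:
  assumes "calc f S" "calc g T"
  shows "cinner (S v) (T v) = (\<integral>w. f w * cnj (g w) \<partial>mu v)"
  using assms(1)
proof (induction rule: calc.induct)
  case (calc_indicator G a)
  have "cinner ((a *\<^sub>C Q G) v) (T v) = a * cinner (Q G v) (T v)"
    by (simp add: scaleC_blinfun.rep_eq cinner_scaleC_left)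
  also have "\<dots> = (\<integral>w. a * (indicator G w * cnj (g w)) \<partial>mu v)"
    by (simp add: calc_inner_indicator[OF assms(2) calc_indicator])
  finally show ?case by (simp add: mult.assoc)
next
  case (calc_add f S h U)
  show ?case
    using calc_add.IH calc_integrable_mult[OF calc_add.hyps(1) assms(2)]
      calc_integrable_mult[OF calc_add.hyps(2) assms(2)]
    by (simp add: blinfun.add_left cinner_add_left distrib_right)
next
  case (calc_lim s S C f S')
  interpret finite_measure "mu v" by (rule finite_mu)
  have [measurable]: "s n \<in> borel_measurable M" for n using calc_measurable[OF calc_lim(1)] .
  have [measurable]: "f \<in> borel_measurable M"
    using calc_measurable calc.calc_lim calc_lim.hyps by metis
  have [measurable]: "g \<in> borel_measurable M" by (rule calc_measurable[OF assms(2)])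
  obtain D where D: "\<forall>w\<in>space M. cmod (g w) \<le> D" using calc_bounded[OF assms(2)] by blast
  have "(\<lambda>n. \<integral>w. s n w * cnj (g w) \<partial>mu v) \<longlonglongrightarrow> (\<integral>w. f w * cnj (g w) \<partial>mu v)"
  proof (rule bounded_convergence[where C = "C * D"])
    show "norm (s n w * cnj (g w)) \<le> C * D" if "w \<in> space (mu v)" for n w
    proof -
      have "cmod (s n w) \<le> C" "cmod (g w) \<le> D" using calc_lim(2) D that by simp_all
      moreover have "0 \<le> C" using norm_ge_zero calculation(1) by (rule order_trans)
      ultimately show ?thesis unfolding norm_mult complex_mod_cnj by (intro mult_mono) auto
    qed
    show "(\<lambda>n. s n w * cnj (g w)) \<longlonglongrightarrow> f w * cnj (g w)" if "w \<in> space (mu v)" for w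
      using that by (intro tendsto_intros calc_lim(3)) simp
  qed measurable
  moreover have "(\<lambda>n. cinner (S n v) (T v)) \<longlonglongrightarrow> cinner (S' v) (T v)"
    by (intro cinner.tendsto tendsto_const calc_lim(4))
  ultimately show ?case using calc_lim.IH by (simp add: LIMSEQ_unique)
qed

lemma calc_integrable_norm2:
  assumes "calc f T"
  shows "integrable (mu v) (\<lambda>w. (cmod (f w))\<^sup>2)"
proof -
  have "integrable (mu v) (\<lambda>w. Re (f w * cnj (f w)))"
    using calc_integrable_mult[OF assms assms] by (rule integrable_Re)
  moreover have "Re (f w * cnj (f w)) = (cmod (f w))\<^sup>2" for w
    by (simp add: cmod_power2 flip: power2_eq_square)
  ultimately show ?thesis by simp
qed

lemma calc_norm:
  assumes "calc f T"
  shows "(norm (T v))\<^sup>2 = (\<integral>w. (cmod (f w))\<^sup>2 \<partial>mu v)"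
proof -
  have "complex_of_real ((norm (T v))\<^sup>2) = (\<integral>w. f w * cnj (f w) \<partial>mu v)"
    using calc_inner[OF assms assms, of v] by (simp add: cinner_self)
  also have "\<dots> = (\<integral>w. complex_of_real ((cmod (f w))\<^sup>2) \<partial>mu v)"
    by (simp only: complex_norm_square)
  also have "\<dots> = complex_of_real (\<integral>w. (cmod (f w))\<^sup>2 \<partial>mu v)"
    by (rule integral_of_real[OF calc_integrable_norm2[OF assms]])
  finally show ?thesis by (simp only: of_real_eq_iff)
qed

text \<open>On the ambient space the unit of the calculus is the projection onto K rather than the
  identity.\<close>

lemma calc_one: "calc (\<lambda>_. 1) (Q (space M))"
  by (rule calc_cong[where f = "\<lambda>w. 1 * indicator (space M) w"])
    (use calc_indicator[of "space M" 1] in \<open>auto simp: scaleC_one\<close>)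

lemma calc_quadratic:
  assumes "calc f T"
  shows "cinner (T v) v = (\<integral>w. f w \<partial>mu v)"
proof -
  have "T v \<in> K" using calc_bops[OF assms] by (rule bopsD(2))
  then have "cinner (T v) v = cinner (T v) (Q (space M) v)"
    using Q_adj[of "space M" "T v" v] by (simp add: Q_space)
  then show ?thesis using calc_inner[OF assms calc_one] by simp
qed

lemma calc_norm_le:
  assumes "calc f T" "c \<ge> 0" "AE w in mu v. cmod (f w) \<le> c"
  shows "norm (T v) \<le> c * norm v"
proof (rule power2_le_imp_le)
  interpret finite_measure "mu v" by (rule finite_mu)
  have "(norm (T v))\<^sup>2 \<le> (\<integral>w. c\<^sup>2 \<partial>mu v)"
    unfolding calc_norm[OF assms(1)]
  proof (rule integral_mono_AE)
    show "AE w in mu v. (cmod (f w))\<^sup>2 \<le> c\<^sup>2"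
      using assms(3) by eventually_elim (simp add: power_mono)
    show "integrable (mu v) (\<lambda>w. (cmod (f w))\<^sup>2)" by (rule calc_integrable_norm2[OF assms(1)])
  qed simp
  also have "\<dots> = (norm (Q (space M) v))\<^sup>2 * c\<^sup>2" by (simp add: measure_mu)
  also have "\<dots> \<le> (norm v)\<^sup>2 * c\<^sup>2" by (intro mult_right_mono power_mono norm_Q_le) auto
  finally show "(norm (T v))\<^sup>2 \<le> (c * norm v)\<^sup>2" by (simp add: power_mult_distrib mult.commute)
qed (use assms(2) in simp)

lemma calc_unique:
  assumes "calc f S" "calc f T"
  shows "S = T"
proof (rule blinfun_eqI)
  fix v
  have "(norm ((S - T) v))\<^sup>2 = 0" using calc_norm[OF calc_diff[OF assms], of v] by simp
  then show "S v = T v" by (simp add: blinfun.diff_left)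
qed

text \<open>By the isometry, strong convergence at v is L^2 convergence for the finite measure
  \<open>mu v\<close>, hence a case of bounded convergence.\<close>

lemma calc_tendsto:
  fixes S :: "nat \<Rightarrow> 'a \<Rightarrow>\<^sub>L 'a" and T :: "'a \<Rightarrow>\<^sub>L 'a"
  assumes "\<And>n. calc (s n) (S n)" "calc f T"
    and "\<And>n w. w \<in> space M \<Longrightarrow> cmod (s n w) \<le> C"
    and "\<And>w. w \<in> space M \<Longrightarrow> (\<lambda>n. s n w) \<longlonglongrightarrow> f w"
  shows "(\<lambda>n. S n v) \<longlonglongrightarrow> T v"
proof -
  interpret finite_measure "mu v" by (rule finite_mu)
  have [measurable]: "s n \<in> borel_measurable M" for n using calc_measurable[OF assms(1)] .
  have [measurable]: "f \<in> borel_measurable M" by (rule calc_measurable[OF assms(2)])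
  obtain D where D: "\<forall>w\<in>space M. cmod (f w) \<le> D" using calc_bounded[OF assms(2)] by blast
  have "(\<lambda>n. \<integral>w. (cmod (s n w - f w))\<^sup>2 \<partial>mu v) \<longlonglongrightarrow> (\<integral>w. 0 \<partial>mu v)"
  proof (rule bounded_convergence[where C = "(C + D)\<^sup>2"])
    show "norm ((cmod (s n w - f w))\<^sup>2) \<le> (C + D)\<^sup>2" if "w \<in> space (mu v)" for n w
    proof -
      have "cmod (s n w - f w) \<le> C + D"
        using norm_triangle_ineq4[of "s n w" "f w"] assms(3)[of w n] D that by fastforce
      then show ?thesis by (simp add: power_mono)
    qed
    show "(\<lambda>n. (cmod (s n w - f w))\<^sup>2) \<longlonglongrightarrow> 0" if "w \<in> space (mu v)" for w
    proof -
      have "(\<lambda>n. (cmod (s n w - f w))\<^sup>2) \<longlonglongrightarrow> (cmod (f w - f w))\<^sup>2"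
        using that by (intro tendsto_intros assms(4)) simp
      then show ?thesis by simp
    qed
  qed measurable
  then have "(\<lambda>n. (norm ((S n - T) v))\<^sup>2) \<longlonglongrightarrow> 0"
    using calc_norm[OF calc_diff[OF assms(1,2)], of _ v] by simp
  then have "(\<lambda>n. sqrt ((norm ((S n - T) v))\<^sup>2)) \<longlonglongrightarrow> sqrt 0" by (rule tendsto_real_sqrt)
  then have "(\<lambda>n. norm (S n v - T v)) \<longlonglongrightarrow> 0" by (simp add: blinfun.diff_left)
  then show ?thesis using LIM_zero_iff tendsto_norm_zero_iff by blast
qed

section \<open>Existence of the calculus on bounded functions, and adjoints\<close>

lemma calc_simple:
  assumes "simple_function M s"
  shows "\<exists>T. calc s T"
proof -
  have fin: "finite (s ` space M)" and me: "s -` {y} \<inter> space M \<in> sets M" for y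
    using assms simple_functionD by auto
  have "calc (\<lambda>w. \<Sum>y\<in>s ` space M. y * indicator (s -` {y} \<inter> space M) w)
      (\<Sum>y\<in>s ` space M. y *\<^sub>C Q (s -` {y} \<inter> space M))"
    by (intro calc_sum fin calc_indicator me)
  then have "calc s (\<Sum>y\<in>s ` space M. y *\<^sub>C Q (s -` {y} \<inter> space M))"
  proof (rule calc_cong)
    fix w assume w: "w \<in> space M"
    have "(\<Sum>y\<in>s ` space M. y * indicator (s -` {y} \<inter> space M) w) = (\<Sum>y\<in>s ` space M. if s w = y then y else 0)"
      using w by (intro sum.cong) (auto simp: indicator_def)
    then show "(\<Sum>y\<in>s ` space M. y * indicator (s -` {y} \<inter> space M) w) = s w" using fin w by simp
  qed
  then show ?thesis by blast
qed

text \<open>Simple approximations of f converge in L^2 of every \<open>mu v\<close>, so the isometry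
  makes their operators Cauchy at each vector; the uniform bound then yields a bounded
  limit.\<close>

lemma calc_exists:
  assumes [measurable]: "f \<in> borel_measurable M" and bound: "\<And>w. w \<in> space M \<Longrightarrow> cmod (f w) \<le> C"
  shows "\<exists>T. calc f T"
proof (cases "space M = {}")
  case True
  then show ?thesis using calc_cong[OF calc_one, of f] by auto
next
  case False
  \<comment> \<open>On an empty space the bound would not restrict C, hence the separate
    case.\<close>
  have "C \<ge> 0" using False bound norm_ge_zero order_trans by blast
  obtain s where s: "\<forall>i. simple_function M (s i)" "\<forall>x\<in>space M. (\<lambda>i. s i x) \<longlonglongrightarrow> f x"
    "\<forall>i. \<forall>x\<in>space M. dist (s i x) 0 \<le> 2 * dist (f x) 0"
    using borel_measurable_implies_sequence_metric[OF assms(1), of 0] by blast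
  \<comment> \<open>The approximants satisfy |s i| \<le> 2 |f|. This is the source of the bounds 3 C
    for a difference with f and 4 C for a difference of two approximants.\<close>
  have sb: "cmod (s i w) \<le> 2 * C" if "w \<in> space M" for i w
  proof -
    have "cmod (s i w) \<le> 2 * cmod (f w)" using s(3) that by simp
    then show ?thesis using bound[OF that] by linarith
  qed
  have "\<exists>S. \<forall>n. calc (s n) (S n)"
    by (intro choice allI calc_simple s(1)[rule_format])
  then obtain S where S: "\<And>n. calc (s n) (S n)" by blast
  have [measurable]: "s n \<in> borel_measurable M" for n using calc_measurable[OF S] .
  have Cauchy: "Cauchy (\<lambda>n. S n v)" for v
  proof -
    interpret finite_measure "mu v" by (rule finite_mu)
    let ?d = "\<lambda>n. \<integral>w. (cmod (s n w - f w))\<^sup>2 \<partial>mu v"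
    have db: "(cmod (s n w - f w))\<^sup>2 \<le> (3 * C)\<^sup>2" if "w \<in> space M" for n w
      using norm_triangle_ineq4[of "s n w" "f w"] sb[OF that, of n] bound[OF that]
      by (intro power_mono) auto
    have "?d \<longlonglongrightarrow> (\<integral>w. 0 \<partial>mu v)"
    proof (rule bounded_convergence[where C = "(3 * C)\<^sup>2"])
      show "norm ((cmod (s n w - f w))\<^sup>2) \<le> (3 * C)\<^sup>2" if "w \<in> space (mu v)" for n w
        using db that by simp
      show "(\<lambda>n. (cmod (s n w - f w))\<^sup>2) \<longlonglongrightarrow> 0" if "w \<in> space (mu v)" for w
      proof -
        have "(\<lambda>n. (cmod (s n w - f w))\<^sup>2) \<longlonglongrightarrow> (cmod (f w - f w))\<^sup>2"
          using that s(2) by (intro tendsto_intros) simp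
        then show ?thesis by simp
      qed
    qed measurable
    then have d: "?d \<longlonglongrightarrow> 0" by simp
    have int: "integrable (mu v) (\<lambda>w. (cmod (s n w - f w))\<^sup>2)" for n
      using db by (intro integrable_const_bound[of _ "(3 * C)\<^sup>2"]) (auto intro: AE_I2)
    have le: "(norm (S n v - S m v))\<^sup>2 \<le> 2 * ?d n + 2 * ?d m" for n m
    proof -
      have "(norm (S n v - S m v))\<^sup>2 = (\<integral>w. (cmod (s n w - s m w))\<^sup>2 \<partial>mu v)"
        using calc_norm[OF calc_diff[OF S S], of n m v] by (simp add: blinfun.diff_left)
      also have "\<dots> \<le> (\<integral>w. 2 * (cmod (s n w - f w))\<^sup>2 + 2 * (cmod (s m w - f w))\<^sup>2 \<partial>mu v)"
      proof (rule integral_mono)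
        show "(cmod (s n w - s m w))\<^sup>2 \<le> 2 * (cmod (s n w - f w))\<^sup>2 + 2 * (cmod (s m w - f w))\<^sup>2" for w
        proof -
          have "(cmod (s n w - s m w))\<^sup>2 \<le> (cmod (s n w - f w) + cmod (s m w - f w))\<^sup>2"
            using norm_triangle_ineq4[of "s n w - f w" "s m w - f w"] by (intro power_mono) auto
          also have "\<dots> \<le> 2 * (cmod (s n w - f w))\<^sup>2 + 2 * (cmod (s m w - f w))\<^sup>2"
            using zero_le_power2[of "cmod (s n w - f w) - cmod (s m w - f w)"]
            by (simp add: power2_sum power2_diff)
          finally show ?thesis .
        qed
        have "(cmod (s n w - s m w))\<^sup>2 \<le> (4 * C)\<^sup>2" if "w \<in> space M" for w
          using norm_triangle_ineq4[of "s n w" "s m w"] sb[OF that, of n] sb[OF that, of m]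
          by (intro power_mono) auto
        then show "integrable (mu v) (\<lambda>w. (cmod (s n w - s m w))\<^sup>2)"
          by (intro integrable_const_bound[of _ "(4 * C)\<^sup>2"]) (auto intro: AE_I2)
      qed (use int in auto)
      also have "\<dots> = 2 * ?d n + 2 * ?d m" using int by simp
      finally show ?thesis .
    qed
    show ?thesis
    proof (rule metric_CauchyI)
      fix e :: real assume "e > 0"
      then have "e\<^sup>2 / 4 > 0" by simp
      then obtain N where N: "\<And>n. n \<ge> N \<Longrightarrow> norm (?d n - 0) < e\<^sup>2 / 4" using LIMSEQ_D[OF d] by blast
      have "dist (S n v) (S m v) < e" if "n \<ge> N" "m \<ge> N" for n m
      proof -
        have "?d n < e\<^sup>2 / 4" "?d m < e\<^sup>2 / 4" using N[OF that(1)] N[OF that(2)] by auto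
        then have "(norm (S n v - S m v))\<^sup>2 < e\<^sup>2" using le[of n m] by linarith
        then show ?thesis using \<open>e > 0\<close> by (simp add: dist_norm power_less_imp_less_base)
      qed
      then show "\<exists>N. \<forall>n\<ge>N. \<forall>m\<ge>N. dist (S n v) (S m v) < e" by blast
    qed
  qed
  have "norm (S n v) \<le> (2 * C) * norm v" for n v
    using \<open>C \<ge> 0\<close> by (intro calc_norm_le[OF S] AE_I2 sb) auto
  then obtain T where "\<And>v. (\<lambda>n. S n v) \<longlonglongrightarrow> blinfun_apply T v"
    using blinfun_pointwise_limit[OF Cauchy] by blast
  then have "calc f T" using S sb s(2) by (intro calc_lim[of s S "2 * C" f T]) auto
  then show ?thesis by blast
qed

lemma calc_cnj:
  assumes "calc f T"
  shows "calc (\<lambda>w. cnj (f w)) (cadj T)"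
proof -
  obtain C where "\<forall>w\<in>space M. cmod (f w) \<le> C" using calc_bounded[OF assms] by blast
  moreover have [measurable]: "f \<in> borel_measurable M" by (rule calc_measurable[OF assms])
  ultimately have "\<exists>U. calc (\<lambda>w. cnj (f w)) U"
    by (intro calc_exists[of "\<lambda>w. cnj (f w)" C]) simp_all
  then obtain U where U: "calc (\<lambda>w. cnj (f w)) U" ..
  have T: "clin T" using calc_bops[OF assms] by (rule clin_bops)
  have "U = cadj T"
  proof (rule clin_eqI)
    show "clin U" using calc_bops[OF U] by (rule clin_bops)
    show "clin (cadj T)" by (rule clin_cadj[OF T])
    fix x
    have "cinner (U x) x = cnj (cinner (T x) x)" by (simp add: calc_quadratic[OF U] calc_quadratic[OF assms])
    also have "\<dots> = cinner (cadj T x) x"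
      by (simp only: cinner_cadj_left[OF T] cinner_commute[of x "T x"])
    finally show "cinner (U x) x = cinner (cadj T x) x" .
  qed
  with U show ?thesis by simp
qed

end

section \<open>Integrals with respect to complex measures\<close>

text \<open>Differences of measures are avoided: with the subtracted measures moved to the other
  side, both sides are sums in [0, \<infinity>], where induction over nonnegative measurable
  functions applies.\<close>

lemma nn_integral_sum_unique:
  assumes sets: "sets \<mu>0 = sets M" "sets \<mu>1 = sets M" "sets \<nu>0 = sets M" "sets \<nu>1 = sets M"
    and eq: "\<And>G. G \<in> sets M \<Longrightarrow> emeasure \<mu>0 G + emeasure \<mu>1 G = emeasure \<nu>0 G + emeasure \<nu>1 G"
    and g: "g \<in> borel_measurable M"
  shows "(\<integral>\<^sup>+w. g w \<partial>\<mu>0) + (\<integral>\<^sup>+w. g w \<partial>\<mu>1) = (\<integral>\<^sup>+w. g w \<partial>\<nu>0) + (\<integral>\<^sup>+w. g w \<partial>\<nu>1)"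
  using g
proof (induction rule: borel_measurable_induct)
  note sets [measurable_cong, simp]
  note spaces = sets_eq_imp_space_eq[OF sets(1)] sets_eq_imp_space_eq[OF sets(2)]
    sets_eq_imp_space_eq[OF sets(3)] sets_eq_imp_space_eq[OF sets(4)]
  {
    case (cong f g)
    have "(\<integral>\<^sup>+w. f w \<partial>\<mu>0) = (\<integral>\<^sup>+w. g w \<partial>\<mu>0)" "(\<integral>\<^sup>+w. f w \<partial>\<mu>1) = (\<integral>\<^sup>+w. g w \<partial>\<mu>1)"
      "(\<integral>\<^sup>+w. f w \<partial>\<nu>0) = (\<integral>\<^sup>+w. g w \<partial>\<nu>0)" "(\<integral>\<^sup>+w. f w \<partial>\<nu>1) = (\<integral>\<^sup>+w. g w \<partial>\<nu>1)"
      by (intro nn_integral_cong; simp add: spaces cong(3))+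
    then show ?case using cong.IH by simp
  next
    case (set A)
    then show ?case by (simp add: eq)
  next
    case (mult u c)
    note [measurable] = mult(2)
    show ?case using mult.IH by (simp add: nn_integral_cmult flip: distrib_left)
  next
    case (add u v)
    have split: "(\<integral>\<^sup>+w. v w + u w \<partial>\<mu>) = (\<integral>\<^sup>+w. v w \<partial>\<mu>) + (\<integral>\<^sup>+w. u w \<partial>\<mu>)" if [measurable_cong]: "sets \<mu> = sets M" for \<mu>
    proof -
      note [measurable] = add.hyps(1,3)
      show ?thesis by (rule nn_integral_add) measurable
    qed
    have swap: "a + b + (c + d) = (a + c) + (b + d)" for a b c d :: ennreal
      by (simp add: ac_simps)
    show ?case unfolding sets[THEN split]
      by (rule trans[OF swap], rule trans[OF _ swap]) (simp only: add.IH)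
  next
    case (seq U)
    note [measurable] = seq(1)
    have inc: "incseq (\<lambda>i. \<integral>\<^sup>+w. U i w \<partial>\<mu>)" for \<mu>
      using \<open>incseq U\<close> by (auto simp: incseq_def le_fun_def intro!: nn_integral_mono)
    have lim: "(\<lambda>i. \<integral>\<^sup>+w. U i w \<partial>\<mu>) \<longlonglongrightarrow> (\<integral>\<^sup>+w. (SUP i. U i) w \<partial>\<mu>)" if [measurable_cong]: "sets \<mu> = sets M" for \<mu>
    proof -
      have "(\<integral>\<^sup>+w. (SUP i. U i) w \<partial>\<mu>) = (SUP i. \<integral>\<^sup>+w. U i w \<partial>\<mu>)"
        unfolding SUP_apply using \<open>incseq U\<close> by (intro nn_integral_monotone_convergence_SUP) auto
      then show ?thesis using LIMSEQ_SUP[OF inc] by simp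
    qed
    have "(\<lambda>i. (\<integral>\<^sup>+w. U i w \<partial>\<mu>0) + (\<integral>\<^sup>+w. U i w \<partial>\<mu>1)) \<longlonglongrightarrow>
        (\<integral>\<^sup>+w. (SUP i. U i) w \<partial>\<mu>0) + (\<integral>\<^sup>+w. (SUP i. U i) w \<partial>\<mu>1)"
      by (intro tendsto_add lim sets)
    moreover have "(\<lambda>i. (\<integral>\<^sup>+w. U i w \<partial>\<nu>0) + (\<integral>\<^sup>+w. U i w \<partial>\<nu>1)) \<longlonglongrightarrow>
        (\<integral>\<^sup>+w. (SUP i. U i) w \<partial>\<nu>0) + (\<integral>\<^sup>+w. (SUP i. U i) w \<partial>\<nu>1)"
      by (intro tendsto_add lim sets)
    ultimately show ?case unfolding seq.IH by (rule LIMSEQ_unique)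
  }
qed

lemma integral_sum_unique_real:
  fixes f :: "'w \<Rightarrow> real"
  assumes "finite_measure \<mu>0" "finite_measure \<mu>1" "finite_measure \<nu>0" "finite_measure \<nu>1"
    and sets: "sets \<mu>0 = sets M" "sets \<mu>1 = sets M" "sets \<nu>0 = sets M" "sets \<nu>1 = sets M"
    and eq: "\<And>G. G \<in> sets M \<Longrightarrow> measure \<mu>0 G + measure \<mu>1 G = measure \<nu>0 G + measure \<nu>1 G"
    and f: "integrable \<mu>0 f" "integrable \<mu>1 f" "integrable \<nu>0 f" "integrable \<nu>1 f"
  shows "(\<integral>w. f w \<partial>\<mu>0) + (\<integral>w. f w \<partial>\<mu>1) = (\<integral>w. f w \<partial>\<nu>0) + (\<integral>w. f w \<partial>\<nu>1)"
proof -
  have em: "emeasure \<mu>0 G + emeasure \<mu>1 G = emeasure \<nu>0 G + emeasure \<nu>1 G" if "G \<in> sets M" for G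
    using eq[OF that] assms(1-4)
    by (simp add: finite_measure.emeasure_eq_measure flip: ennreal_plus)
  have [measurable]: "f \<in> borel_measurable M"
    using borel_measurable_integrable[OF f(1)] measurable_cong_sets[OF sets(1) refl] by blast
  note fin = f[unfolded real_integrable_def]
  note nn = nn_integral_sum_unique[OF sets em, THEN arg_cong, of _ enn2real]
  have add: "enn2real (a + b) = enn2real a + enn2real b" if "a \<noteq> \<infinity>" "b \<noteq> \<infinity>" for a b
    using that by (simp add: enn2real_plus less_top)
  have "enn2real (\<integral>\<^sup>+w. ennreal (g w) \<partial>\<mu>0) + enn2real (\<integral>\<^sup>+w. ennreal (g w) \<partial>\<mu>1)
      = enn2real (\<integral>\<^sup>+w. ennreal (g w) \<partial>\<nu>0) + enn2real (\<integral>\<^sup>+w. ennreal (g w) \<partial>\<nu>1)"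
    if "g = f \<or> g = (\<lambda>w. - f w)" for g
  proof -
    have [measurable]: "g \<in> borel_measurable M" using that by auto
    show ?thesis using nn[of "\<lambda>w. ennreal (g w)"] that fin by (auto simp: add)
  qed
  from this[of f] this[of "\<lambda>w. - f w"] show ?thesis
    by (simp add: real_lebesgue_integral_def f)
qed

lemma integral_sum_unique:
  fixes f :: "'w \<Rightarrow> complex"
  assumes "finite_measure \<mu>0" "finite_measure \<mu>1" "finite_measure \<nu>0" "finite_measure \<nu>1"
    and sets: "sets \<mu>0 = sets M" "sets \<mu>1 = sets M" "sets \<nu>0 = sets M" "sets \<nu>1 = sets M"
    and eq: "\<And>G. G \<in> sets M \<Longrightarrow> measure \<mu>0 G + measure \<mu>1 G = measure \<nu>0 G + measure \<nu>1 G"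
    and f: "integrable \<mu>0 f" "integrable \<mu>1 f" "integrable \<nu>0 f" "integrable \<nu>1 f"
  shows "(\<integral>w. f w \<partial>\<mu>0) + (\<integral>w. f w \<partial>\<mu>1) = (\<integral>w. f w \<partial>\<nu>0) + (\<integral>w. f w \<partial>\<nu>1)"
proof -
  note Re = integral_sum_unique_real[OF assms(1-4) sets eq f[THEN integrable_Re]]
  note Im = integral_sum_unique_real[OF assms(1-4) sets eq f[THEN integrable_Im]]
  show ?thesis using Re Im by (intro complex_eqI) (simp_all add: f)
qed

text \<open>Real and imaginary parts of the two decompositions give two equalities between
  differences of finite measures; rearranged as sums, they are instances of
  \<open>integral_sum_unique\<close>.\<close>

lemma has_cmeasure_integral_unique:
  assumes "has_cmeasure_integral M \<nu> f I" "has_cmeasure_integral M \<nu> f J"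
  shows "I = J"
proof -
  obtain \<mu> :: "nat \<Rightarrow> 'a measure" where
    \<mu>: "\<forall>n<4. finite_measure (\<mu> n) \<and> sets (\<mu> n) = sets M \<and> integrable (\<mu> n) f"
      "\<forall>G\<in>sets M. \<nu> G = (\<Sum>n<4. \<i> ^ n * complex_of_real (measure (\<mu> n) G))"
      "I = (\<Sum>n<4. \<i> ^ n * (\<integral>w. f w \<partial>\<mu> n))"
    using assms(1) unfolding has_cmeasure_integral_def by blast
  obtain \<kappa> :: "nat \<Rightarrow> 'a measure" where
    \<kappa>: "\<forall>n<4. finite_measure (\<kappa> n) \<and> sets (\<kappa> n) = sets M \<and> integrable (\<kappa> n) f"
      "\<forall>G\<in>sets M. \<nu> G = (\<Sum>n<4. \<i> ^ n * complex_of_real (measure (\<kappa> n) G))"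
      "J = (\<Sum>n<4. \<i> ^ n * (\<integral>w. f w \<partial>\<kappa> n))"
    using assms(2) unfolding has_cmeasure_integral_def by blast
  have expand: "(\<Sum>n<4. \<i> ^ n * z n) = (z 0 - z 2) + \<i> * (z 1 - z 3)" for z :: "nat \<Rightarrow> complex"
    by (simp add: numeral_eq_Suc algebra_simps)
  have m: "measure (\<mu> 0) G - measure (\<mu> 2) G = measure (\<kappa> 0) G - measure (\<kappa> 2) G"
    "measure (\<mu> 1) G - measure (\<mu> 3) G = measure (\<kappa> 1) G - measure (\<kappa> 3) G" if "G \<in> sets M" for G
  proof -
    have *: "complex_of_real (measure (\<mu> 0) G) - complex_of_real (measure (\<mu> 2) G) +
        \<i> * (complex_of_real (measure (\<mu> 1) G) - complex_of_real (measure (\<mu> 3) G)) =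
        complex_of_real (measure (\<kappa> 0) G) - complex_of_real (measure (\<kappa> 2) G) +
        \<i> * (complex_of_real (measure (\<kappa> 1) G) - complex_of_real (measure (\<kappa> 3) G))"
      using \<mu>(2)[rule_format, OF that] \<kappa>(2)[rule_format, OF that] unfolding expand by simp
    from arg_cong[OF *, of Re] show "measure (\<mu> 0) G - measure (\<mu> 2) G = measure (\<kappa> 0) G - measure (\<kappa> 2) G"
      by simp
    from arg_cong[OF *, of Im] show "measure (\<mu> 1) G - measure (\<mu> 3) G = measure (\<kappa> 1) G - measure (\<kappa> 3) G"
      by simp
  qed
  have *: "(\<integral>w. f w \<partial>\<mu> i) + (\<integral>w. f w \<partial>\<kappa> j) = (\<integral>w. f w \<partial>\<kappa> i) + (\<integral>w. f w \<partial>\<mu> j)"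
    if ij: "i < 4" "j < 4"
      "\<And>G. G \<in> sets M \<Longrightarrow> measure (\<mu> i) G - measure (\<mu> j) G = measure (\<kappa> i) G - measure (\<kappa> j) G" for i j
  proof (rule integral_sum_unique[where M = M])
    show "measure (\<mu> i) G + measure (\<kappa> j) G = measure (\<kappa> i) G + measure (\<mu> j) G" if "G \<in> sets M" for G
      using ij(3)[OF that] by linarith
  qed (use \<mu>(1) \<kappa>(1) ij(1,2) in auto)
  have "(\<integral>w. f w \<partial>\<mu> 0) + (\<integral>w. f w \<partial>\<kappa> 2) = (\<integral>w. f w \<partial>\<kappa> 0) + (\<integral>w. f w \<partial>\<mu> 2)"
    "(\<integral>w. f w \<partial>\<mu> 1) + (\<integral>w. f w \<partial>\<kappa> 3) = (\<integral>w. f w \<partial>\<kappa> 1) + (\<integral>w. f w \<partial>\<mu> 3)"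
    using m by (intro *; simp)+
  then have "(\<integral>w. f w \<partial>\<mu> 0) - (\<integral>w. f w \<partial>\<mu> 2) = (\<integral>w. f w \<partial>\<kappa> 0) - (\<integral>w. f w \<partial>\<kappa> 2)"
    "(\<integral>w. f w \<partial>\<mu> 1) - (\<integral>w. f w \<partial>\<mu> 3) = (\<integral>w. f w \<partial>\<kappa> 1) - (\<integral>w. f w \<partial>\<kappa> 3)"
    by (simp_all add: algebra_simps)
  then show ?thesis unfolding \<mu>(3) \<kappa>(3) expand by simp
qed

context pvm_space
begin

text \<open>Polarization writes the complex measure as a combination of four spectral measures. The
  coefficients are required to be the bare powers of i, so the factor 1/4 is absorbed by halving the
  vectors. The function f need only agree almost everywhere with a function g in the
  calculus.\<close>

lemma calc_has_cmeasure_integral: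
  assumes "calc g T" "f \<in> borel_measurable M" "\<And>v. AE w in mu v. f w = g w"
  shows "has_cmeasure_integral M (\<lambda>G. cinner (Q G h) k) f (cinner (T h) k)"
  unfolding has_cmeasure_integral_def
proof (intro exI[of _ "\<lambda>n. mu ((1/2) *\<^sub>R (h + \<i> ^ n *\<^sub>C k))"] conjI allI impI ballI)
  let ?v = "\<lambda>n. h + \<i> ^ n *\<^sub>C k"
  have fm: "f \<in> borel_measurable (mu v)" and gm: "g \<in> borel_measurable (mu v)" for v
    using assms(2) calc_measurable[OF assms(1)] by simp_all
  have half: "cinner (S ((1/2) *\<^sub>R v)) ((1/2) *\<^sub>R v) = cinner (S v) v / 4" for S :: "'a \<Rightarrow>\<^sub>L 'a" and v
    by (simp add: blinfun.scaleR_right cinner.scaleR_left cinner.scaleR_right scaleR_conv_of_real)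
  have polar: "cinner (S h) k = (\<Sum>n<4. \<i> ^ n * cinner (S ((1/2) *\<^sub>R ?v n)) ((1/2) *\<^sub>R ?v n))"
    if "clin S" for S :: "'a \<Rightarrow>\<^sub>L 'a"
  proof -
    have "cinner (S h) k = (\<Sum>n<4. \<i> ^ n * cinner (S (?v n)) (?v n)) / 4"
      using arg_cong[OF polarization[OF that, of h k], of "\<lambda>z. z / 4"] by simp
    then show ?thesis by (simp only: half sum_divide_distrib times_divide_eq_right)
  qed
  fix n :: nat
  show "finite_measure (mu ((1/2) *\<^sub>R ?v n))" by (rule finite_mu)
  show "sets (mu ((1/2) *\<^sub>R ?v n)) = sets M" by simp
  show "integrable (mu ((1/2) *\<^sub>R ?v n)) f"
    using calc_integrable[OF assms(1)] integrable_cong_AE[OF fm gm assms(3)] by blast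
  show "cinner (Q G h) k = (\<Sum>n<4. \<i> ^ n * complex_of_real (measure (mu ((1/2) *\<^sub>R ?v n)) G))"
    if "G \<in> sets M" for G
    using polar[OF clin_Q[OF that]] by (simp only: cinner_Q[OF that] measure_mu[OF that])
  have "(\<integral>w. f w \<partial>mu v) = cinner (T v) v" for v
    unfolding calc_quadratic[OF assms(1)] by (rule integral_cong_AE[OF fm gm assms(3)])
  then show "cinner (T h) k = (\<Sum>n<4. \<i> ^ n * (\<integral>w. f w \<partial>mu ((1/2) *\<^sub>R ?v n)))"
    using polar[OF clin_bops[OF calc_bops[OF assms(1)]]] by (simp only:)
qed

lemma pvm_integral_eq:
  assumes "calc g T" "f \<in> borel_measurable M" "\<And>v. AE w in mu v. f w = g w"
  shows "pvm_integral M K Q f = T"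
  unfolding pvm_integral_def
proof (rule the_equality)
  note int = calc_has_cmeasure_integral[OF assms]
  show "T \<in> bops K K \<and> (\<forall>h\<in>K. \<forall>k\<in>K. has_cmeasure_integral M (\<lambda>G. cinner (Q G h) k) f (cinner (T h) k))"
    using int calc_bops[OF assms(1)] by blast
  fix U :: "'a \<Rightarrow>\<^sub>L 'a"
  assume U: "U \<in> bops K K \<and> (\<forall>h\<in>K. \<forall>k\<in>K. has_cmeasure_integral M (\<lambda>G. cinner (Q G h) k) f (cinner (U h) k))"
  show "U = T"
  proof (rule bops_eqI[OF K K])
    show "cinner (U h) k = cinner (T h) k" if "h \<in> K" "k \<in> K" for h k
      using U that by (intro has_cmeasure_integral_unique[OF _ int]) blast
  qed (use U calc_bops[OF assms(1)] in blast)+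
qed

text \<open>The calculus accepts only functions bounded at every point; cutting the values above c
  to 0 supplies such a representative of an essentially bounded function.\<close>

definition trunc :: "real \<Rightarrow> ('w \<Rightarrow> complex) \<Rightarrow> 'w \<Rightarrow> complex" where
  "trunc c f w = (if cmod (f w) \<le> c then f w else 0)"

lemma trunc_le: "c \<ge> 0 \<Longrightarrow> cmod (trunc c f w) \<le> c"
  by (simp add: trunc_def)

lemma pvm_integral_trunc:
  assumes [measurable]: "f \<in> borel_measurable M" and c: "c \<ge> 0"
    and 0: "Q {w \<in> space M. c < cmod (f w)} = 0"
  shows "calc (trunc c f) (pvm_integral M K Q f)"
proof -
  have "\<exists>T. calc (trunc c f) T"
  proof (rule calc_exists)
    show "trunc c f \<in> borel_measurable M" unfolding trunc_def[abs_def] by measurable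
  qed (rule trunc_le[OF c])
  then obtain T where T: "calc (trunc c f) T" ..
  have "pvm_integral M K Q f = T"
  proof (rule pvm_integral_eq[OF T assms(1)])
    fix v
    have "{w \<in> space M. c < cmod (f w)} \<in> null_sets (mu v)"
      using 0 by (intro null_setsI) (simp_all add: emeasure_mu)
    then show "AE w in mu v. f w = trunc c f w"
      by (rule AE_I') (auto simp: trunc_def)
  qed
  with T show ?thesis by simp
qed

lemma norm_pvm_integral_le:
  assumes "f \<in> Linfty M Q"
  shows "norm (pvm_integral M K Q f) \<le> Linfty_norm M Q f"
  unfolding Linfty_norm_def
proof (rule cInf_greatest)
  show "{c. 0 \<le> c \<and> Q {w \<in> space M. c < cmod (f w)} = 0} \<noteq> {}"
    using assms by (auto simp: Linfty_def)
  fix c assume "c \<in> {c. 0 \<le> c \<and> Q {w \<in> space M. c < cmod (f w)} = 0}"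
  then have c: "c \<ge> 0" "Q {w \<in> space M. c < cmod (f w)} = 0" by auto
  have "f \<in> borel_measurable M" using assms by (simp add: Linfty_def)
  then have T: "calc (trunc c f) (pvm_integral M K Q f)" using c by (rule pvm_integral_trunc)
  show "norm (pvm_integral M K Q f) \<le> c"
    by (intro norm_blinfun_bound calc_norm_le[OF T] AE_I2 trunc_le c)
qed

lemma pvm_integral_bops:
  assumes "f \<in> Linfty M Q"
  shows "pvm_integral M K Q f \<in> bops K K"
proof -
  obtain c where "c \<ge> 0" "Q {w \<in> space M. c < cmod (f w)} = 0" "f \<in> borel_measurable M"
    using assms by (auto simp: Linfty_def)
  then show ?thesis using pvm_integral_trunc calc_bops by blast
qed

end

section \<open>Strongly measurable functions\<close>

text \<open>
  The space may be nonseparable, so Borel measurability does not suffice: strongly measurable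
  functions are generated by the simple functions under pointwise limits.
\<close>

inductive strong_measurable :: "'s measure \<Rightarrow> ('s \<Rightarrow> 'a::real_normed_vector) \<Rightarrow> bool" for \<rho> where
  strong_simple: "simple_function \<rho> s \<Longrightarrow> strong_measurable \<rho> s"
| strong_lim: "(\<And>n. strong_measurable \<rho> (s n)) \<Longrightarrow>
    (\<And>\<sigma>. \<sigma> \<in> space \<rho> \<Longrightarrow> (\<lambda>n. s n \<sigma>) \<longlonglongrightarrow> f \<sigma>) \<Longrightarrow> strong_measurable \<rho> f"

lemma strong_cong:
  "strong_measurable \<rho> f \<Longrightarrow> (\<And>\<sigma>. \<sigma> \<in> space \<rho> \<Longrightarrow> f \<sigma> = g \<sigma>) \<Longrightarrow> strong_measurable \<rho> g"
  by (rule strong_lim[of \<rho> "\<lambda>_. f"]) auto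

lemma strong_const: "strong_measurable \<rho> (\<lambda>\<sigma>. v)"
  by (intro strong_simple simple_function_const)

lemma strong_compose:
  fixes h :: "'a::real_normed_vector \<Rightarrow> 'b::real_normed_vector"
  assumes "strong_measurable \<rho> f" "continuous_on UNIV h"
  shows "strong_measurable \<rho> (\<lambda>\<sigma>. h (f \<sigma>))"
  using assms(1)
proof (induction rule: strong_measurable.induct)
  case (strong_simple s)
  then show ?case by (rule strong_measurable.strong_simple[OF simple_function_compose1])
next
  case (strong_lim s f)
  show ?case
    by (rule strong_measurable.strong_lim[of \<rho> "\<lambda>n \<sigma>. h (s n \<sigma>)", OF strong_lim.IH])
      (rule continuous_on_tendsto_compose[OF assms(2) strong_lim(2)]; simp)
qed

lemma strong_compose2:
  fixes h :: "'a::real_normed_vector \<Rightarrow> 'b::real_normed_vector \<Rightarrow> 'c::real_normed_vector"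
  assumes f: "strong_measurable \<rho> f" and g: "strong_measurable \<rho> g"
    and h: "continuous_on UNIV (\<lambda>(x, y). h x y)"
  shows "strong_measurable \<rho> (\<lambda>\<sigma>. h (f \<sigma>) (g \<sigma>))"
proof -
  have lim: "(\<lambda>n. h (x n) (y n)) \<longlonglongrightarrow> h a b" if "x \<longlonglongrightarrow> a" "y \<longlonglongrightarrow> b" for x y a b
    using continuous_on_tendsto_compose[OF h tendsto_Pair[OF that]] by simp
  have 1: "strong_measurable \<rho> (\<lambda>\<sigma>. h (s \<sigma>) (g \<sigma>))" if s: "simple_function \<rho> s" for s
    using g
  proof (induction rule: strong_measurable.induct)
    case (strong_simple t)
    then show ?case by (rule strong_measurable.strong_simple[OF simple_function_compose2[OF s]])
  next
    case (strong_lim t g)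
    show ?case
      by (rule strong_measurable.strong_lim[of \<rho> "\<lambda>n \<sigma>. h (s \<sigma>) (t n \<sigma>)", OF strong_lim.IH])
        (intro lim tendsto_const strong_lim(2))
  qed
  show ?thesis
    using f
  proof (induction rule: strong_measurable.induct)
    case (strong_lim s f)
    show ?case
      by (rule strong_measurable.strong_lim[of \<rho> "\<lambda>n \<sigma>. h (s n \<sigma>) (g \<sigma>)", OF strong_lim.IH])
        (intro lim tendsto_const strong_lim(2))
  qed (rule 1)
qed

lemma strong_add:
  "strong_measurable \<rho> f \<Longrightarrow> strong_measurable \<rho> g \<Longrightarrow> strong_measurable \<rho> (\<lambda>\<sigma>. f \<sigma> + g \<sigma>)"
  by (rule strong_compose2) (auto simp: split_beta intro!: continuous_intros)

lemma strong_diff: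
  "strong_measurable \<rho> f \<Longrightarrow> strong_measurable \<rho> g \<Longrightarrow> strong_measurable \<rho> (\<lambda>\<sigma>. f \<sigma> - g \<sigma>)"
  by (rule strong_compose2) (auto simp: split_beta intro!: continuous_intros)

lemma strong_indicator_mult:
  assumes "strong_measurable \<rho> f" "S \<in> sets \<rho>"
  shows "strong_measurable \<rho> (\<lambda>\<sigma>. indicator S \<sigma> *\<^sub>R f \<sigma>)"
proof (rule strong_compose2[OF _ assms(1), of "indicat_real S" "\<lambda>x y. x *\<^sub>R y"])
  show "strong_measurable \<rho> (indicat_real S)"
    by (intro strong_simple simple_function_indicator assms(2))
qed (auto simp: split_beta intro!: continuous_intros)

lemma strong_sum:
  "(\<And>i. i \<in> I \<Longrightarrow> strong_measurable \<rho> (f i)) \<Longrightarrow> strong_measurable \<rho> (\<lambda>\<sigma>. \<Sum>i\<in>I. f i \<sigma>)"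
  by (induction I rule: infinite_finite_induct) (auto intro: strong_const strong_add)

text \<open>Induction on the argument u: if u is simple, the result is a finite sum of the given
  functions cut off by indicators, and continuity of each A \<sigma> handles limits. Products of
  operator valued functions are treated in this way.\<close>

lemma strong_apply:
  fixes A :: "'s \<Rightarrow> 'a::real_normed_vector \<Rightarrow>\<^sub>L 'b::real_normed_vector"
  assumes "strong_measurable \<rho> u" "\<And>v. strong_measurable \<rho> (\<lambda>\<sigma>. A \<sigma> v)"
  shows "strong_measurable \<rho> (\<lambda>\<sigma>. A \<sigma> (u \<sigma>))"
  using assms(1)
proof (induction rule: strong_measurable.induct)
  case (strong_simple s)
  have fin: "finite (s ` space \<rho>)" and me: "s -` {y} \<inter> space \<rho> \<in> sets \<rho>" for y
    using strong_simple simple_functionD by auto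
  have "strong_measurable \<rho> (\<lambda>\<sigma>. \<Sum>y\<in>s ` space \<rho>. indicator (s -` {y} \<inter> space \<rho>) \<sigma> *\<^sub>R A \<sigma> y)"
    by (intro strong_sum strong_indicator_mult assms(2) me)
  then show ?case
  proof (rule strong_cong)
    fix \<sigma> assume \<sigma>: "\<sigma> \<in> space \<rho>"
    have "(\<Sum>y\<in>s ` space \<rho>. indicator (s -` {y} \<inter> space \<rho>) \<sigma> *\<^sub>R A \<sigma> y) =
        (\<Sum>y\<in>s ` space \<rho>. if s \<sigma> = y then A \<sigma> y else 0)"
      using \<sigma> by (intro sum.cong) (auto simp: indicator_def)
    then show "(\<Sum>y\<in>s ` space \<rho>. indicator (s -` {y} \<inter> space \<rho>) \<sigma> *\<^sub>R A \<sigma> y) = A \<sigma> (s \<sigma>)"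
      using fin \<sigma> by simp
  qed
next
  case (strong_lim s f)
  show ?case
    by (rule strong_measurable.strong_lim[of \<rho> "\<lambda>n \<sigma>. A \<sigma> (s n \<sigma>)", OF strong_lim.IH])
      (intro blinfun.tendsto tendsto_const strong_lim(2))
qed

lemma strong_norm_measurable:
  assumes "strong_measurable \<rho> f"
  shows "(\<lambda>\<sigma>. norm (f \<sigma>)) \<in> borel_measurable \<rho>"
  using assms
proof (induction rule: strong_measurable.induct)
  case (strong_simple s)
  then show ?case by (rule borel_measurable_simple_function[OF simple_function_compose1])
next
  case (strong_lim s f)
  show ?case
    by (rule borel_measurable_LIMSEQ_metric[of "\<lambda>n \<sigma>. norm (s n \<sigma>)", OF strong_lim.IH])
      (intro tendsto_norm strong_lim(2))
qed

text \<open>The substitute for separability of the space: the range of one strongly measurable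
  function is always separable, which is what the greedy choice needs.\<close>

lemma strong_separable:
  assumes "strong_measurable \<rho> f"
  shows "\<exists>D. countable D \<and> (\<forall>\<sigma>\<in>space \<rho>. f \<sigma> \<in> closure D)"
  using assms
proof (induction rule: strong_measurable.induct)
  case (strong_simple s)
  have "finite (s ` space \<rho>)" using strong_simple simple_functionD by auto
  moreover have "s \<sigma> \<in> closure (s ` space \<rho>)" if "\<sigma> \<in> space \<rho>" for \<sigma>
    using subsetD[OF closure_subset, of "s \<sigma>" "s ` space \<rho>"] that by simp
  ultimately show ?case
    by (intro exI[of _ "s ` space \<rho>"]) (simp add: countable_finite)
next
  case (strong_lim s f)
  have "\<exists>D. \<forall>n. countable (D n) \<and> (\<forall>\<sigma>\<in>space \<rho>. s n \<sigma> \<in> closure (D n))"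
    by (intro choice allI strong_lim.IH)
  then obtain D where D: "\<forall>n. countable (D n) \<and> (\<forall>\<sigma>\<in>space \<rho>. s n \<sigma> \<in> closure (D n))" ..
  have "f \<sigma> \<in> closure (\<Union>n. D n)" if "\<sigma> \<in> space \<rho>" for \<sigma>
  proof (rule closed_sequentially[OF closed_closure _ strong_lim(2)[OF that]])
    show "s n \<sigma> \<in> closure (\<Union>n. D n)" for n
      by (rule subsetD[OF closure_mono[of "D n"]]) (use D that in auto)
  qed
  moreover have "countable (\<Union>n. D n)" using D by simp
  ultimately show ?case by (intro exI[of _ "\<Union>n. D n"]) simp
qed

lemma strong_greedy:
  assumes "strong_measurable \<rho> r"
  shows "\<exists>(i :: 's \<Rightarrow> nat) d. i \<in> measurable \<rho> (count_space UNIV) \<and>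
    strong_measurable \<rho> (\<lambda>\<sigma>. r \<sigma> - d (i \<sigma>)) \<and>
    (\<forall>\<sigma>\<in>space \<rho>. norm (r \<sigma> - d (i \<sigma>)) \<le> norm (r \<sigma>) / 4)"
proof -
  obtain D where D: "countable D" "\<And>\<sigma>. \<sigma> \<in> space \<rho> \<Longrightarrow> r \<sigma> \<in> closure D"
    using strong_separable[OF assms] by blast
  \<comment> \<open>Where r vanishes the allowed error is 0, which density of D cannot guarantee;
    adjoining 0 settles this and makes the set nonempty.\<close>
  define d where "d = from_nat_into (insert 0 D)"
  have d: "range d = insert 0 D" using D(1) by (simp add: d_def range_from_nat_into)
  define P where "P m \<sigma> \<longleftrightarrow> norm (r \<sigma> - d m) \<le> norm (r \<sigma>) / 4" for m \<sigma>
  define i where "i \<sigma> = (LEAST m. P m \<sigma>)" for \<sigma>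
  have ex: "\<exists>m. P m \<sigma>" if \<sigma>: "\<sigma> \<in> space \<rho>" for \<sigma>
  proof (cases "r \<sigma> = 0")
    case True
    have "0 \<in> range d" by (simp add: d)
    then obtain m where "d m = 0" by (metis imageE)
    then show ?thesis using True by (intro exI[of _ m]) (simp add: P_def)
  next
    case False
    then obtain y where y: "y \<in> D" "dist y (r \<sigma>) < norm (r \<sigma>) / 4"
      using D(2)[OF \<sigma>, unfolded closure_approachable, rule_format, of "norm (r \<sigma>) / 4"] by auto
    then have "y \<in> range d" by (simp add: d)
    then obtain m where "d m = y" by (metis imageE)
    then show ?thesis using y(2) by (intro exI[of _ m]) (simp add: P_def dist_norm norm_minus_commute)
  qed
  have Pi: "P (i \<sigma>) \<sigma>" if "\<sigma> \<in> space \<rho>" for \<sigma> unfolding i_def using ex[OF that] by (rule LeastI_ex)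
  have [measurable]: "(\<lambda>\<sigma>. norm (r \<sigma> - d m)) \<in> borel_measurable \<rho>" for m
    by (intro strong_norm_measurable strong_diff assms strong_const)
  have [measurable]: "(\<lambda>\<sigma>. norm (r \<sigma>)) \<in> borel_measurable \<rho>" by (rule strong_norm_measurable[OF assms])
  have [measurable]: "Measurable.pred \<rho> (P m)" for m unfolding P_def by measurable
  have i: "i \<in> measurable \<rho> (count_space UNIV)" unfolding i_def by measurable
  have me: "{\<sigma> \<in> space \<rho>. i \<sigma> = m} \<in> sets \<rho>" for m using i by measurable
  \<comment> \<open>A countably valued function is the limit of its truncations to the indices below
    n, which at \<sigma> are constant once n exceeds i \<sigma>.\<close>
  have "strong_measurable \<rho> (\<lambda>\<sigma>. d (i \<sigma>))"
  proof (rule strong_lim)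
    show "strong_measurable \<rho> (\<lambda>\<sigma>. \<Sum>m<n. indicator {\<sigma> \<in> space \<rho>. i \<sigma> = m} \<sigma> *\<^sub>R d m)" for n
      by (intro strong_sum strong_indicator_mult strong_const me)
    fix \<sigma> assume \<sigma>: "\<sigma> \<in> space \<rho>"
    show "(\<lambda>n. \<Sum>m<n. indicator {\<sigma> \<in> space \<rho>. i \<sigma> = m} \<sigma> *\<^sub>R d m) \<longlonglongrightarrow> d (i \<sigma>)"
    proof (rule tendsto_eventually)
      have "(\<Sum>m<n. indicator {\<sigma> \<in> space \<rho>. i \<sigma> = m} \<sigma> *\<^sub>R d m) = d (i \<sigma>)" if "n \<ge> Suc (i \<sigma>)" for n
      proof -
        have "(\<Sum>m<n. indicator {\<sigma> \<in> space \<rho>. i \<sigma> = m} \<sigma> *\<^sub>R d m) = (\<Sum>m<n. if i \<sigma> = m then d m else 0)"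
          using \<sigma> by (intro sum.cong) (auto simp: indicator_def)
        then show ?thesis using that by simp
      qed
      then show "\<forall>\<^sub>F n in sequentially. (\<Sum>m<n. indicator {\<sigma> \<in> space \<rho>. i \<sigma> = m} \<sigma> *\<^sub>R d m) = d (i \<sigma>)"
        unfolding eventually_sequentially by blast
    qed
  qed
  then have "strong_measurable \<rho> (\<lambda>\<sigma>. r \<sigma> - d (i \<sigma>))" by (intro strong_diff assms)
  then show ?thesis using i Pi unfolding P_def by blast
qed

section \<open>Absolutely convergent expansions of strongly measurable functions\<close>

lemma has_sum_delta: "((\<lambda>m. if i = m then f m else 0) has_sum f i) UNIV"
  for f :: "'i \<Rightarrow> 'a::{comm_monoid_add,topological_space}"
proof -
  have "((\<lambda>m. f m) has_sum f i) {i}" using has_sum_finite[of "{i}" f] by simp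
  then show ?thesis by (rule iffD1[OF has_sum_cong_neutral, rotated -1]) auto
qed

text \<open>A Fubini principle for unordered sums: a summable majorant allows the iterated sum to be
  read as a sum over pairs. The majorant's total is returned too, since later estimates use
  it.\<close>

lemma has_sum_Sigma_majorized:
  fixes f :: "'p \<times> 'm \<Rightarrow> 'a::banach" and M :: "'p \<times> 'm \<Rightarrow> real"
  assumes M: "\<And>p. ((\<lambda>m. M (p, m)) has_sum n p) UNIV" "n summable_on UNIV" "\<And>x. norm (f x) \<le> M x"
    and f: "\<And>p. ((\<lambda>m. f (p, m)) has_sum g p) UNIV" "(g has_sum S) UNIV"
  shows "(f has_sum S) UNIV" "(M has_sum infsum n UNIV) UNIV"
proof -
  have "0 \<le> M x" for x by (rule order_trans[OF norm_ge_zero M(3)])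
  then have MS: "M summable_on (UNIV \<times> UNIV)"
    by (intro summable_on_SigmaI[OF M(1,2)])
  have "(M has_sum infsum n UNIV) (UNIV \<times> UNIV)"
    by (rule has_sum_SigmaI[OF M(1) has_sum_infsum[OF M(2)] MS])
  then show "(M has_sum infsum n UNIV) UNIV" by simp
  have "(\<lambda>x. norm (f x)) summable_on (UNIV \<times> UNIV)"
    by (rule Infinite_Sum.abs_summable_on_comparison_test'[OF MS M(3)])
  then have "f summable_on (UNIV \<times> UNIV)" by (rule abs_summable_summable)
  then have "(f has_sum S) (UNIV \<times> UNIV)"
    by (rule has_sum_SigmaI[OF f])
  then show "(f has_sum S) UNIV" by simp
qed

text \<open>
  Applying the greedy approximation to the successive remainders expands \<open>u\<close> into countably
  valued functions whose norms decrease geometrically relative to the norm of \<open>u\<close>.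
\<close>

lemma strong_countably_valued_series:
  fixes u :: "'s \<Rightarrow> 'a::banach"
  assumes "strong_measurable \<rho> u"
  shows "\<exists>(i :: nat \<Rightarrow> 's \<Rightarrow> nat) d. (\<forall>p. i p \<in> measurable \<rho> (count_space UNIV)) \<and>
    (\<forall>\<sigma>\<in>space \<rho>. (\<lambda>p. d p (i p \<sigma>)) sums u \<sigma> \<and>
      (\<forall>p. norm (d p (i p \<sigma>)) \<le> 5 / 4 * norm (u \<sigma>) * (1 / 4) ^ p))"
proof -
  define good where "good r x \<longleftrightarrow> fst x \<in> measurable \<rho> (count_space UNIV) \<and>
    strong_measurable \<rho> (\<lambda>\<sigma>. r \<sigma> - snd x (fst x \<sigma>)) \<and>
    (\<forall>\<sigma>\<in>space \<rho>. norm (r \<sigma> - snd x (fst x \<sigma>)) \<le> norm (r \<sigma>) / 4)"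
    for r :: "'s \<Rightarrow> 'a" and x :: "('s \<Rightarrow> nat) \<times> (nat \<Rightarrow> 'a)"
  have "\<exists>x. strong_measurable \<rho> r \<longrightarrow> good r x" for r
  proof (cases "strong_measurable \<rho> r")
    case True
    then obtain i :: "'s \<Rightarrow> nat" and d where "good r (i, d)"
      using strong_greedy[OF True] unfolding good_def by auto
    then show ?thesis by blast
  qed simp
  then obtain J where J: "\<forall>r. strong_measurable \<rho> r \<longrightarrow> good r (J r)" using choice[of "\<lambda>r x. strong_measurable \<rho> r \<longrightarrow> good r x"] by blast
  define R where "R = rec_nat u (\<lambda>_ r \<sigma>. r \<sigma> - snd (J r) (fst (J r) \<sigma>))"
  have R0: "R 0 = u" by (simp add: R_def)
  have RS: "R (Suc p) = (\<lambda>\<sigma>. R p \<sigma> - snd (J (R p)) (fst (J (R p)) \<sigma>))" for p by (simp add: R_def)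
  have sR: "strong_measurable \<rho> (R p)" for p
  proof (induction p)
    case (Suc p)
    then have "good (R p) (J (R p))" using J by blast
    then show ?case unfolding RS good_def by blast
  qed (simp add: R0 assms)
  then have gR: "good (R p) (J (R p))" for p using J by blast
  define i where "i p = fst (J (R p))" for p
  define d where "d p = snd (J (R p))" for p
  have diff: "d p (i p \<sigma>) = R p \<sigma> - R (Suc p) \<sigma>" for p \<sigma> by (simp add: RS d_def i_def)
  have nR: "norm (R p \<sigma>) \<le> norm (u \<sigma>) * (1 / 4) ^ p" if "\<sigma> \<in> space \<rho>" for p \<sigma>
  proof (induction p)
    case (Suc p)
    have "norm (R (Suc p) \<sigma>) \<le> norm (R p \<sigma>) / 4" using gR[of p] that unfolding good_def RS by blast
    then show ?case using Suc by simp
  qed (simp add: R0)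
  have "i p \<in> measurable \<rho> (count_space UNIV)" for p using gR[of p] unfolding good_def i_def by blast
  moreover have "(\<lambda>p. d p (i p \<sigma>)) sums u \<sigma>" if "\<sigma> \<in> space \<rho>" for \<sigma>
  proof -
    have "(\<lambda>p. norm (u \<sigma>) * (1 / 4 :: real) ^ p) \<longlonglongrightarrow> norm (u \<sigma>) * 0"
      by (intro tendsto_mult tendsto_const LIMSEQ_realpow_zero) auto
    then have z: "(\<lambda>p. norm (u \<sigma>) * (1 / 4 :: real) ^ p) \<longlonglongrightarrow> 0" by simp
    have "(\<lambda>p. R p \<sigma>) \<longlonglongrightarrow> 0"
      by (rule Lim_null_comparison[OF _ z]) (simp add: nR[OF that])
    from telescope_sums'[OF this] show ?thesis by (simp add: diff R0)
  qed
  \<comment> \<open>The p-th term is the difference of two successive remainders, whence 1 + 1/4 =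
    5/4.\<close>
  moreover have "norm (d p (i p \<sigma>)) \<le> 5 / 4 * norm (u \<sigma>) * (1 / 4) ^ p" if "\<sigma> \<in> space \<rho>" for p \<sigma>
    using norm_triangle_ineq4[of "R p \<sigma>" "R (Suc p) \<sigma>"] nR[OF that, of p] nR[OF that, of "Suc p"]
    unfolding diff by simp
  ultimately show ?thesis by blast
qed

text \<open>All dependence on \<sigma> sits in scalar functions, which may be integrated one by one.
  The bound is relative to the norm of u at the same point, so that integrability of that norm
  passes to the series.\<close>

definition strong_expansion ::
  "'s measure \<Rightarrow> ('s \<Rightarrow> 'a::real_normed_vector) \<Rightarrow> ('i \<Rightarrow> 's \<Rightarrow> real) \<Rightarrow> ('i \<Rightarrow> 'a) \<Rightarrow> bool" where
  "strong_expansion \<rho> u a z \<longleftrightarrow> (\<forall>x. a x \<in> borel_measurable \<rho>) \<and>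
    (\<forall>\<sigma>\<in>space \<rho>. ((\<lambda>x. a x \<sigma> *\<^sub>R z x) has_sum u \<sigma>) UNIV \<and>
      (\<exists>c\<le>2 * norm (u \<sigma>). ((\<lambda>x. norm (a x \<sigma> *\<^sub>R z x)) has_sum c) UNIV))"

lemma strong_series:
  fixes u :: "'s \<Rightarrow> 'a::banach"
  assumes "strong_measurable \<rho> u"
  shows "\<exists>(a :: nat \<times> nat \<Rightarrow> 's \<Rightarrow> real) z. strong_expansion \<rho> u a z"
proof -
  obtain i :: "nat \<Rightarrow> 's \<Rightarrow> nat" and d where i: "\<forall>p. i p \<in> measurable \<rho> (count_space UNIV)"
    and d: "\<forall>\<sigma>\<in>space \<rho>. (\<lambda>p. d p (i p \<sigma>)) sums u \<sigma> \<and>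
      (\<forall>p. norm (d p (i p \<sigma>)) \<le> 5 / 4 * norm (u \<sigma>) * (1 / 4) ^ p)"
    using strong_countably_valued_series[OF assms] by (elim exE conjE)
  \<comment> \<open>The scalar at (p, m) is the indicator of the set where i p takes the value m;
    for fixed p and \<sigma> exactly one m contributes.\<close>
  define a where "a x \<sigma> = (if i (fst x) \<sigma> = snd x then 1 else 0 :: real)" for x \<sigma>
  define z where "z x = d (fst x) (snd x)" for x
  have "a x \<in> borel_measurable \<rho>" for x
  proof -
    have [measurable]: "i p \<in> measurable \<rho> (count_space UNIV)" for p using i by blast
    show ?thesis unfolding a_def by measurable
  qed
  moreover have "((\<lambda>x. a x \<sigma> *\<^sub>R z x) has_sum u \<sigma>) UNIV \<and>
      (\<exists>c\<le>2 * norm (u \<sigma>). ((\<lambda>x. norm (a x \<sigma> *\<^sub>R z x)) has_sum c) UNIV)" if \<sigma>: "\<sigma> \<in> space \<rho>" for \<sigma>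
  proof -
    let ?q = "\<lambda>p. d p (i p \<sigma>)"
    have az: "a (p, m) \<sigma> *\<^sub>R z (p, m) = (if i p \<sigma> = m then d p m else 0)" for p m
      by (simp add: a_def z_def)
    have q: "?q sums u \<sigma>" "norm (?q p) \<le> 5 / 4 * norm (u \<sigma>) * (1 / 4) ^ p" for p
      using d \<sigma> by blast+
    have geo: "(\<lambda>p. 5 / 4 * norm (u \<sigma>) * (1 / 4 :: real) ^ p) sums (5 / 4 * norm (u \<sigma>) * (1 / (1 - 1 / 4)))"
      by (intro sums_mult geometric_sums) simp
    have sq: "summable (\<lambda>p. norm (?q p))"
      by (rule summable_comparison_test'[OF sums_summable[OF geo], of 0])
        (unfold real_norm_def abs_norm_cancel, rule q(2))
    have hs: "(?q has_sum u \<sigma>) UNIV" by (rule norm_summable_imp_has_sum[OF sq q(1)])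
    have ns: "((\<lambda>p. norm (?q p)) has_sum (\<Sum>p. norm (?q p))) UNIV"
      by (rule norm_summable_imp_has_sum) (use sq in \<open>auto intro: summable_sums\<close>)
    have in1: "((\<lambda>m. a (p, m) \<sigma> *\<^sub>R z (p, m)) has_sum ?q p) UNIV" for p
      unfolding az by (rule has_sum_delta)
    have in2: "((\<lambda>m. norm (a (p, m) \<sigma> *\<^sub>R z (p, m))) has_sum norm (?q p)) UNIV" for p
    proof -
      have eq: "norm (a (p, m) \<sigma> *\<^sub>R z (p, m)) = (if i p \<sigma> = m then norm (d p m) else 0)" for m
        unfolding az by simp
      show ?thesis unfolding eq by (rule has_sum_delta[where f = "\<lambda>m. norm (d p m)"])
    qed
    note res = has_sum_Sigma_majorized[OF in2 has_sum_imp_summable[OF ns] order_refl in1 hs]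
    \<comment> \<open>The geometric series sums to 5/4 * 4/3 = 5/3, rounded up to 2.\<close>
    have "(\<Sum>p. norm (?q p)) \<le> 5 / 4 * norm (u \<sigma>) * (1 / (1 - 1 / 4))"
      using suminf_le[OF q(2) sq sums_summable[OF geo]] sums_unique[OF geo] by simp
    also have "\<dots> = 5 / 3 * norm (u \<sigma>)" by simp
    finally have "infsum (\<lambda>p. norm (?q p)) UNIV \<le> 2 * norm (u \<sigma>)"
      unfolding infsumI[OF ns] using norm_ge_zero[of "u \<sigma>"] by linarith
    then show ?thesis using res by blast
  qed
  ultimately show ?thesis unfolding strong_expansion_def by blast
qed

section \<open>Rank one operators and functionals on the trace class\<close>

definition rk :: "'b::complex_hilbert \<Rightarrow> 'a::complex_hilbert \<Rightarrow> 'a \<Rightarrow>\<^sub>L 'b" where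
  "rk x y = Blinfun (\<lambda>h. cinner h y *\<^sub>C x)"

lemma rk_apply: "rk x y h = cinner h y *\<^sub>C x"
proof -
  have "bounded_linear (\<lambda>h. cinner h y *\<^sub>C x)"
    by (intro bounded_linear_compose[OF scaleC.bounded_linear_left] cinner.bounded_linear_left)
  then show ?thesis unfolding rk_def by (simp add: bounded_linear_Blinfun_apply)
qed

lemma norm_rk_le: "norm (rk x y) \<le> norm x * norm y"
proof (rule norm_blinfun_bound)
  show "norm (rk x y h) \<le> norm x * norm y * norm h" for h
    using mult_right_mono[OF cmod_cinner_le[of h y] norm_ge_zero[of x]]
    by (simp add: rk_apply norm_scaleC mult_ac)
qed simp

interpretation rk: bounded_bilinear rk
proof
  show "\<exists>K. \<forall>a b. norm (rk a b) \<le> norm a * norm b * K"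
    by (rule exI[of _ 1]) (simp add: norm_rk_le)
qed (rule blinfun_eqI, simp add: rk_apply scaleC_add_right cinner_add_right scaleC_add_left
    blinfun.add_left blinfun.scaleR_left scaleC.scaleR_left scaleC.scaleR_right cinner.scaleR_right)+

lemma scaleR_eq_scaleC: "r *\<^sub>R x = complex_of_real r *\<^sub>C (x :: 'a::complex_vector)"
  by (simp add: scaleC_of_real)

text \<open>Absolute summability upgrades pointwise convergence to convergence in operator norm, so
  a representation can be handled as a series in the Banach space of operators.\<close>

lemma nuclear_rep_iff:
  "nuclear_rep A x y \<longleftrightarrow> summable (\<lambda>n. norm (x n) * norm (y n)) \<and> (\<lambda>n. rk (x n) (y n)) sums A"
proof
  assume A: "nuclear_rep A x y"
  then have s: "summable (\<lambda>n. norm (x n) * norm (y n))" by (simp add: nuclear_rep_def)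
  have "summable (\<lambda>n. rk (x n) (y n))"
    by (rule summable_comparison_test'[OF s, of 0]) (rule norm_rk_le)
  then obtain B where B: "(\<lambda>n. rk (x n) (y n)) sums B" using summable_sums by blast
  have "B = A"
  proof (rule blinfun_eqI)
    fix h
    have "(\<lambda>n. cinner h (y n) *\<^sub>C x n) sums B h"
      using bounded_linear.sums[OF blinfun.bounded_linear_left B] by (simp add: rk_apply)
    moreover have "(\<lambda>n. cinner h (y n) *\<^sub>C x n) sums A h" using A by (simp add: nuclear_rep_def)
    ultimately show "B h = A h" by (rule sums_unique2)
  qed
  with s B show "summable (\<lambda>n. norm (x n) * norm (y n)) \<and> (\<lambda>n. rk (x n) (y n)) sums A" by simp
next
  assume A: "summable (\<lambda>n. norm (x n) * norm (y n)) \<and> (\<lambda>n. rk (x n) (y n)) sums A"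
  have "(\<lambda>n. cinner h (y n) *\<^sub>C x n) sums A h" for h
    using bounded_linear.sums[OF blinfun.bounded_linear_left, of "\<lambda>n. rk (x n) (y n)" A h] A
    by (simp add: rk_apply)
  with A show "nuclear_rep A x y" by (simp add: nuclear_rep_def)
qed

lemma rk_trace_class:
  assumes K: "closed_csubspace K" and x: "x \<in> K" and y: "y \<in> H"
  shows "rk x y \<in> trace_class H K" "trace_norm (rk x y) \<le> norm x * norm y"
proof -
  let ?x = "\<lambda>n::nat. if n = 0 then x else 0"
  have 1: "(\<lambda>n. norm (?x n) * norm y) = (\<lambda>n. if n = 0 then norm x * norm y else 0)" by auto
  have 2: "(\<lambda>n. rk (?x n) y) = (\<lambda>n. if n = 0 then rk x y else 0)" by (auto simp: rk.zero_left)
  have rep: "nuclear_rep (rk x y) ?x (\<lambda>_. y)"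
    unfolding nuclear_rep_iff 1 2
    using sums_single[of 0 "\<lambda>_. rk x y"] sums_summable[OF sums_single[of 0 "\<lambda>_. norm x * norm y"]] by simp
  have "0 \<in> K" using K by (simp add: closed_csubspace_def)
  then have "?x n \<in> K" for n using x by simp
  note res = nuclear_trace_class[OF rep K this y]
  have "(\<Sum>n. norm (?x n) * norm y) = norm x * norm y"
    unfolding 1 using sums_unique[OF sums_single[of 0 "\<lambda>_. norm x * norm y"]] by simp
  then show "rk x y \<in> trace_class H K" "trace_norm (rk x y) \<le> norm x * norm y" using res by simp_all
qed

lemma dual_rk_scaleR:
  fixes x :: "'b::complex_hilbert" and y :: "'a::complex_hilbert"
  assumes K: "closed_csubspace K" and x: "x \<in> K" and y: "y \<in> H"
    and l: "l \<in> dual_on (trace_class H K) trace_norm"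
  shows "l (rk (r *\<^sub>R x) y) = complex_of_real r * l (rk x y)"
proof -
  have "rk (r *\<^sub>R x) y = complex_of_real r *\<^sub>C rk x y"
    unfolding rk.scaleR_left by (rule scaleR_eq_scaleC)
  moreover have "l (complex_of_real r *\<^sub>C rk x y) = complex_of_real r * l (rk x y)"
    using l rk_trace_class(1)[OF K x y] unfolding dual_on_def by blast
  ultimately show ?thesis by simp
qed

text \<open>The tail A - P N is represented by the shifted sequences, so
  \<open>nuclear_trace_class\<close> bounds its trace norm by a tail of a convergent series.
  Boundedness of l on the trace class then gives convergence.\<close>

lemma dual_sums:
  fixes A :: "'a::complex_hilbert \<Rightarrow>\<^sub>L 'b::complex_hilbert"
  assumes A: "nuclear_rep A x y" and K: "closed_csubspace K" and xK: "\<And>n. x n \<in> K" and yH: "\<And>n. y n \<in> H"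
    and l: "l \<in> dual_on (trace_class H K) trace_norm"
  shows "(\<lambda>n. l (rk (x n) (y n))) sums l A"
proof -
  let ?V = "trace_class H K"
  let ?s = "\<lambda>n. norm (x n) * norm (y n)"
  have s: "summable ?s" and sA: "(\<lambda>n. rk (x n) (y n)) sums A"
    using A by (simp_all add: nuclear_rep_iff)
  have K0: "0 \<in> K" using K by (simp add: closed_csubspace_def)
  obtain C where C: "\<forall>T\<in>?V. cmod (l T) \<le> C * trace_norm T"
    using l unfolding dual_on_def by blast
  have add: "l (S + T) = l S + l T" if "S \<in> ?V" "T \<in> ?V" for S T
    using l that unfolding dual_on_def by blast
  note rkV = rk_trace_class(1)[OF K xK yH]
  define P where "P N = (\<Sum>n<N. rk (x n) (y n))" for N
  have tail: "nuclear_rep (A - P N) (\<lambda>n. x (n + N)) (\<lambda>n. y (n + N))" for N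
    unfolding nuclear_rep_iff P_def
    using summable_ignore_initial_segment[OF s, of N] sums_split_initial_segment[OF sA, of N] by simp
  have tailV: "A - P N \<in> ?V" and tail_norm: "trace_norm (A - P N) \<le> (\<Sum>n. ?s (n + N))" for N
    using nuclear_trace_class[OF tail K xK yH] by simp_all
  have PV: "P N \<in> ?V" for N
  proof (rule nuclear_trace_class(1)[OF _ K])
    let ?x = "\<lambda>i. if i < N then x i else 0"
    have "(\<lambda>i. rk (?x i) (y i)) sums (\<Sum>i<N. rk (?x i) (y i))"
      by (rule sums_finite) (auto simp: rk.zero_left)
    then have "(\<lambda>i. rk (?x i) (y i)) sums P N" by (simp add: P_def)
    moreover have "summable (\<lambda>i. norm (?x i) * norm (y i))"
      by (rule summable_finite[of "{..<N}"]) auto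
    ultimately show "nuclear_rep (P N) ?x y" by (simp add: nuclear_rep_iff)
  qed (auto simp: xK yH K0)
  have l0: "l 0 = 0"
  proof -
    have "(0 :: 'a \<Rightarrow>\<^sub>L 'b) \<in> ?V" using PV[of 0] by (simp add: P_def)
    then have "l (0 *\<^sub>C 0) = 0 * l 0" using l unfolding dual_on_def by blast
    then show ?thesis by (simp add: scaleC.zero_left)
  qed
  have lP: "l (P N) = (\<Sum>n<N. l (rk (x n) (y n)))" for N
  proof (induction N)
    case (Suc N)
    have "P (Suc N) = P N + rk (x N) (y N)" by (simp add: P_def)
    then show ?case using add[OF PV[of N] rkV[of N]] Suc by simp
  qed (simp add: P_def l0)
  have "(\<lambda>N. l A - l (P N)) \<longlonglongrightarrow> 0"
  proof (rule Lim_null_comparison)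
    \<comment> \<open>The constant in \<open>dual_on\<close> carries no sign condition, hence the
      absolute value.\<close>
    have "cmod (l A - l (P N)) \<le> \<bar>C\<bar> * (\<Sum>n. ?s (n + N))" for N
    proof -
      have "l A = l (A - P N) + l (P N)" using add[OF tailV[of N] PV[of N]] by simp
      then have "cmod (l A - l (P N)) \<le> C * trace_norm (A - P N)" using C tailV by simp
      also have "\<dots> \<le> \<bar>C\<bar> * trace_norm (A - P N)" by (intro mult_right_mono) (auto simp: trace_norm_def)
      also have "\<dots> \<le> \<bar>C\<bar> * (\<Sum>n. ?s (n + N))" by (intro mult_left_mono tail_norm) auto
      finally show ?thesis .
    qed
    then show "\<forall>\<^sub>F N in sequentially. cmod (l A - l (P N)) \<le> \<bar>C\<bar> * (\<Sum>n. ?s (n + N))" by simp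
    have "(\<lambda>N. suminf ?s - (\<Sum>n<N. ?s n)) \<longlonglongrightarrow> suminf ?s - suminf ?s"
      by (intro tendsto_diff tendsto_const summable_LIMSEQ[OF s])
    then have "(\<lambda>N. \<Sum>n. ?s (n + N)) \<longlonglongrightarrow> 0"
      by (simp add: suminf_minus_initial_segment[OF s])
    then show "(\<lambda>N. \<bar>C\<bar> * (\<Sum>n. ?s (n + N))) \<longlonglongrightarrow> 0" by (rule tendsto_mult_right_zero)
  qed
  from tendsto_diff[OF tendsto_const[of "l A"] this] have "(\<lambda>N. l (P N)) \<longlonglongrightarrow> l A" by simp
  then show ?thesis unfolding sums_def lP .
qed

section \<open>Gel'fand--Pettis integration of operator series\<close>

text \<open>One series serves all functionals. By \<open>bound\<close>, sum and integral may be
  interchanged, so the integral of l (F \<sigma>) over S is the sum of r i times l at the i-th rank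
  one operator, r i being the integral of t i over S. By \<open>dual_sums\<close> this is l v for
  the operator v with coefficients r i, and v does not depend on l.\<close>

lemma gp_series:
  fixes t :: "nat \<Rightarrow> 's \<Rightarrow> real" and F :: "'s \<Rightarrow> 'a::complex_hilbert \<Rightarrow>\<^sub>L 'b::complex_hilbert"
  assumes K: "closed_csubspace K"
    and t: "\<And>i. t i \<in> borel_measurable \<rho>" and X: "\<And>i. X i \<in> K" and Y: "\<And>i. Y i \<in> H"
    and rep: "\<And>\<sigma>. \<sigma> \<in> space \<rho> \<Longrightarrow> nuclear_rep (F \<sigma>) (\<lambda>i. t i \<sigma> *\<^sub>R X i) Y"
    and bound: "(\<integral>\<^sup>+\<sigma>. (\<Sum>i. ennreal (\<bar>t i \<sigma>\<bar> * (norm (X i) * norm (Y i)))) \<partial>\<rho>) < \<infinity>"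
    and zero: "\<And>i \<sigma>. X i = 0 \<or> Y i = 0 \<Longrightarrow> t i \<sigma> = 0"
  shows "gp_integrable (trace_class H K) trace_norm \<rho> F"
proof -
  let ?V = "trace_class H K"
  define w where "w i = norm (X i) * norm (Y i)" for i
  have w0: "0 \<le> w i" for i by (simp add: w_def)
  note [measurable] = t
  have XK: "r *\<^sub>R X i \<in> K" for r i using K X by (rule closed_csubspace_scaleR)
  have "(\<Sum>i. \<integral>\<^sup>+\<sigma>. ennreal (\<bar>t i \<sigma>\<bar> * w i) \<partial>\<rho>) < \<infinity>"
    using bound unfolding w_def by (subst nn_integral_suminf[symmetric]) auto
  then have sumfin: "(\<Sum>i. \<integral>\<^sup>+\<sigma>. ennreal (\<bar>t i \<sigma>\<bar> * w i) \<partial>\<rho>) \<noteq> \<infinity>" by simp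
  have fin: "(\<integral>\<^sup>+\<sigma>. ennreal (\<bar>t i \<sigma>\<bar> * w i) \<partial>\<rho>) < \<infinity>" for i
    using ennreal_suminf_lessD[of _ \<infinity> i] sumfin by (simp add: less_top)
  have itw: "integrable \<rho> (\<lambda>\<sigma>. \<bar>t i \<sigma>\<bar> * w i)" for i
    using fin[of i] w0 by (intro integrableI_bounded) simp_all
  \<comment> \<open>If the weight w i vanishes, \<open>bound\<close> says nothing about t i; then
    \<open>zero\<close> forces t i to vanish.\<close>
  have it: "integrable \<rho> (t i)" for i
  proof (cases "w i = 0")
    case True
    then have "t i = (\<lambda>_. 0)" using zero[of i] by (auto simp: w_def fun_eq_iff)
    then show ?thesis by simp
  next
    case False
    have "integrable \<rho> (\<lambda>\<sigma>. \<bar>t i \<sigma>\<bar> * w i / w i)" using itw by (rule integrable_divide)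
    then have "integrable \<rho> (\<lambda>\<sigma>. \<bar>t i \<sigma>\<bar>)" using False by simp
    then show ?thesis using t by (rule integrable_abs_cancel)
  qed
  define m where "m i = (\<integral>\<sigma>. \<bar>t i \<sigma>\<bar> * w i \<partial>\<rho>)" for i
  have m0: "0 \<le> m i" for i unfolding m_def by (intro integral_nonneg_AE AE_I2) (simp add: w0)
  have "(\<integral>\<^sup>+\<sigma>. ennreal (\<bar>t i \<sigma>\<bar> * w i) \<partial>\<rho>) = ennreal (m i)" for i
    unfolding m_def by (rule nn_integral_eq_integral[OF itw]) (simp add: w0)
  then have sm: "summable m"
    using sumfin by (intro summable_suminf_not_top m0) simp
  have FV: "F \<sigma> \<in> ?V" if "\<sigma> \<in> space \<rho>" for \<sigma>
    by (rule nuclear_trace_class(1)[OF rep[OF that] K XK Y])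
  have main: "integrable \<rho> (\<lambda>\<sigma>. l (F \<sigma>)) \<and>
      (\<forall>S\<in>sets \<rho>. (\<lambda>i. complex_of_real (\<integral>\<sigma>. indicator S \<sigma> * t i \<sigma> \<partial>\<rho>) * l (rk (X i) (Y i)))
        sums (LINT \<sigma>:S|\<rho>. l (F \<sigma>)))"
    if l: "l \<in> dual_on ?V trace_norm" for l
  proof -
    define L where "L i = l (rk (X i) (Y i))" for i
    obtain C where C: "\<forall>T\<in>?V. cmod (l T) \<le> C * trace_norm T"
      using l unfolding dual_on_def by blast
    have rkV: "rk (X i) (Y i) \<in> ?V" and rkn: "trace_norm (rk (X i) (Y i)) \<le> w i" for i
      using rk_trace_class[OF K X Y] by (simp_all add: w_def)
    have L: "cmod (L i) \<le> \<bar>C\<bar> * w i" for i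
    proof -
      have "cmod (L i) \<le> C * trace_norm (rk (X i) (Y i))" using C rkV by (simp add: L_def)
      also have "\<dots> \<le> \<bar>C\<bar> * trace_norm (rk (X i) (Y i))" by (intro mult_right_mono) (auto simp: trace_norm_def)
      also have "\<dots> \<le> \<bar>C\<bar> * w i" by (intro mult_left_mono rkn) simp
      finally show ?thesis .
    qed
    have lscale: "l (rk (r *\<^sub>R X i) (Y i)) = complex_of_real r * L i" for r i
      unfolding L_def by (rule dual_rk_scaleR[OF K X Y l])
    have lF: "(\<lambda>i. complex_of_real (t i \<sigma>) * L i) sums l (F \<sigma>)" if "\<sigma> \<in> space \<rho>" for \<sigma>
      using dual_sums[OF rep[OF that] K XK Y l] unfolding lscale .
    have S: "integrable \<rho> (\<lambda>\<sigma>. indicator S \<sigma> *\<^sub>R l (F \<sigma>)) \<and>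
        (\<lambda>i. complex_of_real (\<integral>\<sigma>. indicator S \<sigma> * t i \<sigma> \<partial>\<rho>) * L i) sums (\<integral>\<sigma>. indicator S \<sigma> *\<^sub>R l (F \<sigma>) \<partial>\<rho>)"
      if [measurable]: "S \<in> sets \<rho>" for S
    proof -
      define f where "f i \<sigma> = complex_of_real (indicator S \<sigma> * t i \<sigma>) * L i" for i \<sigma>
      have iS: "integrable \<rho> (\<lambda>\<sigma>. indicator S \<sigma> * t i \<sigma>)" for i
        using integrable_mult_indicator[OF that it[of i]] by simp
      then have ifi: "integrable \<rho> (f i)" for i
        unfolding f_def by (intro integrable_mult_left integrable_of_real)
      have nf: "norm (f i \<sigma>) \<le> \<bar>C\<bar> * (\<bar>t i \<sigma>\<bar> * w i)" for i \<sigma>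
      proof -
        have "norm (f i \<sigma>) \<le> \<bar>t i \<sigma>\<bar> * (\<bar>C\<bar> * w i)"
          unfolding f_def norm_mult by (intro mult_mono L) (auto simp: indicator_def)
        then show ?thesis by (simp add: mult_ac)
      qed
      have sumpt: "summable (\<lambda>i. norm (f i \<sigma>))" if "\<sigma> \<in> space \<rho>" for \<sigma>
      proof (rule summable_comparison_test'[where N = 0])
        have "summable (\<lambda>i. norm (t i \<sigma> *\<^sub>R X i) * norm (Y i))"
          using rep[OF that] by (simp add: nuclear_rep_def)
        then show "summable (\<lambda>i. \<bar>C\<bar> * (\<bar>t i \<sigma>\<bar> * w i))"
          by (intro summable_mult) (simp add: w_def mult.assoc)
      qed (simp add: nf)
      have sumint: "summable (\<lambda>i. \<integral>\<sigma>. norm (f i \<sigma>) \<partial>\<rho>)"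
      proof (rule summable_comparison_test'[where N = 0])
        show "summable (\<lambda>i. \<bar>C\<bar> * m i)" by (rule summable_mult[OF sm])
        fix i
        have "(\<integral>\<sigma>. norm (f i \<sigma>) \<partial>\<rho>) \<le> (\<integral>\<sigma>. \<bar>C\<bar> * (\<bar>t i \<sigma>\<bar> * w i) \<partial>\<rho>)"
          by (intro integral_mono integrable_norm ifi integrable_mult_right itw nf)
        then show "norm (\<integral>\<sigma>. norm (f i \<sigma>) \<partial>\<rho>) \<le> \<bar>C\<bar> * m i"
          by (simp add: m_def)
      qed
      have fl: "(\<Sum>i. f i \<sigma>) = indicator S \<sigma> *\<^sub>R l (F \<sigma>)" if "\<sigma> \<in> space \<rho>" for \<sigma>
      proof -
        have "(\<lambda>i. indicator S \<sigma> *\<^sub>R (complex_of_real (t i \<sigma>) * L i)) sums (indicator S \<sigma> *\<^sub>R l (F \<sigma>))"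
          by (intro bounded_linear.sums[OF bounded_linear_scaleR_right] lF that)
        then have "(\<lambda>i. f i \<sigma>) sums (indicator S \<sigma> *\<^sub>R l (F \<sigma>))"
          by (simp add: f_def scaleR_conv_of_real mult.assoc)
        then show ?thesis by (rule sums_unique[symmetric])
      qed
      note AE = AE_I2[of \<rho>, OF sumpt]
      have "integrable \<rho> (\<lambda>\<sigma>. \<Sum>i. f i \<sigma>)" by (rule integrable_suminf[OF ifi AE sumint])
      then have 1: "integrable \<rho> (\<lambda>\<sigma>. indicator S \<sigma> *\<^sub>R l (F \<sigma>))"
        by (rule iffD1[OF Bochner_Integration.integrable_cong[OF refl], rotated]) (rule fl)
      have "(\<lambda>i. \<integral>\<sigma>. f i \<sigma> \<partial>\<rho>) sums (\<integral>\<sigma>. (\<Sum>i. f i \<sigma>) \<partial>\<rho>)"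
        by (rule sums_integral[OF ifi AE sumint])
      also have "(\<integral>\<sigma>. (\<Sum>i. f i \<sigma>) \<partial>\<rho>) = (\<integral>\<sigma>. indicator S \<sigma> *\<^sub>R l (F \<sigma>) \<partial>\<rho>)"
        by (rule Bochner_Integration.integral_cong[OF refl]) (rule fl)
      also have "(\<lambda>i. \<integral>\<sigma>. f i \<sigma> \<partial>\<rho>) = (\<lambda>i. complex_of_real (\<integral>\<sigma>. indicator S \<sigma> * t i \<sigma> \<partial>\<rho>) * L i)"
        unfolding f_def by (intro ext) (simp only: integral_mult_left_zero integral_of_real[OF iS])
      finally show ?thesis using 1 by simp
    qed
    have "integrable \<rho> (\<lambda>\<sigma>. l (F \<sigma>))"
      using conjunct1[OF S[OF sets.top]]
      by (rule iffD1[OF Bochner_Integration.integrable_cong[OF refl], rotated]) simp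
    then show ?thesis using S unfolding set_lebesgue_integral_def L_def by blast
  qed
  \<comment> \<open>The coefficients of the candidate are dominated by the summable sequence m,
    whatever S is.\<close>
  have "\<exists>v. is_gp_integral ?V trace_norm \<rho> F S v" if S: "S \<in> sets \<rho>" for S
  proof -
    define r where "r i = (\<integral>\<sigma>. indicator S \<sigma> * t i \<sigma> \<partial>\<rho>)" for i
    have r: "norm (r i *\<^sub>R X i) * norm (Y i) \<le> m i" for i
    proof -
      have "\<bar>r i\<bar> \<le> (\<integral>\<sigma>. norm (indicator S \<sigma> * t i \<sigma>) \<partial>\<rho>)"         unfolding r_def using integral_norm_bound[of \<rho> "\<lambda>\<sigma>. indicator S \<sigma> * t i \<sigma>"] by (simp only: real_norm_def)
      also have "\<dots> \<le> (\<integral>\<sigma>. \<bar>t i \<sigma>\<bar> \<partial>\<rho>)"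
        using integrable_mult_indicator[OF S it[of i]] it[of i]
        by (intro integral_mono) (auto simp: indicator_def)
      finally have "\<bar>r i\<bar> * w i \<le> (\<integral>\<sigma>. \<bar>t i \<sigma>\<bar> \<partial>\<rho>) * w i" by (rule mult_right_mono[OF _ w0])
      also have "\<dots> = m i" unfolding m_def using it[of i] by simp
      finally show ?thesis by (simp add: w_def mult.assoc)
    qed
    have sr: "summable (\<lambda>i. norm (r i *\<^sub>R X i) * norm (Y i))"
      by (rule summable_comparison_test'[OF sm, of 0]) (unfold real_norm_def abs_mult abs_norm_cancel, rule r)
    have "summable (\<lambda>i. rk (r i *\<^sub>R X i) (Y i))"
      by (rule summable_comparison_test'[OF sr, of 0]) (rule norm_rk_le)
    then obtain v where "(\<lambda>i. rk (r i *\<^sub>R X i) (Y i)) sums v" using summable_sums by blast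
    with sr have v: "nuclear_rep v (\<lambda>i. r i *\<^sub>R X i) Y" by (simp add: nuclear_rep_iff)
    have "l v = (LINT \<sigma>:S|\<rho>. l (F \<sigma>))" if l: "l \<in> dual_on ?V trace_norm" for l
    proof (rule sums_unique2)
      show "(\<lambda>i. l (rk (r i *\<^sub>R X i) (Y i))) sums l v" by (rule dual_sums[OF v K XK Y l])
      show "(\<lambda>i. l (rk (r i *\<^sub>R X i) (Y i))) sums (LINT \<sigma>:S|\<rho>. l (F \<sigma>))"
        using main[OF l] S unfolding r_def dual_rk_scaleR[OF K X Y l] by blast
    qed
    moreover have "v \<in> ?V" by (rule nuclear_trace_class(1)[OF v K XK Y])
    ultimately show ?thesis unfolding is_gp_integral_def by blast
  qed
  then show ?thesis using FV main unfolding gp_integrable_def by blast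
qed

text \<open>Both integrals are definite descriptions of an operator in \<open>bops H K\<close> with
  prescribed matrix coefficients, and \<open>bops_eqI\<close> gives uniqueness in each case.\<close>

lemma gp_integral_eq_pettis:
  fixes F :: "'s \<Rightarrow> 'a::complex_hilbert \<Rightarrow>\<^sub>L 'b::complex_hilbert"
  assumes H: "closed_csubspace H" and K: "closed_csubspace K"
    and gp: "gp_integrable (trace_class H K) trace_norm \<rho> F"
  shows "pointwise_pettis_integral H K \<rho> F \<in> trace_class H K \<and>
    gp_integral (trace_class H K) trace_norm \<rho> F (space \<rho>) = pointwise_pettis_integral H K \<rho> F"
proof -
  let ?V = "trace_class H K"
  obtain v where v: "is_gp_integral ?V trace_norm \<rho> F (space \<rho>) v"
    using gp unfolding gp_integrable_def by blast
  have V: "T \<in> bops H K" if "T \<in> ?V" for T using that by (simp add: trace_class_def)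
  have int: "integrable \<rho> (\<lambda>\<sigma>. cinner (F \<sigma> h) h')" for h h'
  proof -
    have "\<forall>l\<in>dual_on ?V trace_norm. integrable \<rho> (\<lambda>\<sigma>. l (F \<sigma>))"
      using gp by (simp add: gp_integrable_def)
    from bspec[OF this matrix_coefficient_dual] show ?thesis .
  qed
  have coef: "cinner (T h) h' = (\<integral>\<sigma>. cinner (F \<sigma> h) h' \<partial>\<rho>)"
    if "is_gp_integral ?V trace_norm \<rho> F (space \<rho>) T" for T h h'
  proof -
    have "cinner (T h) h' = (LINT \<sigma>:space \<rho>|\<rho>. cinner (F \<sigma> h) h')"
    proof -
      have "\<forall>l\<in>dual_on ?V trace_norm. l T = (LINT \<sigma>:space \<rho>|\<rho>. l (F \<sigma>))"
        using that by (simp add: is_gp_integral_def)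
      from bspec[OF this matrix_coefficient_dual] show ?thesis .
    qed
    then show ?thesis using set_integral_space[OF int] by simp
  qed
  have vV: "v \<in> ?V" using v by (simp add: is_gp_integral_def)
  have "pointwise_pettis_integral H K \<rho> F = v"
    unfolding pointwise_pettis_integral_def
  proof (rule the_equality)
    show "v \<in> bops H K \<and> (\<forall>h\<in>H. \<forall>h'\<in>K. integrable \<rho> (\<lambda>\<sigma>. cinner (F \<sigma> h) h') \<and>
        cinner (v h) h' = (\<integral>\<sigma>. cinner (F \<sigma> h) h' \<partial>\<rho>))"
      using V[OF vV] int coef[OF v] by blast
    fix T :: "'a \<Rightarrow>\<^sub>L 'b"
    assume T: "T \<in> bops H K \<and> (\<forall>h\<in>H. \<forall>h'\<in>K. integrable \<rho> (\<lambda>\<sigma>. cinner (F \<sigma> h) h') \<and>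
        cinner (T h) h' = (\<integral>\<sigma>. cinner (F \<sigma> h) h' \<partial>\<rho>))"
    show "T = v"
      by (rule bops_eqI[OF H K conjunct1[OF T] V[OF vV]]) (use T coef[OF v] in simp)
  qed
  moreover have "gp_integral ?V trace_norm \<rho> F (space \<rho>) = v"
    unfolding gp_integral_def
  proof (rule the_equality, rule v)
    fix T assume T: "is_gp_integral ?V trace_norm \<rho> F (space \<rho>) T"
    then have TV: "T \<in> ?V" by (simp add: is_gp_integral_def)
    show "T = v"
      by (rule bops_eqI[OF H K V[OF TV] V[OF vV]]) (simp only: coef[OF T] coef[OF v])
  qed
  ultimately show ?thesis using vV by simp
qed

text \<open>Majorants replace the norms of f and g because in \<open>gp_family\<close> the terms are
  projected after the expansion, while a sum is known only for the norms before projection.\<close>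

lemma has_sum_rk_double:
  fixes f :: "'i \<Rightarrow> 'b::complex_hilbert" and g :: "'j \<Rightarrow> 'a::complex_hilbert"
  assumes f: "(f has_sum u) UNIV" and cf: "(cf has_sum c) UNIV" "\<And>x. norm (f x) \<le> cf x"
    and g: "(g has_sum v) UNIV" and dg: "(dg has_sum d) UNIV" "\<And>y. norm (g y) \<le> dg y"
  shows "((\<lambda>(x, y). rk (f x) (g y)) has_sum rk u v) UNIV" "((\<lambda>(x, y). cf x * dg y) has_sum (c * d)) UNIV"
proof -
  let ?f = "\<lambda>(x, y). rk (f x) (g y)" and ?M = "\<lambda>(x, y). cf x * dg y"
  have M: "((\<lambda>y. ?M (x, y)) has_sum (cf x * d)) UNIV" for x
    by (simp add: has_sum_cmult_right[OF dg(1)])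
  have n: "((\<lambda>x. cf x * d) has_sum (c * d)) UNIV" by (rule has_sum_cmult_left[OF cf(1)])
  have cf0: "0 \<le> cf x" for x by (rule order_trans[OF norm_ge_zero cf(2)])
  have le: "norm (?f z) \<le> ?M z" for z
  proof (cases z)
    case (Pair x y)
    have "norm (f x) * norm (g y) \<le> cf x * dg y" by (intro mult_mono cf(2) dg(2) cf0 norm_ge_zero)
    then show ?thesis unfolding Pair prod.case using norm_rk_le[of "f x" "g y"] by linarith
  qed
  have inner: "((\<lambda>y. ?f (x, y)) has_sum rk (f x) v) UNIV" for x
    unfolding prod.case by (rule has_sum_bounded_linear[OF rk.bounded_linear_right g])
  have outer: "((\<lambda>x. rk (f x) v) has_sum rk u v) UNIV"
    by (rule has_sum_bounded_linear[OF rk.bounded_linear_left f])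
  note res = has_sum_Sigma_majorized[OF M has_sum_imp_summable[OF n] le inner outer]
  show "(?f has_sum rk u v) UNIV" by (rule res(1))
  show "(?M has_sum (c * d)) UNIV" using res(2) unfolding infsumI[OF n] .
qed

text \<open>Expanding u n and v n separately and multiplying gives a series over n and two pairs of
  indices, with fixed vectors and scalar functions as \<open>gp_series\<close> requires. The
  estimate by g is pointwise, so g may be nonmeasurable.\<close>

lemma gp_family:
  fixes u :: "nat \<Rightarrow> 's \<Rightarrow> 'b::complex_hilbert" and v :: "nat \<Rightarrow> 's \<Rightarrow> 'a::complex_hilbert"
    and pH :: "'a \<Rightarrow>\<^sub>L 'a" and pK :: "'b \<Rightarrow>\<^sub>L 'b"
  assumes K: "closed_csubspace K"
    and pH: "\<And>x. pH x \<in> H" "\<And>x. norm (pH x) \<le> norm x" "\<And>x. x \<in> H \<Longrightarrow> pH x = x"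
    and pK: "\<And>x. pK x \<in> K" "\<And>x. norm (pK x) \<le> norm x" "\<And>x. x \<in> K \<Longrightarrow> pK x = x"
    and u: "\<And>n. strong_measurable \<rho> (u n)" "\<And>n \<sigma>. \<sigma> \<in> space \<rho> \<Longrightarrow> u n \<sigma> \<in> K"
    and v: "\<And>n. strong_measurable \<rho> (v n)" "\<And>n \<sigma>. \<sigma> \<in> space \<rho> \<Longrightarrow> v n \<sigma> \<in> H"
    and rep: "\<And>\<sigma>. \<sigma> \<in> space \<rho> \<Longrightarrow> nuclear_rep (F \<sigma>) (\<lambda>n. u n \<sigma>) (\<lambda>n. v n \<sigma>)"
    and g: "\<And>\<sigma>. \<sigma> \<in> space \<rho> \<Longrightarrow> (\<Sum>n. norm (u n \<sigma>) * norm (v n \<sigma>)) \<le> g \<sigma>"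
      "upper_nn_integral \<rho> (\<lambda>\<sigma>. ennreal (g \<sigma>)) < \<infinity>"
  shows "gp_integrable (trace_class H K) trace_norm \<rho> F"
proof -
  have "\<forall>n. \<exists>az :: (nat \<times> nat \<Rightarrow> 's \<Rightarrow> real) \<times> _. strong_expansion \<rho> (u n) (fst az) (snd az)"
    using strong_series[OF u(1)] by simp
  then obtain A :: "nat \<Rightarrow> (nat \<times> nat \<Rightarrow> 's \<Rightarrow> real) \<times> _"
    where A: "\<forall>n. strong_expansion \<rho> (u n) (fst (A n)) (snd (A n))" by (rule choice[THEN exE])
  have "\<forall>n. \<exists>az :: (nat \<times> nat \<Rightarrow> 's \<Rightarrow> real) \<times> _. strong_expansion \<rho> (v n) (fst az) (snd az)"
    using strong_series[OF v(1)] by simp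
  then obtain B :: "nat \<Rightarrow> (nat \<times> nat \<Rightarrow> 's \<Rightarrow> real) \<times> _"
    where B: "\<forall>n. strong_expansion \<rho> (v n) (fst (B n)) (snd (B n))" by (rule choice[THEN exE])
  define a where "a n = fst (A n)" for n
  define z where "z n x = pK (snd (A n) x)" for n x
  define c where "c n = fst (B n)" for n
  define w where "w n x = pH (snd (B n) x)" for n x
  have meas [measurable]: "a n x \<in> borel_measurable \<rho>" "c n x \<in> borel_measurable \<rho>" for n x
    using A B unfolding strong_expansion_def a_def c_def by blast+
  \<comment> \<open>A projected vector may be 0 while its coefficient is not; resetting the
    coefficient meets the last hypothesis of \<open>gp_series\<close> and leaves every term
    unchanged.\<close>
  define T where "T q \<sigma> = (if z (fst q) (fst (snd q)) = 0 \<or> w (fst q) (snd (snd q)) = 0 then 0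
    else a (fst q) (fst (snd q)) \<sigma> * c (fst q) (snd (snd q)) \<sigma>)"
    for q :: "nat \<times> (nat \<times> nat) \<times> (nat \<times> nat)" and \<sigma>
  define Z where "Z q = z (fst q) (fst (snd q))" for q :: "nat \<times> (nat \<times> nat) \<times> (nat \<times> nat)"
  define W where "W q = w (fst q) (snd (snd q))" for q :: "nat \<times> (nat \<times> nat) \<times> (nat \<times> nat)"
  have T [measurable]: "T q \<in> borel_measurable \<rho>" for q unfolding T_def by simp
  have point: "\<exists>M C. ((\<lambda>q. T q \<sigma> *\<^sub>R rk (Z q) (W q)) has_sum F \<sigma>) UNIV \<and> (M has_sum C) UNIV \<and>
      (\<forall>q. \<bar>T q \<sigma>\<bar> * (norm (Z q) * norm (W q)) \<le> M q) \<and> C \<le> 4 * g \<sigma>" if \<sigma>: "\<sigma> \<in> space \<rho>" for \<sigma>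
  proof -
    have Fs: "summable (\<lambda>n. norm (u n \<sigma>) * norm (v n \<sigma>))" "(\<lambda>n. rk (u n \<sigma>) (v n \<sigma>)) sums F \<sigma>"
      using rep[OF \<sigma>] by (simp_all add: nuclear_rep_iff)
    have "\<exists>cu. cu \<le> 2 * norm (u n \<sigma>) \<and> ((\<lambda>x. norm (a n x \<sigma> *\<^sub>R snd (A n) x)) has_sum cu) UNIV" for n
      using A \<sigma> unfolding strong_expansion_def a_def by blast
    then have "\<exists>cu. \<forall>n. cu n \<le> 2 * norm (u n \<sigma>) \<and> ((\<lambda>x. norm (a n x \<sigma> *\<^sub>R snd (A n) x)) has_sum cu n) UNIV"
      by (intro choice allI)
    then obtain cu where cu: "\<And>n. cu n \<le> 2 * norm (u n \<sigma>)"
      "\<And>n. ((\<lambda>x. norm (a n x \<sigma> *\<^sub>R snd (A n) x)) has_sum cu n) UNIV" by blast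
    have "\<exists>cv. cv \<le> 2 * norm (v n \<sigma>) \<and> ((\<lambda>x. norm (c n x \<sigma> *\<^sub>R snd (B n) x)) has_sum cv) UNIV" for n
      using B \<sigma> unfolding strong_expansion_def c_def by blast
    then have "\<exists>cv. \<forall>n. cv n \<le> 2 * norm (v n \<sigma>) \<and> ((\<lambda>x. norm (c n x \<sigma> *\<^sub>R snd (B n) x)) has_sum cv n) UNIV"
      by (intro choice allI)
    then obtain cv where cv: "\<And>n. cv n \<le> 2 * norm (v n \<sigma>)"
      "\<And>n. ((\<lambda>x. norm (c n x \<sigma> *\<^sub>R snd (B n) x)) has_sum cv n) UNIV" by blast
    have cu0: "0 \<le> cu n" and cv0: "0 \<le> cv n" for n
      by (rule has_sum_nonneg[OF cu(2)], simp) (rule has_sum_nonneg[OF cv(2)], simp)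
    have us: "((\<lambda>x. a n x \<sigma> *\<^sub>R z n x) has_sum u n \<sigma>) UNIV" for n
    proof -
      have "((\<lambda>x. a n x \<sigma> *\<^sub>R snd (A n) x) has_sum u n \<sigma>) UNIV" using A \<sigma> unfolding strong_expansion_def a_def by blast
      from has_sum_bounded_linear[OF blinfun.bounded_linear_right this, of pK]
      show ?thesis by (simp add: z_def blinfun.scaleR_right pK(3)[OF u(2)[OF \<sigma>]])
    qed
    have vs: "((\<lambda>x. c n x \<sigma> *\<^sub>R w n x) has_sum v n \<sigma>) UNIV" for n
    proof -
      have "((\<lambda>x. c n x \<sigma> *\<^sub>R snd (B n) x) has_sum v n \<sigma>) UNIV" using B \<sigma> unfolding strong_expansion_def c_def by blast
      from has_sum_bounded_linear[OF blinfun.bounded_linear_right this, of pH]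
      show ?thesis by (simp add: w_def blinfun.scaleR_right pH(3)[OF v(2)[OF \<sigma>]])
    qed
    have uz: "norm (a n x \<sigma> *\<^sub>R z n x) \<le> norm (a n x \<sigma> *\<^sub>R snd (A n) x)" for n x
      by (simp add: z_def mult_left_mono pK(2))
    have vw: "norm (c n x \<sigma> *\<^sub>R w n x) \<le> norm (c n x \<sigma> *\<^sub>R snd (B n) x)" for n x
      by (simp add: w_def mult_left_mono pH(2))
    note dbl = has_sum_rk_double[OF us cu(2) uz vs cv(2) vw]
    define M where "M q = norm (a (fst q) (fst (snd q)) \<sigma> *\<^sub>R snd (A (fst q)) (fst (snd q))) *
      norm (c (fst q) (snd (snd q)) \<sigma> *\<^sub>R snd (B (fst q)) (snd (snd q)))"
      for q :: "nat \<times> (nat \<times> nat) \<times> (nat \<times> nat)"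
    define f where "f q = rk (a (fst q) (fst (snd q)) \<sigma> *\<^sub>R z (fst q) (fst (snd q)))
      (c (fst q) (snd (snd q)) \<sigma> *\<^sub>R w (fst q) (snd (snd q)))"
      for q :: "nat \<times> (nat \<times> nat) \<times> (nat \<times> nat)"
    have fin: "((\<lambda>m. f (n, m)) has_sum rk (u n \<sigma>) (v n \<sigma>)) UNIV" for n
      using dbl(1)[of n n] unfolding f_def fst_conv snd_conv case_prod_beta .
    have Min: "((\<lambda>m. M (n, m)) has_sum (cu n * cv n)) UNIV" for n
      using dbl(2)[of n n] unfolding M_def fst_conv snd_conv case_prod_beta .
    \<comment> \<open>Each of the two expansions costs a factor 2.\<close>
    have le4: "cu n * cv n \<le> 4 * (norm (u n \<sigma>) * norm (v n \<sigma>))" for n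
    proof -
      have "cu n * cv n \<le> (2 * norm (u n \<sigma>)) * (2 * norm (v n \<sigma>))"
        by (intro mult_mono cu(1) cv(1) cv0) simp
      then show ?thesis by (simp add: mult_ac)
    qed
    have s4: "summable (\<lambda>n. 4 * (norm (u n \<sigma>) * norm (v n \<sigma>)))" by (rule summable_mult[OF Fs(1)])
    have sc: "summable (\<lambda>n. cu n * cv n)"
    proof (rule summable_comparison_test'[OF s4, of 0])
      show "norm (cu n * cv n) \<le> 4 * (norm (u n \<sigma>) * norm (v n \<sigma>))" for n
        using le4[of n] cu0[of n] cv0[of n] by (simp add: abs_mult)
    qed
    have hc: "((\<lambda>n. cu n * cv n) has_sum (\<Sum>n. cu n * cv n)) UNIV"
      by (rule norm_summable_imp_has_sum) (use sc cu0 cv0 in \<open>simp_all add: abs_mult summable_sums\<close>)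
    have hF: "((\<lambda>n. rk (u n \<sigma>) (v n \<sigma>)) has_sum F \<sigma>) UNIV"
    proof (rule norm_summable_imp_has_sum[OF _ Fs(2)])
      show "summable (\<lambda>n. norm (rk (u n \<sigma>) (v n \<sigma>)))"
        by (rule summable_comparison_test'[OF Fs(1), of 0]) (simp add: norm_rk_le)
    qed
    have fM: "norm (f q) \<le> M q" for q
      unfolding f_def M_def by (rule order_trans[OF norm_rk_le]) (intro mult_mono uz vw norm_ge_zero)
    note res = has_sum_Sigma_majorized[OF Min has_sum_imp_summable[OF hc] fM fin hF]
    have fT: "f q = T q \<sigma> *\<^sub>R rk (Z q) (W q)" for q
      by (auto simp: f_def T_def Z_def W_def rk.scaleR_left rk.scaleR_right rk.zero_left rk.zero_right)
    have "\<bar>T q \<sigma>\<bar> * (norm (Z q) * norm (W q)) \<le> M q" for q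
    proof -
      have "\<bar>T q \<sigma>\<bar> * (norm (Z q) * norm (W q)) \<le>
          norm (a (fst q) (fst (snd q)) \<sigma> *\<^sub>R z (fst q) (fst (snd q))) *
          norm (c (fst q) (snd (snd q)) \<sigma> *\<^sub>R w (fst q) (snd (snd q)))"
        by (auto simp: T_def Z_def W_def abs_mult mult_ac)
      also have "\<dots> \<le> M q" unfolding M_def by (intro mult_mono uz vw norm_ge_zero)
      finally show ?thesis .
    qed
    moreover have "(\<Sum>n. cu n * cv n) \<le> 4 * g \<sigma>"
    proof -
      have "(\<Sum>n. cu n * cv n) \<le> (\<Sum>n. 4 * (norm (u n \<sigma>) * norm (v n \<sigma>)))"
        by (rule suminf_le[OF le4 sc s4])
      also have "\<dots> = 4 * (\<Sum>n. norm (u n \<sigma>) * norm (v n \<sigma>))" by (rule suminf_mult[OF Fs(1)])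
      also have "\<dots> \<le> 4 * g \<sigma>" using g(1)[OF \<sigma>] by simp
      finally show ?thesis .
    qed
    ultimately show ?thesis using res unfolding fT infsumI[OF hc] by blast
  qed
  have cnt: "countable (UNIV :: (nat \<times> (nat \<times> nat) \<times> (nat \<times> nat)) set)" by simp
  obtain N and e :: "nat \<Rightarrow> nat \<times> (nat \<times> nat) \<times> (nat \<times> nat)" where
    e: "\<forall>(f :: _ \<Rightarrow> 'a \<Rightarrow>\<^sub>L 'b) s. (f has_sum s) UNIV \<longrightarrow> (\<lambda>n. if n \<in> N then f (e n) else 0) sums s"
    "\<forall>(f :: _ \<Rightarrow> real) s. (f has_sum s) UNIV \<longrightarrow> (\<lambda>n. if n \<in> N then f (e n) else 0) sums s"
    by (rule countable_enumeration[OF cnt, where 'b = "'a \<Rightarrow>\<^sub>L 'b"])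
  \<comment> \<open>Indices outside N are padding of the enumeration and receive coefficient
    0.\<close>
  define t where "t i \<sigma> = (if i \<in> N then T (e i) \<sigma> else 0)" for i \<sigma>
  define X where "X i = Z (e i)" for i
  define Y where "Y i = W (e i)" for i
  have pt: "nuclear_rep (F \<sigma>) (\<lambda>i. t i \<sigma> *\<^sub>R X i) Y \<and>
      (\<Sum>i. ennreal (\<bar>t i \<sigma>\<bar> * (norm (X i) * norm (Y i)))) \<le> ennreal (4 * g \<sigma>)"
    if \<sigma>: "\<sigma> \<in> space \<rho>" for \<sigma>
  proof -
    obtain M C where hs: "((\<lambda>q. T q \<sigma> *\<^sub>R rk (Z q) (W q)) has_sum F \<sigma>) UNIV" "(M has_sum C) UNIV"
      and MC: "\<forall>q. \<bar>T q \<sigma>\<bar> * (norm (Z q) * norm (W q)) \<le> M q" "C \<le> 4 * g \<sigma>"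
      using point[OF \<sigma>] by (elim exE conjE)
    have sM: "(\<lambda>i. if i \<in> N then M (e i) else 0) sums C" by (rule e(2)[rule_format, OF hs(2)])
    have le: "\<bar>t i \<sigma>\<bar> * (norm (X i) * norm (Y i)) \<le> (if i \<in> N then M (e i) else 0)" for i
      using MC(1)[rule_format, of "e i"] by (simp add: t_def X_def Y_def)
    have sm: "summable (\<lambda>i. \<bar>t i \<sigma>\<bar> * (norm (X i) * norm (Y i)))"
      by (rule summable_comparison_test'[OF sums_summable[OF sM], of 0])
        (unfold real_norm_def abs_mult abs_norm_cancel abs_idempotent, rule le)
    have "(\<lambda>i. if i \<in> N then T (e i) \<sigma> *\<^sub>R rk (Z (e i)) (W (e i)) else 0) sums F \<sigma>"
      by (rule e(1)[rule_format, OF hs(1)])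
    moreover have "(if i \<in> N then T (e i) \<sigma> *\<^sub>R rk (Z (e i)) (W (e i)) else 0) = rk (t i \<sigma> *\<^sub>R X i) (Y i)" for i
      by (simp add: t_def X_def Y_def rk.scaleR_left rk.zero_left)
    ultimately have "(\<lambda>i. rk (t i \<sigma> *\<^sub>R X i) (Y i)) sums F \<sigma>" by simp
    then have "nuclear_rep (F \<sigma>) (\<lambda>i. t i \<sigma> *\<^sub>R X i) Y"
      using sm by (simp add: nuclear_rep_iff mult.assoc)
    moreover have "(\<Sum>i. ennreal (\<bar>t i \<sigma>\<bar> * (norm (X i) * norm (Y i)))) \<le> ennreal (4 * g \<sigma>)"
    proof -
      have "(\<Sum>i. ennreal (\<bar>t i \<sigma>\<bar> * (norm (X i) * norm (Y i)))) =
          ennreal (\<Sum>i. \<bar>t i \<sigma>\<bar> * (norm (X i) * norm (Y i)))"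
        using sm by (intro suminf_ennreal2) auto
      moreover have "(\<Sum>i. \<bar>t i \<sigma>\<bar> * (norm (X i) * norm (Y i))) \<le> C"
        using suminf_le[OF le sm sums_summable[OF sM]] sums_unique[OF sM] by simp
      ultimately show ?thesis using MC(2) by (simp only:) (intro ennreal_leI, linarith)
    qed
    ultimately show ?thesis by blast
  qed
  \<comment> \<open>A measurable function above g almost everywhere, with finite integral; it exists
    because the upper integral is an infimum below \<infinity>.\<close>
  obtain G where G: "G \<in> borel_measurable \<rho>" "AE \<sigma> in \<rho>. ennreal (g \<sigma>) \<le> G \<sigma>" "(\<integral>\<^sup>+\<sigma>. G \<sigma> \<partial>\<rho>) < \<infinity>"
    using g(2) unfolding upper_nn_integral_def Inf_less_iff by blast
  show ?thesis
  proof (rule gp_series[OF K])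
    show "t i \<in> borel_measurable \<rho>" for i unfolding t_def by simp
    show "X i \<in> K" for i unfolding X_def Z_def z_def by (rule pK(1))
    show "Y i \<in> H" for i unfolding Y_def W_def w_def by (rule pH(1))
    show "nuclear_rep (F \<sigma>) (\<lambda>i. t i \<sigma> *\<^sub>R X i) Y" if "\<sigma> \<in> space \<rho>" for \<sigma>
      using pt[OF that] by blast
    have "(\<integral>\<^sup>+\<sigma>. (\<Sum>i. ennreal (\<bar>t i \<sigma>\<bar> * (norm (X i) * norm (Y i)))) \<partial>\<rho>) \<le> (\<integral>\<^sup>+\<sigma>. 4 * G \<sigma> \<partial>\<rho>)"
    proof (rule nn_integral_mono_AE)
      show "AE \<sigma> in \<rho>. (\<Sum>i. ennreal (\<bar>t i \<sigma>\<bar> * (norm (X i) * norm (Y i)))) \<le> 4 * G \<sigma>"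
        using G(2) AE_space
      proof eventually_elim
        case (elim \<sigma>)
        have "ennreal (4 * g \<sigma>) = 4 * ennreal (g \<sigma>)" by (simp add: ennreal_mult')
        then show ?case using pt[OF elim(2)] mult_left_mono[OF elim(1), of 4] by (auto intro: order_trans)
      qed
    qed
    also have "\<dots> = 4 * (\<integral>\<^sup>+\<sigma>. G \<sigma> \<partial>\<rho>)" by (rule nn_integral_cmult[OF G(1)])
    also have "\<dots> < \<infinity>" using G(3) by (simp add: ennreal_mult_less_top)
    finally show "(\<integral>\<^sup>+\<sigma>. (\<Sum>i. ennreal (\<bar>t i \<sigma>\<bar> * (norm (X i) * norm (Y i)))) \<partial>\<rho>) < \<infinity>" .
    show "t i \<sigma> = 0" if "X i = 0 \<or> Y i = 0" for i \<sigma>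
      using that by (auto simp: t_def T_def X_def Y_def Z_def W_def)
  qed
qed

section \<open>Measurability of sections of the functional calculus\<close>

context pvm_space
begin

definition the_calc :: "('w \<Rightarrow> complex) \<Rightarrow> 'a \<Rightarrow>\<^sub>L 'a" where
  "the_calc f = (SOME T. calc f T)"

lemma the_calc_eq: "calc f T \<Longrightarrow> the_calc f = T"
  unfolding the_calc_def using someI[of "calc f" T] calc_unique by blast

lemma calc_the_calc:
  "f \<in> borel_measurable M \<Longrightarrow> (\<And>w. w \<in> space M \<Longrightarrow> cmod (f w) \<le> C) \<Longrightarrow> calc f (the_calc f)"
  unfolding the_calc_def by (rule someI_ex) (rule calc_exists)

text \<open>This is the property propagated by the monotone class argument. Joint measurability is
  part of it so that the sections of a limit are measurable and again admit a calculus
  value.\<close>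

definition strong_sections :: "'s measure \<Rightarrow> ('w \<times> 's \<Rightarrow> complex) \<Rightarrow> bool" where
  "strong_sections \<rho> f \<longleftrightarrow> f \<in> borel_measurable (M \<Otimes>\<^sub>M \<rho>) \<and>
    (\<forall>\<sigma>\<in>space \<rho>. \<exists>T. calc (\<lambda>w. f (w, \<sigma>)) T) \<and>
    (\<forall>v. strong_measurable \<rho> (\<lambda>\<sigma>. the_calc (\<lambda>w. f (w, \<sigma>)) v))"

lemma strong_sections_cong:
  assumes "strong_sections \<rho> f" "\<And>x. x \<in> space (M \<Otimes>\<^sub>M \<rho>) \<Longrightarrow> f x = g x"
  shows "strong_sections \<rho> g"
  unfolding strong_sections_def
proof (intro conjI ballI allI)
  show "g \<in> borel_measurable (M \<Otimes>\<^sub>M \<rho>)"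
    using assms measurable_cong[of "M \<Otimes>\<^sub>M \<rho>" f g borel] unfolding strong_sections_def by blast
  have calc: "calc (\<lambda>w. g (w, \<sigma>)) T" if "calc (\<lambda>w. f (w, \<sigma>)) T" "\<sigma> \<in> space \<rho>" for \<sigma> T
    by (rule calc_cong[OF that(1)]) (use assms(2) that(2) in \<open>simp add: space_pair_measure\<close>)
  show "\<exists>T. calc (\<lambda>w. g (w, \<sigma>)) T" if "\<sigma> \<in> space \<rho>" for \<sigma>
    using assms(1) calc that unfolding strong_sections_def by blast
  fix v
  have "strong_measurable \<rho> (\<lambda>\<sigma>. the_calc (\<lambda>w. f (w, \<sigma>)) v)" using assms(1) unfolding strong_sections_def by blast
  then show "strong_measurable \<rho> (\<lambda>\<sigma>. the_calc (\<lambda>w. g (w, \<sigma>)) v)"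
  proof (rule strong_cong)
    fix \<sigma> assume \<sigma>: "\<sigma> \<in> space \<rho>"
    then obtain T where T: "calc (\<lambda>w. f (w, \<sigma>)) T" using assms(1) unfolding strong_sections_def by blast
    show "the_calc (\<lambda>w. f (w, \<sigma>)) v = the_calc (\<lambda>w. g (w, \<sigma>)) v"
      unfolding the_calc_eq[OF T] the_calc_eq[OF calc[OF T \<sigma>]] ..
  qed
qed

lemma strong_sections_add:
  assumes "strong_sections \<rho> f" "strong_sections \<rho> g"
  shows "strong_sections \<rho> (\<lambda>x. f x + g x)"
  unfolding strong_sections_def
proof (intro conjI ballI allI)
  show "(\<lambda>x. f x + g x) \<in> borel_measurable (M \<Otimes>\<^sub>M \<rho>)"
    using assms unfolding strong_sections_def by (intro borel_measurable_add) auto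
  show "\<exists>T. calc (\<lambda>w. f (w, \<sigma>) + g (w, \<sigma>)) T" if "\<sigma> \<in> space \<rho>" for \<sigma>
    using assms that calc_add unfolding strong_sections_def by blast
  fix v
  have "strong_measurable \<rho> (\<lambda>\<sigma>. the_calc (\<lambda>w. f (w, \<sigma>)) v + the_calc (\<lambda>w. g (w, \<sigma>)) v)"
    using assms unfolding strong_sections_def by (intro strong_add) auto
  then show "strong_measurable \<rho> (\<lambda>\<sigma>. the_calc (\<lambda>w. f (w, \<sigma>) + g (w, \<sigma>)) v)"
  proof (rule strong_cong)
    fix \<sigma> assume \<sigma>: "\<sigma> \<in> space \<rho>"
    obtain S T where S: "calc (\<lambda>w. f (w, \<sigma>)) S" and T: "calc (\<lambda>w. g (w, \<sigma>)) T"
      using assms \<sigma> unfolding strong_sections_def by blast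
    show "the_calc (\<lambda>w. f (w, \<sigma>)) v + the_calc (\<lambda>w. g (w, \<sigma>)) v = the_calc (\<lambda>w. f (w, \<sigma>) + g (w, \<sigma>)) v"
      unfolding the_calc_eq[OF S] the_calc_eq[OF T] the_calc_eq[OF calc_add[OF S T]] by (simp add: blinfun.add_left)
  qed
qed

lemma strong_sections_scale:
  assumes "strong_sections \<rho> f"
  shows "strong_sections \<rho> (\<lambda>x. c * f x)"
  unfolding strong_sections_def
proof (intro conjI ballI allI)
  show "(\<lambda>x. c * f x) \<in> borel_measurable (M \<Otimes>\<^sub>M \<rho>)"
    using assms unfolding strong_sections_def by auto
  show "\<exists>T. calc (\<lambda>w. c * f (w, \<sigma>)) T" if "\<sigma> \<in> space \<rho>" for \<sigma>
    using assms that calc_scale unfolding strong_sections_def by blast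
  fix v
  have "strong_measurable \<rho> (\<lambda>\<sigma>. c *\<^sub>C the_calc (\<lambda>w. f (w, \<sigma>)) v)"
    using assms unfolding strong_sections_def
    by (intro strong_compose[of \<rho> _ "\<lambda>x. c *\<^sub>C x"] linear_continuous_on bounded_linear_scaleC) auto
  then show "strong_measurable \<rho> (\<lambda>\<sigma>. the_calc (\<lambda>w. c * f (w, \<sigma>)) v)"
  proof (rule strong_cong)
    fix \<sigma> assume \<sigma>: "\<sigma> \<in> space \<rho>"
    obtain S where S: "calc (\<lambda>w. f (w, \<sigma>)) S" using assms \<sigma> unfolding strong_sections_def by blast
    show "c *\<^sub>C the_calc (\<lambda>w. f (w, \<sigma>)) v = the_calc (\<lambda>w. c * f (w, \<sigma>)) v"
      unfolding the_calc_eq[OF S] the_calc_eq[OF calc_scale[OF S]] by (simp add: scaleC_blinfun.rep_eq)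
  qed
qed

lemma strong_sections_lim:
  assumes s: "\<And>n. strong_sections \<rho> (s n)" and C: "\<And>n x. x \<in> space (M \<Otimes>\<^sub>M \<rho>) \<Longrightarrow> cmod (s n x) \<le> C"
    and lim: "\<And>x. x \<in> space (M \<Otimes>\<^sub>M \<rho>) \<Longrightarrow> (\<lambda>n. s n x) \<longlonglongrightarrow> f x"
  shows "strong_sections \<rho> f"
proof -
  have f [measurable]: "f \<in> borel_measurable (M \<Otimes>\<^sub>M \<rho>)"
    using s lim by (intro borel_measurable_LIMSEQ_metric[of s _ f]) (auto simp: strong_sections_def)
  have fC: "cmod (f x) \<le> C" if "x \<in> space (M \<Otimes>\<^sub>M \<rho>)" for x
    by (rule LIMSEQ_le_const2[OF tendsto_norm[OF lim[OF that]]]) (use C[OF that] in blast)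
  have sec: "w \<in> space M \<Longrightarrow> \<sigma> \<in> space \<rho> \<Longrightarrow> (w, \<sigma>) \<in> space (M \<Otimes>\<^sub>M \<rho>)" for w \<sigma>
    by (simp add: space_pair_measure)
  have cf: "calc (\<lambda>w. f (w, \<sigma>)) (the_calc (\<lambda>w. f (w, \<sigma>)))" if "\<sigma> \<in> space \<rho>" for \<sigma>
    using that by (intro calc_the_calc[of _ C] fC sec) measurable
  have cs: "calc (\<lambda>w. s n (w, \<sigma>)) (the_calc (\<lambda>w. s n (w, \<sigma>)))" if "\<sigma> \<in> space \<rho>" for n \<sigma>
    using s[of n] that the_calc_eq unfolding strong_sections_def by metis
  have "strong_measurable \<rho> (\<lambda>\<sigma>. the_calc (\<lambda>w. f (w, \<sigma>)) v)" for v
  proof (rule strong_lim)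
    show "strong_measurable \<rho> (\<lambda>\<sigma>. the_calc (\<lambda>w. s n (w, \<sigma>)) v)" for n
      using s[of n] unfolding strong_sections_def by blast
    show "(\<lambda>n. the_calc (\<lambda>w. s n (w, \<sigma>)) v) \<longlonglongrightarrow> the_calc (\<lambda>w. f (w, \<sigma>)) v" if "\<sigma> \<in> space \<rho>" for \<sigma>
      by (rule calc_tendsto[OF cs[OF that] cf[OF that], where C = C]) (intro C lim sec that, assumption)+
  qed
  then show ?thesis using f cf unfolding strong_sections_def by blast
qed

lemma strong_sections_sum:
  "(\<And>i. i \<in> I \<Longrightarrow> strong_sections \<rho> (f i)) \<Longrightarrow> strong_sections \<rho> (\<lambda>x. 0) \<Longrightarrow>
    strong_sections \<rho> (\<lambda>x. \<Sum>i\<in>I. f i x)"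
  by (induction I rule: infinite_finite_induct) (auto intro: strong_sections_add)

lemma strong_sections_rectangle:
  assumes G: "G \<in> sets M" and S: "S \<in> sets \<rho>"
  shows "strong_sections \<rho> (indicator (G \<times> S))"
proof -
  have calc: "calc (\<lambda>w. indicator (G \<times> S) (w, \<sigma>)) (indicator S \<sigma> *\<^sub>C Q G)" for \<sigma>
  proof -
    have "(\<lambda>w. indicator (G \<times> S) (w, \<sigma>)) = (\<lambda>w. indicator S \<sigma> * indicator G w :: complex)"
      by (auto simp: indicator_def)
    then show ?thesis using calc_indicator[OF G] by simp
  qed
  have "strong_measurable \<rho> (\<lambda>\<sigma>. the_calc (\<lambda>w. indicator (G \<times> S) (w, \<sigma>)) v)" for v
  proof -
    have "the_calc (\<lambda>w. indicator (G \<times> S) (w, \<sigma>)) v = indicator S \<sigma> *\<^sub>R Q G v" for \<sigma>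
      unfolding the_calc_eq[OF calc]
      by (cases "\<sigma> \<in> S") (simp_all add: scaleC_blinfun.rep_eq scaleC.zero_left)
    then show ?thesis using strong_indicator_mult[OF strong_const S] by simp
  qed
  then show ?thesis using calc G S unfolding strong_sections_def by auto
qed

text \<open>Rectangles are stable under intersection. A complement is handled by linearity, and a
  countable disjoint union is a limit of partial sums bounded by 1, so Dynkin's induction reaches
  the whole product \<sigma>-algebra.\<close>

lemma strong_sections_indicator:
  assumes "A \<in> sets (M \<Otimes>\<^sub>M \<rho>)"
  shows "strong_sections \<rho> (indicator A)"
proof -
  let ?E = "{a \<times> b |a b. a \<in> sets M \<and> b \<in> sets \<rho>}"
  have A: "A \<in> sigma_sets (space M \<times> space \<rho>) ?E" using assms by (simp add: sets_pair_measure)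
  have E: "?E \<subseteq> Pow (space M \<times> space \<rho>)"
    using pair_measure_closed by blast
  have zero: "strong_sections \<rho> (\<lambda>x. 0)"
    using strong_sections_rectangle[of "{}" "{}" \<rho>] by (simp add: indicator_def[abs_def])
  have one: "strong_sections \<rho> (indicator (space M \<times> space \<rho>))"
    by (rule strong_sections_rectangle) auto
  show ?thesis
    using Int_stable_pair_measure_generator E A
  proof (induction rule: sigma_sets_induct_disjoint)
    case (basic A)
    then show ?case using strong_sections_rectangle by blast
  next
    case empty
    then show ?case using zero by (simp add: indicator_def[abs_def])
  next
    case (compl A)
    show ?case
      by (rule strong_sections_cong[OF strong_sections_add[OF one strong_sections_scale[OF compl(2), of "-1"]]])
        (auto simp: indicator_def space_pair_measure)
  next
    case (union B)
    have sum: "(\<Sum>i<n. indicator (B i) x) = (indicator (\<Union>i<n. B i) x :: complex)" for n x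
      using union(1) by (intro indicator_UN_disjoint[symmetric]) (auto simp: disjoint_family_on_def)
    show ?case
    proof (rule strong_sections_lim[where C = 1])
      show "strong_sections \<rho> (\<lambda>x. \<Sum>i<n. indicator (B i) x)" for n
        by (intro strong_sections_sum union(3) zero)
      show "cmod (\<Sum>i<n. indicator (B i) x) \<le> 1" for n x
        unfolding sum by (simp add: indicator_def)
      show "(\<lambda>n. \<Sum>i<n. indicator (B i) x) \<longlonglongrightarrow> (indicator (\<Union>i. B i) x :: complex)" for x
        unfolding sum by (rule LIMSEQ_indicator_UN)
    qed
  qed
qed

lemma strong_sections_bounded:
  assumes f: "f \<in> borel_measurable (M \<Otimes>\<^sub>M \<rho>)" and C: "\<And>x. x \<in> space (M \<Otimes>\<^sub>M \<rho>) \<Longrightarrow> cmod (f x) \<le> C"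
  shows "strong_sections \<rho> f"
proof -
  have zero: "strong_sections \<rho> (\<lambda>x. 0)"
    using strong_sections_indicator[of "{}" \<rho>] by (simp add: indicator_def[abs_def])
  have simple: "strong_sections \<rho> s" if s: "simple_function (M \<Otimes>\<^sub>M \<rho>) s" for s
  proof -
    let ?\<Omega> = "space (M \<Otimes>\<^sub>M \<rho>)"
    have fin: "finite (s ` ?\<Omega>)" and me: "s -` {y} \<inter> ?\<Omega> \<in> sets (M \<Otimes>\<^sub>M \<rho>)" for y
      using s simple_functionD by auto
    have "strong_sections \<rho> (\<lambda>x. \<Sum>y\<in>s ` ?\<Omega>. y * indicator (s -` {y} \<inter> ?\<Omega>) x)"
      by (intro strong_sections_sum strong_sections_scale strong_sections_indicator me zero)
    then show ?thesis
    proof (rule strong_sections_cong)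
      fix x assume x: "x \<in> ?\<Omega>"
      have "(\<Sum>y\<in>s ` ?\<Omega>. y * indicator (s -` {y} \<inter> ?\<Omega>) x) = (\<Sum>y\<in>s ` ?\<Omega>. if s x = y then y else 0)"
        using x by (intro sum.cong) (auto simp: indicator_def)
      then show "(\<Sum>y\<in>s ` ?\<Omega>. y * indicator (s -` {y} \<inter> ?\<Omega>) x) = s x" using fin x by simp
    qed
  qed
  obtain s where s: "\<forall>i. simple_function (M \<Otimes>\<^sub>M \<rho>) (s i)"
    "\<forall>x\<in>space (M \<Otimes>\<^sub>M \<rho>). (\<lambda>i. s i x) \<longlonglongrightarrow> f x"
    "\<forall>i. \<forall>x\<in>space (M \<Otimes>\<^sub>M \<rho>). dist (s i x) 0 \<le> 2 * dist (f x) 0"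
    using borel_measurable_implies_sequence_metric[OF f, of 0] by blast
  show ?thesis
  proof (rule strong_sections_lim[where C = "2 * C"])
    show "strong_sections \<rho> (s n)" for n using s(1) simple by blast
    show "cmod (s n x) \<le> 2 * C" if "x \<in> space (M \<Otimes>\<^sub>M \<rho>)" for n x
    proof -
      have "cmod (s n x) \<le> 2 * cmod (f x)" using s(3) that by simp
      then show ?thesis using C[OF that] by linarith
    qed
    show "(\<lambda>n. s n x) \<longlonglongrightarrow> f x" if "x \<in> space (M \<Otimes>\<^sub>M \<rho>)" for x using s(2) that by blast
  qed
qed

section \<open>From bounded functions to essentially bounded sections\<close>

lemma Q_null_mono:
  assumes "A \<in> sets M" "B \<in> sets M" "A \<subseteq> B" "Q B = 0"
  shows "Q A = 0"
proof (rule blinfun_eqI)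
  fix v
  have "Q A v = Q (A \<inter> B) v" using assms(3) by (simp add: Int_absorb2)
  also have "\<dots> = Q A (Q B v)" by (rule Q_Int[OF assms(1,2), symmetric])
  finally show "Q A v = blinfun_apply 0 v" by (simp add: assms(4))
qed

text \<open>The essential bound varies with \<sigma> and no measurable choice of it is at hand.
  Truncation at n has a bound uniform in \<sigma>, and at each \<sigma> the truncated operators
  equal the integral as soon as n exceeds an essential bound there.\<close>

lemma strong_pvm_integral:
  assumes f: "(\<lambda>(w, \<sigma>). f w \<sigma>) \<in> borel_measurable (M \<Otimes>\<^sub>M \<rho>)"
    and L: "\<And>\<sigma>. \<sigma> \<in> space \<rho> \<Longrightarrow> (\<lambda>w. f w \<sigma>) \<in> Linfty M Q"
  shows "strong_measurable \<rho> (\<lambda>\<sigma>. pvm_integral M K Q (\<lambda>w. f w \<sigma>) v)"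
    "strong_measurable \<rho> (\<lambda>\<sigma>. cadj (pvm_integral M K Q (\<lambda>w. f w \<sigma>)) v)"
proof -
  note [measurable] = f
  have ev: "\<exists>N. \<forall>n\<ge>N. calc (trunc (real n) (\<lambda>w. f w \<sigma>)) (pvm_integral M K Q (\<lambda>w. f w \<sigma>))"
    if \<sigma>: "\<sigma> \<in> space \<rho>" for \<sigma>
  proof -
    obtain c where c: "c \<ge> 0" "Q {w \<in> space M. c < cmod (f w \<sigma>)} = 0" and
      fm [measurable]: "(\<lambda>w. f w \<sigma>) \<in> borel_measurable M"
      using L[OF \<sigma>] by (auto simp: Linfty_def)
    have "calc (trunc (real n) (\<lambda>w. f w \<sigma>)) (pvm_integral M K Q (\<lambda>w. f w \<sigma>))" if n: "n \<ge> nat \<lceil>c\<rceil>" for n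
    proof (rule pvm_integral_trunc[OF fm])
      have "c \<le> real n" using n by linarith
      then show "Q {w \<in> space M. real n < cmod (f w \<sigma>)} = 0"
        by (intro Q_null_mono[OF _ _ _ c(2)]) auto
    qed simp
    then show ?thesis by blast
  qed
  have T [measurable]: "(\<lambda>x. trunc (real n) (\<lambda>w. f w (snd x)) (fst x)) \<in> borel_measurable (M \<Otimes>\<^sub>M \<rho>)" for n
    using f unfolding trunc_def split_beta by measurable
  have "strong_sections \<rho> (\<lambda>x. trunc (real n) (\<lambda>w. f w (snd x)) (fst x))" for n
    by (rule strong_sections_bounded[OF T, of n "real n"]) (simp add: trunc_le)
  then have 1: "strong_measurable \<rho> (\<lambda>\<sigma>. the_calc (trunc (real n) (\<lambda>w. f w \<sigma>)) v)" for n
    unfolding strong_sections_def by simp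
  have "strong_sections \<rho> (\<lambda>x. cnj (trunc (real n) (\<lambda>w. f w (snd x)) (fst x)))" for n
    by (rule strong_sections_bounded[where C = "real n"]) (simp_all add: trunc_le)
  then have 2: "strong_measurable \<rho> (\<lambda>\<sigma>. the_calc (\<lambda>w. cnj (trunc (real n) (\<lambda>w. f w \<sigma>) w)) v)" for n
    unfolding strong_sections_def by simp
  show "strong_measurable \<rho> (\<lambda>\<sigma>. pvm_integral M K Q (\<lambda>w. f w \<sigma>) v)"
  proof (rule strong_lim[OF 1])
    fix \<sigma> assume "\<sigma> \<in> space \<rho>"
    then obtain N where N: "\<forall>n\<ge>N. calc (trunc (real n) (\<lambda>w. f w \<sigma>)) (pvm_integral M K Q (\<lambda>w. f w \<sigma>))"
      using ev by blast
    have "the_calc (trunc (real n) (\<lambda>w. f w \<sigma>)) v = pvm_integral M K Q (\<lambda>w. f w \<sigma>) v" if "n \<ge> N" for n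
      using the_calc_eq[OF N[rule_format, OF that]] by simp
    then show "(\<lambda>n. the_calc (trunc (real n) (\<lambda>w. f w \<sigma>)) v) \<longlonglongrightarrow> pvm_integral M K Q (\<lambda>w. f w \<sigma>) v"
      by (intro tendsto_eventually) (auto simp: eventually_sequentially)
  qed
  show "strong_measurable \<rho> (\<lambda>\<sigma>. cadj (pvm_integral M K Q (\<lambda>w. f w \<sigma>)) v)"
  proof (rule strong_lim[OF 2])
    fix \<sigma> assume "\<sigma> \<in> space \<rho>"
    then obtain N where N: "\<forall>n\<ge>N. calc (trunc (real n) (\<lambda>w. f w \<sigma>)) (pvm_integral M K Q (\<lambda>w. f w \<sigma>))"
      using ev by blast
    have "the_calc (\<lambda>w. cnj (trunc (real n) (\<lambda>w. f w \<sigma>) w)) v = cadj (pvm_integral M K Q (\<lambda>w. f w \<sigma>)) v" if "n \<ge> N" for n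
      using the_calc_eq[OF calc_cnj[OF N[rule_format, OF that]]] by simp
    then show "(\<lambda>n. the_calc (\<lambda>w. cnj (trunc (real n) (\<lambda>w. f w \<sigma>) w)) v) \<longlonglongrightarrow> cadj (pvm_integral M K Q (\<lambda>w. f w \<sigma>)) v"
      by (intro tendsto_eventually) (auto simp: eventually_sequentially)
  qed
qed

lemma cadj_pvm_integral_bops:
  assumes "f \<in> Linfty M Q"
  shows "cadj (pvm_integral M K Q f) \<in> bops K K"
proof -
  obtain c where "c \<ge> 0" "Q {w \<in> space M. c < cmod (f w)} = 0" "f \<in> borel_measurable M"
    using assms by (auto simp: Linfty_def)
  then show ?thesis using pvm_integral_trunc calc_cnj calc_bops by blast
qed

end

section \<open>The multiple operator integral\<close>

text \<open>The adjoint has a clause of its own because the vectors on the right side come from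
  adjoints, and taking adjoints is not continuous in the strong operator topology.\<close>

definition strong_op :: "'s measure \<Rightarrow> ('s \<Rightarrow> 'a::complex_hilbert \<Rightarrow>\<^sub>L 'b::complex_hilbert) \<Rightarrow> bool" where
  "strong_op \<rho> A \<longleftrightarrow> (\<forall>v. strong_measurable \<rho> (\<lambda>\<sigma>. A \<sigma> v)) \<and>
    (\<forall>v. strong_measurable \<rho> (\<lambda>\<sigma>. cadj (A \<sigma>) v)) \<and> (\<forall>\<sigma>\<in>space \<rho>. clin (A \<sigma>))"

lemma strong_op_const: "clin A \<Longrightarrow> strong_op \<rho> (\<lambda>_. A)"
  by (simp add: strong_op_def strong_const)

lemma strong_op_compose:
  assumes A: "strong_op \<rho> A" and B: "strong_op \<rho> B"
  shows "strong_op \<rho> (\<lambda>\<sigma>. A \<sigma> o\<^sub>L B \<sigma>)"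
  unfolding strong_op_def
proof (intro conjI allI ballI)
  show "clin (A \<sigma> o\<^sub>L B \<sigma>)" if "\<sigma> \<in> space \<rho>" for \<sigma>
    using A B that unfolding strong_op_def by (intro clin_compose) auto
  show "strong_measurable \<rho> (\<lambda>\<sigma>. (A \<sigma> o\<^sub>L B \<sigma>) v)" for v
    unfolding blinfun_apply_blinfun_compose
    by (rule strong_apply) (use A B in \<open>simp_all add: strong_op_def\<close>)
  have "strong_measurable \<rho> (\<lambda>\<sigma>. cadj (B \<sigma>) (cadj (A \<sigma>) v))" for v
    by (rule strong_apply) (use A B in \<open>simp_all add: strong_op_def\<close>)
  then show "strong_measurable \<rho> (\<lambda>\<sigma>. cadj (A \<sigma> o\<^sub>L B \<sigma>) v)" for v
  proof (rule strong_cong)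
    show "cadj (B \<sigma>) (cadj (A \<sigma>) v) = cadj (A \<sigma> o\<^sub>L B \<sigma>) v" if "\<sigma> \<in> space \<rho>" for \<sigma>
      using A B that cadj_compose[of "A \<sigma>" "B \<sigma>"] by (simp add: strong_op_def)
  qed
qed

text \<open>The terminal operator is left free so that \<open>operator_product\<close> can be cut at
  any factor.\<close>

definition chain :: "(nat \<Rightarrow> 'a::real_normed_vector \<Rightarrow>\<^sub>L 'a) \<Rightarrow> (nat \<Rightarrow> 'a \<Rightarrow>\<^sub>L 'a) \<Rightarrow> nat list \<Rightarrow> ('a \<Rightarrow>\<^sub>L 'a) \<Rightarrow> 'a \<Rightarrow>\<^sub>L 'a"
  where "chain A b js X = foldr (\<lambda>j T. A j o\<^sub>L b j o\<^sub>L T) js X"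

lemma chain_simps [simp]:
  "chain A b [] X = X" "chain A b (j # js) X = A j o\<^sub>L b j o\<^sub>L chain A b js X"
  by (simp_all add: chain_def)

lemma chain_append: "chain A b (is @ js) X = chain A b is (chain A b js X)"
  by (simp add: chain_def)

lemma chain_compose: "chain A b js (X o\<^sub>L Y) = chain A b js X o\<^sub>L Y"
proof (induction js)
  case (Cons j js)
  show ?case by (rule blinfun_eqI) (simp add: Cons)
qed simp

lemma strong_op_chain:
  assumes "\<And>j. j \<in> set js \<Longrightarrow> strong_op \<rho> (\<lambda>\<sigma>. A \<sigma> j) \<and> clin (b j)" "strong_op \<rho> X"
  shows "strong_op \<rho> (\<lambda>\<sigma>. chain (A \<sigma>) b js (X \<sigma>))"
  using assms
proof (induction js)
  case (Cons j js)
  have "strong_op \<rho> (\<lambda>\<sigma>. A \<sigma> j o\<^sub>L b j o\<^sub>L chain (A \<sigma>) b js (X \<sigma>))"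
    using Cons by (intro strong_op_compose strong_op_const) auto
  then show ?case by simp
qed simp

lemma norm_chain_le:
  assumes "distinct js" "\<And>j. j \<in> set js \<Longrightarrow> norm (A j) \<le> N j" "norm X \<le> n"
  shows "norm (chain A b js X) \<le> (\<Prod>j\<in>set js. N j) * (\<Prod>j\<in>set js. norm (b j)) * n"
  using assms
proof (induction js)
  case (Cons j js)
  have IH: "norm (chain A b js X) \<le> (\<Prod>j\<in>set js. N j) * (\<Prod>j\<in>set js. norm (b j)) * n"
    using Cons by simp
  have "norm (A j o\<^sub>L b j o\<^sub>L chain A b js X) \<le> (norm (A j) * norm (b j)) * norm (chain A b js X)"
    by (rule order_trans[OF norm_blinfun_compose]) (intro mult_right_mono norm_blinfun_compose norm_ge_zero)
  also have "\<dots> \<le> (N j * norm (b j)) * ((\<Prod>j\<in>set js. N j) * (\<Prod>j\<in>set js. norm (b j)) * n)"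
    using Cons.prems(2)[of j] IH
    by (intro mult_mono mult_right_mono) (auto intro: order_trans[OF norm_ge_zero] mult_nonneg_nonneg)
  finally show ?case using Cons.prems(1) by (simp add: mult_ac)
qed simp

lemma upper_nn_integral_finite_bound:
  assumes "upper_nn_integral \<rho> h < \<infinity>" "\<And>\<sigma>. \<sigma> \<in> space \<rho> \<Longrightarrow> g \<sigma> \<le> ennreal c * h \<sigma>"
  shows "upper_nn_integral \<rho> g < \<infinity>"
proof -
  obtain G where G [measurable]: "G \<in> borel_measurable \<rho>"
    and le: "AE \<sigma> in \<rho>. h \<sigma> \<le> G \<sigma>" and fin: "(\<integral>\<^sup>+\<sigma>. G \<sigma> \<partial>\<rho>) < \<infinity>"
    using assms(1) unfolding upper_nn_integral_def Inf_less_iff by blast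
  have "AE \<sigma> in \<rho>. g \<sigma> \<le> ennreal c * G \<sigma>"
    using le AE_space
  proof eventually_elim
    case (elim \<sigma>)
    then show ?case using assms(2)[OF elim(2)] mult_left_mono[OF elim(1), of "ennreal c"] by (auto intro: order_trans)
  qed
  then have "upper_nn_integral \<rho> g \<le> (\<integral>\<^sup>+\<sigma>. ennreal c * G \<sigma> \<partial>\<rho>)"
    unfolding upper_nn_integral_def by (intro Inf_lower) (auto intro!: exI[of _ "\<lambda>\<sigma>. ennreal c * G \<sigma>"])
  also have "\<dots> = ennreal c * (\<integral>\<^sup>+\<sigma>. G \<sigma> \<partial>\<rho>)" by (rule nn_integral_cmult[OF G])
  also have "\<dots> < \<infinity>" using fin by (simp add: ennreal_mult_less_top)
  finally show ?thesis .
qed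

lemma gp_integrable_moi_integrand:
  fixes k :: nat
    and M :: "nat \<Rightarrow> 'w measure"
    and H :: "nat \<Rightarrow> 'h::complex_hilbert set"
    and Q :: "nat \<Rightarrow> 'w set \<Rightarrow> 'h \<Rightarrow>\<^sub>L 'h"
    and \<rho> :: "'s measure"
    and \<phi>s :: "nat \<Rightarrow> 'w \<Rightarrow> 's \<Rightarrow> complex"
    and b :: "nat \<Rightarrow> 'h \<Rightarrow>\<^sub>L 'h"
  assumes pvm: "\<And>j. j \<in> {1..k + 1} \<Longrightarrow> pvm_space (M j) (H j) (Q j)"
    and meas: "\<And>j. j \<in> {1..k + 1} \<Longrightarrow> (\<lambda>(w, \<sigma>). \<phi>s j w \<sigma>) \<in> borel_measurable (M j \<Otimes>\<^sub>M \<rho>)"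
    and Linf: "\<And>j \<sigma>. j \<in> {1..k + 1} \<Longrightarrow> \<sigma> \<in> space \<rho> \<Longrightarrow> (\<lambda>w. \<phi>s j w \<sigma>) \<in> Linfty (M j) (Q j)"
    and upper: "upper_nn_integral \<rho>
      (\<lambda>\<sigma>. \<Prod>j\<in>{1..k + 1}. ennreal (Linfty_norm (M j) (Q j) (\<lambda>w. \<phi>s j w \<sigma>))) < \<infinity>"
    and b: "\<And>j. j \<in> {1..k} \<Longrightarrow> clin (b j)"
    and i: "i \<in> {1..k}" "b i \<in> trace_class H' K'"
  shows "gp_integrable (trace_class (H (k + 1)) (H 1)) trace_norm \<rho> (moi_integrand k M H Q \<phi>s b)"
proof -
  define A where "A \<sigma> j = pvm_integral (M j) (H j) (Q j) (\<lambda>w. \<phi>s j w \<sigma>)" for \<sigma> j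
  define N where "N \<sigma> j = Linfty_norm (M j) (Q j) (\<lambda>w. \<phi>s j w \<sigma>)" for \<sigma> j
  have A_bops: "A \<sigma> j \<in> bops (H j) (H j)" and A_adj: "cadj (A \<sigma> j) \<in> bops (H j) (H j)"
    and AN: "norm (A \<sigma> j) \<le> N \<sigma> j" if "j \<in> {1..k + 1}" "\<sigma> \<in> space \<rho>" for \<sigma> j
    unfolding A_def N_def
    using pvm_space.pvm_integral_bops[OF pvm Linf] pvm_space.cadj_pvm_integral_bops[OF pvm Linf]
      pvm_space.norm_pvm_integral_le[OF pvm Linf] that by blast+
  have N0: "0 \<le> N \<sigma> j" if "j \<in> {1..k + 1}" "\<sigma> \<in> space \<rho>" for \<sigma> j
    by (rule order_trans[OF norm_ge_zero AN[OF that]])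
  have A_strong: "strong_op \<rho> (\<lambda>\<sigma>. A \<sigma> j)" if j: "j \<in> {1..k + 1}" for j
    unfolding strong_op_def
  proof (intro conjI allI ballI)
    show "clin (A \<sigma> j)" if "\<sigma> \<in> space \<rho>" for \<sigma> using A_bops[OF j that] by (rule clin_bops)
    show "strong_measurable \<rho> (\<lambda>\<sigma>. A \<sigma> j v)" "strong_measurable \<rho> (\<lambda>\<sigma>. cadj (A \<sigma> j) v)" for v
      unfolding A_def using pvm_space.strong_pvm_integral[OF pvm[OF j] meas[OF j] Linf[OF j]] by blast+
  qed
  have i_in: "1 \<le> i" "i \<le> k" using i(1) by auto
  \<comment> \<open>The cut is made around \<open>b i\<close>: L ends with the factor A \<sigma> i,
    and R starts with the factor of index i + 1. For i = 1 or i = k the corresponding list is empty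
    and one factor remains.\<close>
  let ?l = "[1..<i]" and ?r = "[Suc i..<k + 1]"
  define L where "L \<sigma> = chain (A \<sigma>) b ?l (A \<sigma> i)" for \<sigma>
  define R where "R \<sigma> = chain (A \<sigma>) b ?r (A \<sigma> (k + 1))" for \<sigma>
  have F: "moi_integrand k M H Q \<phi>s b \<sigma> = L \<sigma> o\<^sub>L b i o\<^sub>L R \<sigma>" for \<sigma>
  proof -
    have "[1..<k + 1] = ?l @ i # ?r"
      using i_in upt_add_eq_append[of 1 i "k + 1 - i"] upt_conv_Cons[of i "k + 1"] by simp
    then have "moi_integrand k M H Q \<phi>s b \<sigma> = chain (A \<sigma>) b (?l @ i # ?r) (A \<sigma> (k + 1))"
      unfolding moi_integrand_def operator_product_def chain_def A_def[abs_def] by simp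
    also have "\<dots> = L \<sigma> o\<^sub>L b i o\<^sub>L R \<sigma>"
      by (simp add: chain_append chain_compose L_def R_def)
    finally show ?thesis .
  qed
  have L_strong: "strong_op \<rho> L" and R_strong: "strong_op \<rho> R"
    unfolding L_def R_def using i_in A_strong b by (intro strong_op_chain; auto)+
  have L_clin: "clin (L \<sigma>)" and R_clin: "clin (R \<sigma>)" if "\<sigma> \<in> space \<rho>" for \<sigma>
    using L_strong R_strong that by (simp_all add: strong_op_def)
  \<comment> \<open>The leftmost factor is A \<sigma> 1 in either case: as the terminal operator if
    i = 1, otherwise as the head of the list.\<close>
  have L_in: "L \<sigma> x \<in> H 1" if \<sigma>: "\<sigma> \<in> space \<rho>" for \<sigma> x
  proof (cases "i = 1")
    case True
    then show ?thesis using bopsD(2)[OF A_bops[OF _ \<sigma>, of 1]] by (simp add: L_def)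
  next
    case False
    then have "?l = 1 # [Suc 1..<i]" using i_in by (simp add: upt_conv_Cons)
    then show ?thesis using bopsD(2)[OF A_bops[OF _ \<sigma>, of 1]] by (simp add: L_def)
  qed
  have R_in: "cadj (R \<sigma>) y \<in> H (k + 1)" if \<sigma>: "\<sigma> \<in> space \<rho>" for \<sigma> y
  proof -
    \<comment> \<open>Splitting off the rightmost factor makes
      \<open>cadj (A \<sigma> (k + 1))\<close> the outermost operator of the adjoint, which
      determines its range.\<close>
    let ?Z = "chain (A \<sigma>) b ?r id_blinfun"
    have "strong_op \<rho> (\<lambda>\<sigma>. chain (A \<sigma>) b ?r id_blinfun)"
      using i_in A_strong b by (intro strong_op_chain strong_op_const) (auto simp: clin_def)
    then have "clin ?Z" using \<sigma> by (simp add: strong_op_def)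
    moreover have "R \<sigma> = ?Z o\<^sub>L A \<sigma> (k + 1)"     proof -
      have "A \<sigma> (k + 1) = id_blinfun o\<^sub>L A \<sigma> (k + 1)" by (rule blinfun_eqI) simp
      then show ?thesis unfolding R_def by (metis chain_compose)
    qed
    moreover have "clin (A \<sigma> (k + 1))" by (rule clin_bops[OF A_bops[OF _ \<sigma>]]) simp
    ultimately have "cadj (R \<sigma>) y = cadj (A \<sigma> (k + 1)) (cadj ?Z y)" by (simp add: cadj_compose)
    then show ?thesis using bopsD(2)[OF A_adj[OF _ \<sigma>, of "k + 1"]] by simp
  qed
  obtain x y where xy: "nuclear_rep (b i) x y" using i(2) by (rule trace_class_nuclear)
  define s where "s = (\<Sum>n. norm (x n) * norm (y n))"
  have sxy: "summable (\<lambda>n. norm (x n) * norm (y n))" using xy by (simp add: nuclear_rep_def)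
  define B where "B = (\<Prod>j\<in>set ?l. norm (b j)) * (\<Prod>j\<in>set ?r. norm (b j))"
  have B0: "0 \<le> B" unfolding B_def by (intro mult_nonneg_nonneg prod_nonneg) auto
  have s0: "0 \<le> s" unfolding s_def by (intro suminf_nonneg sxy) auto
  \<comment> \<open>Here s sums the norms of the rank one terms of \<open>b i\<close>, and B
    collects the norms of the other b j. Up to the constant B * s this is the product in condition
    (ii) of the decomposition, so its upper integral is finite.\<close>
  define g where "g \<sigma> = B * (\<Prod>j\<in>{1..k + 1}. N \<sigma> j) * s" for \<sigma>
  have LR: "norm (L \<sigma>) * norm (R \<sigma>) \<le> B * (\<Prod>j\<in>{1..k + 1}. N \<sigma> j)" if \<sigma>: "\<sigma> \<in> space \<rho>" for \<sigma>
  proof -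
    have L: "norm (L \<sigma>) \<le> (\<Prod>j\<in>set ?l. N \<sigma> j) * (\<Prod>j\<in>set ?l. norm (b j)) * N \<sigma> i"
      unfolding L_def using i_in by (intro norm_chain_le AN \<sigma>) auto
    have R: "norm (R \<sigma>) \<le> (\<Prod>j\<in>set ?r. N \<sigma> j) * (\<Prod>j\<in>set ?r. norm (b j)) * N \<sigma> (k + 1)"
      unfolding R_def using i_in by (intro norm_chain_le AN \<sigma>) auto
    have "{1..k + 1} = insert i (insert (k + 1) (set ?l \<union> set ?r))" using i_in by auto
    moreover have "prod (N \<sigma>) (insert i (insert (k + 1) (set ?l \<union> set ?r))) =
        N \<sigma> i * prod (N \<sigma>) (insert (k + 1) (set ?l \<union> set ?r))"
      using i_in by (intro prod.insert) auto
    moreover have "prod (N \<sigma>) (insert (k + 1) (set ?l \<union> set ?r)) = N \<sigma> (k + 1) * prod (N \<sigma>) (set ?l \<union> set ?r)"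
      using i_in by (intro prod.insert) auto
    moreover have "prod (N \<sigma>) (set ?l \<union> set ?r) = prod (N \<sigma>) (set ?l) * prod (N \<sigma>) (set ?r)"
      by (intro prod.union_disjoint) auto
    ultimately have "prod (N \<sigma>) {1..k + 1} =
        N \<sigma> i * (N \<sigma> (k + 1) * (prod (N \<sigma>) (set ?l) * prod (N \<sigma>) (set ?r)))"
      by (simp only:)
    moreover have "norm (L \<sigma>) * norm (R \<sigma>) \<le> ((\<Prod>j\<in>set ?l. N \<sigma> j) * (\<Prod>j\<in>set ?l. norm (b j)) * N \<sigma> i) *
        ((\<Prod>j\<in>set ?r. N \<sigma> j) * (\<Prod>j\<in>set ?r. norm (b j)) * N \<sigma> (k + 1))"
      by (intro mult_mono L R norm_ge_zero order_trans[OF norm_ge_zero L])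
    ultimately show ?thesis unfolding B_def by (simp only: mult_ac)
  qed
  interpret P1: pvm_space "M 1" "H 1" "Q 1" by (rule pvm) simp
  interpret Pk: pvm_space "M (k + 1)" "H (k + 1)" "Q (k + 1)" by (rule pvm) simp
  show ?thesis
  proof (rule gp_family[where pK = "Q 1 (space (M 1))" and pH = "Q (k + 1) (space (M (k + 1)))" and u = "\<lambda>n \<sigma>. L \<sigma> (x n)" and v = "\<lambda>n \<sigma>. cadj (R \<sigma>) (y n)" and g = g])
    show "closed_csubspace (H 1)" by (rule P1.K)
    show "Q 1 (space (M 1)) z \<in> H 1" "norm (Q 1 (space (M 1)) z) \<le> norm z" for z
      by (rule P1.Q_in, simp, rule P1.norm_Q_le, simp)
    show "Q 1 (space (M 1)) z = z" if "z \<in> H 1" for z using that by (rule P1.Q_space)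
    show "Q (k + 1) (space (M (k + 1))) z \<in> H (k + 1)" "norm (Q (k + 1) (space (M (k + 1))) z) \<le> norm z" for z
      by (rule Pk.Q_in, simp, rule Pk.norm_Q_le, simp)
    show "Q (k + 1) (space (M (k + 1))) z = z" if "z \<in> H (k + 1)" for z using that by (rule Pk.Q_space)
    show "strong_measurable \<rho> (\<lambda>\<sigma>. L \<sigma> (x n))" "strong_measurable \<rho> (\<lambda>\<sigma>. cadj (R \<sigma>) (y n))" for n
      using L_strong R_strong by (simp_all add: strong_op_def)
    show "L \<sigma> (x n) \<in> H 1" "cadj (R \<sigma>) (y n) \<in> H (k + 1)" if "\<sigma> \<in> space \<rho>" for n \<sigma>
      using L_in R_in that by blast+
    have le: "norm (L \<sigma> (x n)) * norm (cadj (R \<sigma>) (y n)) \<le> (norm (L \<sigma>) * norm (R \<sigma>)) * (norm (x n) * norm (y n))"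
      if "\<sigma> \<in> space \<rho>" for n \<sigma>
    proof -
      have "norm (cadj (R \<sigma>) (y n)) \<le> norm (R \<sigma>) * norm (y n)"
        by (rule order_trans[OF norm_blinfun]) (intro mult_right_mono norm_cadj_le R_clin that norm_ge_zero)
      then have "norm (L \<sigma> (x n)) * norm (cadj (R \<sigma>) (y n)) \<le> (norm (L \<sigma>) * norm (x n)) * (norm (R \<sigma>) * norm (y n))"
        by (intro mult_mono norm_blinfun) auto
      then show ?thesis by (simp add: mult_ac)
    qed
    have sum: "summable (\<lambda>n. norm (L \<sigma> (x n)) * norm (cadj (R \<sigma>) (y n)))" if "\<sigma> \<in> space \<rho>" for \<sigma>
      by (rule summable_comparison_test'[OF summable_mult[OF sxy], of 0])
        (unfold real_norm_def abs_mult abs_norm_cancel, rule le[OF that])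
    show "nuclear_rep (moi_integrand k M H Q \<phi>s b \<sigma>) (\<lambda>n. L \<sigma> (x n)) (\<lambda>n. cadj (R \<sigma>) (y n))"
      if \<sigma>: "\<sigma> \<in> space \<rho>" for \<sigma>
      unfolding nuclear_rep_def
    proof (intro conjI allI sum \<sigma>)
      fix h
      have "(\<lambda>n. cinner (R \<sigma> h) (y n) *\<^sub>C x n) sums b i (R \<sigma> h)" using xy by (simp add: nuclear_rep_def)
      then have "(\<lambda>n. L \<sigma> (cinner (R \<sigma> h) (y n) *\<^sub>C x n)) sums L \<sigma> (b i (R \<sigma> h))"
        by (rule bounded_linear.sums[OF blinfun.bounded_linear_right])
      then show "(\<lambda>n. cinner h (cadj (R \<sigma>) (y n)) *\<^sub>C L \<sigma> (x n)) sums moi_integrand k M H Q \<phi>s b \<sigma> h"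
        by (simp add: F clinD[OF L_clin[OF \<sigma>]] cinner_cadj[OF R_clin[OF \<sigma>]])
    qed
    show "(\<Sum>n. norm (L \<sigma> (x n)) * norm (cadj (R \<sigma>) (y n))) \<le> g \<sigma>" if \<sigma>: "\<sigma> \<in> space \<rho>" for \<sigma>
    proof -
      have "(\<Sum>n. norm (L \<sigma> (x n)) * norm (cadj (R \<sigma>) (y n))) \<le>
          (\<Sum>n. (norm (L \<sigma>) * norm (R \<sigma>)) * (norm (x n) * norm (y n)))"
        by (intro suminf_le le sum \<sigma> summable_mult sxy)
      also have "\<dots> = (norm (L \<sigma>) * norm (R \<sigma>)) * s" unfolding s_def by (rule suminf_mult[OF sxy])
      also have "\<dots> \<le> g \<sigma>" unfolding g_def by (intro mult_right_mono LR \<sigma> s0)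
      finally show ?thesis .
    qed
    show "upper_nn_integral \<rho> (\<lambda>\<sigma>. ennreal (g \<sigma>)) < \<infinity>"
    proof (rule upper_nn_integral_finite_bound[OF upper, where c = "B * s"])
      fix \<sigma> assume \<sigma>: "\<sigma> \<in> space \<rho>"
      have "ennreal (g \<sigma>) = ennreal ((B * s) * (\<Prod>j\<in>{1..k + 1}. N \<sigma> j))" by (simp only: g_def mult_ac)
      also have "\<dots> = ennreal (B * s) * ennreal (\<Prod>j\<in>{1..k + 1}. N \<sigma> j)"
        using B0 s0 by (intro ennreal_mult') simp
      also have "ennreal (\<Prod>j\<in>{1..k + 1}. N \<sigma> j) = (\<Prod>j\<in>{1..k + 1}. ennreal (N \<sigma> j))"
        by (rule prod_ennreal[symmetric]) (rule N0[OF _ \<sigma>])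
      finally show "ennreal (g \<sigma>) \<le> ennreal (B * s) *
          (\<Prod>j\<in>{1..k + 1}. ennreal (Linfty_norm (M j) (Q j) (\<lambda>w. \<phi>s j w \<sigma>)))"
        unfolding N_def by simp
    qed
  qed
qed

theorem theorem4p2p9:
  fixes k :: nat
    and M :: "nat \<Rightarrow> 'w measure"
    and H :: "nat \<Rightarrow> 'h::complex_hilbert set"
    and Q :: "nat \<Rightarrow> 'w set \<Rightarrow> 'h \<Rightarrow>\<^sub>L 'h"
    and K :: "'t::complex_hilbert set"
    and tens :: "(nat \<Rightarrow> 'h) \<Rightarrow> 't"
    and P :: "(nat \<Rightarrow> 'w) set \<Rightarrow> 't \<Rightarrow>\<^sub>L 't"
    and \<phi> :: "(nat \<Rightarrow> 'w) \<Rightarrow> complex"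
    and \<rho> :: "'s measure"
    and \<phi>s :: "nat \<Rightarrow> 'w \<Rightarrow> 's \<Rightarrow> complex"
    and b :: "nat \<Rightarrow> 'h \<Rightarrow>\<^sub>L 'h"
  assumes "1 \<le> k"
    and "\<forall>j\<in>{1..k + 1}. pvm (M j) (H j) (Q j)"
    and "hilbert_tensor_product {1..k + 1} H K tens"
    and "is_product_pvm {1..k + 1} M H Q K tens P"
    and "integral_projective_decomposition {1..k + 1} M Q P \<phi> \<rho> \<phi>s"
    and "\<forall>j\<in>{1..k}. b j \<in> bops (H (j + 1)) (H j)"
    and "\<exists>j\<in>{1..k}. b j \<in> trace_class (H (j + 1)) (H j)"
  shows "(\<forall>\<sigma>\<in>space \<rho>. moi_integrand k M H Q \<phi>s b \<sigma> \<in> trace_class (H (k + 1)) (H 1)) \<and>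
    gp_integrable (trace_class (H (k + 1)) (H 1)) trace_norm \<rho> (moi_integrand k M H Q \<phi>s b) \<and>
    moi k M H Q \<rho> \<phi>s b \<in> trace_class (H (k + 1)) (H 1) \<and>
    gp_integral (trace_class (H (k + 1)) (H 1)) trace_norm \<rho> (moi_integrand k M H Q \<phi>s b) (space \<rho>)
      = moi k M H Q \<rho> \<phi>s b"
proof -
  have pvm: "pvm_space (M j) (H j) (Q j)" if "j \<in> {1..k + 1}" for j
    using assms(2) that by (simp add: pvm_space_def)
  obtain i where i: "i \<in> {1..k}" "b i \<in> trace_class (H (i + 1)) (H i)" using assms(7) by blast
  note dec = assms(5)[unfolded integral_projective_decomposition_def]
  have gp: "gp_integrable (trace_class (H (k + 1)) (H 1)) trace_norm \<rho> (moi_integrand k M H Q \<phi>s b)"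
  proof (rule gp_integrable_moi_integrand)
    show "pvm_space (M j) (H j) (Q j)" if "j \<in> {1..k + 1}" for j by (rule pvm[OF that])
    show "i \<in> {1..k}" "b i \<in> trace_class (H (i + 1)) (H i)" by (rule i)+
    show "clin (b j)" if "j \<in> {1..k}" for j
    proof (rule clin_bops)
      show "b j \<in> bops (H (j + 1)) (H j)" using assms(6) that by blast
    qed
  qed (use dec in blast)+
  have closed: "closed_csubspace (H 1)" "closed_csubspace (H (k + 1))"
    using pvm_space.K[OF pvm] by simp_all
  show ?thesis
    using gp gp_integral_eq_pettis[OF closed(2,1) gp] unfolding moi_def gp_integrable_def by blast
qed

end
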